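(* Let $G$ be a compact Lie group with Lie algebra $\mathfrak g$ and a fixed invariant inner product on $\mathfrak g$. Assume that the adjoint action $\mathrm{Ad}:G\to \mathrm{O}(\mathfrak g)$ lifts to a group homomorphism $\tau:G\to \mathrm{Pin}(\mathfrak g)$, and let $\mathcal T\in\Omega(G)$ be the differential form defined by $\tau$. For any group valued Hamiltonian $G$-manifold $(M,\omega,\Phi)$, the top form degree part $\Gamma_{[\dim M]}$ of the differential form $$\Gamma=\exp(\omega)\,\Phi^*\mathcal T$$ is a volume form on $M$ (i.e. nowhere vanishing). On the subset of $M$ where $\omega$ is non-degenerate, $$\Gamma_{[\dim M]}=\pm\frac{\exp(\omega)_{[\dim M]}}{\big|\det\big(\frac{1+\mathrm{Ad}_{\Phi}}{2}\big)\big|^{1/2}},$$ where the signs depend on the choice of lift $\tau$.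
   Context: $G$ is a compact Lie group (possibly disconnected), $\mathfrak g$ its Lie algebra, with a fixed $\mathrm{Ad}(G)$-invariant inner product "$\cdot$". $\theta^L=g^{-1}dg$ and $\theta^R=dg\,g^{-1}$ are the left/right invariant Maurer–Cartan forms. For a $G$-manifold $M$ and $\xi\in\mathfrak g$, the generating vector field is $\xi_M(m)=\frac{d}{dt}|_{t=0}\exp(-t\xi).m$. Put $\eta=\frac1{12}\theta^L\cdot[\theta^L,\theta^L]\in\Omega^3(G)$. A group valued Hamiltonian $G$-manifold is a triple $(M,\omega,\Phi)$ with $M$ a $G$-manifold, $\omega$ a $G$-invariant 2-form and $\Phi:M\to G$ a smooth map equivariant for the conjugation action on $G$, such that (i) $d\omega=\Phi^*\eta$; (ii) $\iota(\xi_M)\omega=\frac12\Phi^*(\theta^L+\theta^R)\cdot\xi$ for all $\xi\in\mathfrak g$; (iii) $\ker\omega_m=\{\xi_M(m)\mid(\mathrm{Ad}_{\Phi(m)}+1)\xi=0\}$ for all $m\in M$. Clifford algebra: for an orthonormal basis $e_i$ of $\mathfrak g$, $\mathrm{Cl}(\mathfrak g)$ has generators $x_i$ (corresponding to $e_i$) with relations $x_ix_j+x_jx_i=\delta_{ij}$. Let $\alpha$ be its parity automorphism and $\widetilde{\mathrm{Ad}}(x)y=\alpha(x)yx^{-1}$. $\mathrm{Pin}(\mathfrak g)\subset\mathrm{Cl}(\mathfrak g)^\times$ is the group generated by elements $\xi\in\mathfrak g\subset\mathrm{Cl}(\mathfrak g)$ with $\xi\cdot\xi=2$; $\widetilde{\mathrm{Ad}}:\mathrm{Pin}(\mathfrak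 g)\to\mathrm O(\mathfrak g)$ is a double covering, and a lift $\tau$ means $\widetilde{\mathrm{Ad}}\circ\tau=\mathrm{Ad}$. The symbol map $\sigma:\mathrm{Cl}(\mathfrak g)\to\wedge\mathfrak g$ is the linear map $x_{i_1}\cdots x_{i_s}\mapsto y_{i_1}\cdots y_{i_s}$ for $i_1<\dots<i_s$, with $y_i$ the generators of $\wedge\mathfrak g$. The form $\mathcal T\in\Omega(G)$: its value at $g$ is obtained from $\sigma(\tau(g))\in\wedge\mathfrak g$ by replacing each $y_i$ with $\frac12(\theta^R_i)_g$, where $\theta^R_i=\theta^R\cdot e_i$. $\beta_{[k]}$ denotes the degree $k$ part of a form $\beta$. $\mathrm{Ad}_\Phi$ at $m$ is $\mathrm{Ad}_{\Phi(m)}$ on $\mathfrak g$. *)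

theory Defs
  imports "HOL-Analysis.Analysis" "HOL-Algebra.Generated_Groups" "HOL-Algebra.Group_Action"
    "Jordan_Normal_Form.Determinant"
begin

section \<open>Smooth manifolds\<close>

primrec Ck_on :: "nat \<Rightarrow> 'a::real_normed_vector set \<Rightarrow> ('a \<Rightarrow> 'b::real_normed_vector) \<Rightarrow> bool" where
  "Ck_on 0 S f \<longleftrightarrow> continuous_on S f"
| "Ck_on (Suc k) S f \<longleftrightarrow> (\<forall>x\<in>S. f differentiable (at x)) \<and>
     (\<forall>v. Ck_on k S (\<lambda>x. frechet_derivative f (at x) v))"

text \<open>Only used for open \<open>S\<close> in a finite-dimensional space, where it means \<open>C\<close>-infinity.\<close>

definition smooth_on :: "'a::real_normed_vector set \<Rightarrow> ('a \<Rightarrow> 'b::real_normed_vector) \<Rightarrow> bool" where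
  "smooth_on S f \<longleftrightarrow> (\<forall>k. Ck_on k S f)"

type_synonym ('m, 'v) chart = "'m set \<times> ('m \<Rightarrow> 'v)"

text \<open>A chart is a pair of its domain and its coordinate map into the model space \<open>'v\<close>.\<close>

record ('m, 'v) manifold =
  mtop :: "'m topology"
  atlas :: "('m, 'v) chart set"

abbreviation points :: "('m, 'v) manifold \<Rightarrow> 'm set" where
  "points M \<equiv> topspace (mtop M)"

definition chart_inv :: "('m, 'v) chart \<Rightarrow> 'v \<Rightarrow> 'm" where
  "chart_inv c = inv_into (fst c) (snd c)"

text \<open>The model space is only required to be finite-dimensional, so that zero-dimensional
  manifolds (e.g. finite groups, isolated points), which the class \<open>euclidean_space\<close> would
  exclude, are admitted.  The atlas need not be maximal.\<close>

definition smooth_manifold :: "('m, 'v::real_normed_vector) manifold \<Rightarrow> bool" where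
  "smooth_manifold M \<longleftrightarrow>
     (\<exists>B::'v set. finite B \<and> span B = UNIV) \<and>
     Hausdorff_space (mtop M) \<and> second_countable (mtop M) \<and>
     \<Union> (fst ` atlas M) = points M \<and>
     (\<forall>c\<in>atlas M. openin (mtop M) (fst c) \<and> open (snd c ` fst c) \<and>
        homeomorphic_map (subtopology (mtop M) (fst c)) (top_of_set (snd c ` fst c)) (snd c)) \<and>
     (\<forall>c\<in>atlas M. \<forall>d\<in>atlas M. smooth_on (snd c ` (fst c \<inter> fst d)) (snd d \<circ> chart_inv c))"

definition mdim :: "('m, 'v::real_normed_vector) manifold \<Rightarrow> nat" where
  "mdim M = dim (UNIV :: 'v set)"

definition prod_manifold ::
  "('m, 'v::real_normed_vector) manifold \<Rightarrow> ('n, 'w::real_normed_vector) manifold \<Rightarrow> ('m \<times> 'n, 'v \<times> 'w) manifold"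
  where
  "prod_manifold M N = \<lparr>mtop = prod_topology (mtop M) (mtop N),
     atlas = {(fst c \<times> fst d, map_prod (snd c) (snd d)) |c d. c \<in> atlas M \<and> d \<in> atlas N}\<rparr>"

definition real_line :: "(real, real) manifold" where
  "real_line = \<lparr>mtop = euclidean, atlas = {(UNIV, id)}\<rparr>"

definition coord_rep :: "('m, 'v) chart \<Rightarrow> ('n, 'w) chart \<Rightarrow> ('m \<Rightarrow> 'n) \<Rightarrow> 'v \<Rightarrow> 'w" where
  "coord_rep c d f = snd d \<circ> f \<circ> chart_inv c"

definition smooth_map ::
  "('m, 'v::real_normed_vector) manifold \<Rightarrow> ('n, 'w::real_normed_vector) manifold \<Rightarrow> ('m \<Rightarrow> 'n) \<Rightarrow> bool"
  where
  "smooth_map M N f \<longleftrightarrow> continuous_map (mtop M) (mtop N) f \<and>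
     (\<forall>c\<in>atlas M. \<forall>d\<in>atlas N. smooth_on (snd c ` (fst c \<inter> f -` fst d)) (coord_rep c d f))"

text \<open>The tangent space at \<open>p\<close> is the model space, identified through one chart
  \<open>chart_at M p\<close> around \<open>p\<close>, selected once and for all.\<close>

definition chart_at :: "('m, 'v) manifold \<Rightarrow> 'm \<Rightarrow> ('m, 'v) chart" where
  "chart_at M p = (SOME c. c \<in> atlas M \<and> p \<in> fst c)"

definition coord_at :: "('m, 'v) manifold \<Rightarrow> 'm \<Rightarrow> 'v" where
  "coord_at M p = snd (chart_at M p) p"

definition tangent_map ::
  "('m, 'v::real_normed_vector) manifold \<Rightarrow> ('n, 'w::real_normed_vector) manifold \<Rightarrow> ('m \<Rightarrow> 'n) \<Rightarrow> 'm \<Rightarrow> 'v \<Rightarrow> 'w"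
  where
  "tangent_map M N f p =
     frechet_derivative (coord_rep (chart_at M p) (chart_at N (f p)) f) (at (coord_at M p))"

text \<open>A vector field \<open>X\<close> (in the identifications above) written in the coordinates of the
  chart \<open>c\<close>, and the Lie bracket of vector fields.\<close>

definition vf_rep :: "('m, 'v::real_normed_vector) manifold \<Rightarrow> ('m, 'v) chart \<Rightarrow> ('m \<Rightarrow> 'v) \<Rightarrow> 'v \<Rightarrow> 'v" where
  "vf_rep M c X x = (let p = chart_inv c x in
     frechet_derivative (coord_rep (chart_at M p) c id) (at (coord_at M p)) (X p))"

definition lie_bracket ::
  "('m, 'v::real_normed_vector) manifold \<Rightarrow> ('m \<Rightarrow> 'v) \<Rightarrow> ('m \<Rightarrow> 'v) \<Rightarrow> 'm \<Rightarrow> 'v" where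
  "lie_bracket M X Y p =
     frechet_derivative (vf_rep M (chart_at M p) Y) (at (coord_at M p)) (X p)
     - frechet_derivative (vf_rep M (chart_at M p) X) (at (coord_at M p)) (Y p)"


section \<open>Exterior algebra of alternating multilinear forms\<close>

text \<open>An inhomogeneous multilinear form on \<open>'v\<close> is a function on lists of vectors; its degree \<open>k\<close>
  part is its restriction to lists of length \<open>k\<close>.\<close>

type_synonym 'v mform = "'v list \<Rightarrow> real"

definition degree_part :: "nat \<Rightarrow> 'v mform \<Rightarrow> 'v mform" where
  "degree_part k b = (\<lambda>vs. if length vs = k then b vs else 0)"

definition alternating_form :: "nat \<Rightarrow> ('v::real_vector) mform \<Rightarrow> bool" where
  "alternating_form k b \<longleftrightarrow>
     (\<forall>vs. length vs \<noteq> k \<longrightarrow> b vs = 0) \<and>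
     (\<forall>vs i. length vs = k \<longrightarrow> i < k \<longrightarrow> linear (\<lambda>x. b (vs[i := x]))) \<and>
     (\<forall>vs i j. length vs = k \<longrightarrow> i < j \<longrightarrow> j < k \<longrightarrow> vs ! i = vs ! j \<longrightarrow> b vs = 0)"

definition unit_form :: "'v mform" where
  "unit_form vs = (if vs = [] then 1 else 0)"

definition one_form :: "('v \<Rightarrow> real) \<Rightarrow> 'v mform" where
  "one_form f vs = (case vs of [v] \<Rightarrow> f v | _ \<Rightarrow> 0)"

text \<open>The wedge product as a signed sum over shuffles: \<open>S\<close> is the set of positions fed into the
  first factor.  Normalised so that \<open>(a \<and> b)(u, v) = a(u) b(v) - a(v) b(u)\<close> for one-forms.\<close>

definition wedge :: "'v mform \<Rightarrow> 'v mform \<Rightarrow> 'v mform" where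
  "wedge a b vs = (\<Sum>S\<in>Pow {..<length vs}.
     (- 1) ^ card {(i, j). i \<in> {..<length vs} - S \<and> j \<in> S \<and> i < j}
     * a (nths vs S) * b (nths vs ({..<length vs} - S)))"

definition wedge_list :: "'v mform list \<Rightarrow> 'v mform" where
  "wedge_list as = foldr wedge as unit_form"

text \<open>Used for forms of positive degree only: powers beyond \<open>length vs\<close> then vanish on \<open>vs\<close>,
  so the exponential series is a finite sum.\<close>

definition exp_form :: "'v mform \<Rightarrow> 'v mform" where
  "exp_form a vs = (\<Sum>k\<le>length vs. ((wedge a ^^ k) unit_form) vs / fact k)"

definition form_kernel :: "'v mform \<Rightarrow> 'v set" where
  "form_kernel w = {v. \<forall>u. w [v, u] = 0}"

definition nondegenerate :: "('v::zero) mform \<Rightarrow> bool" where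
  "nondegenerate w \<longleftrightarrow> form_kernel w = {0}"


section \<open>Differential forms\<close>

definition form_rep ::
  "('m, 'v::real_normed_vector) manifold \<Rightarrow> ('m, 'v) chart \<Rightarrow> ('m \<Rightarrow> 'v mform) \<Rightarrow> 'v \<Rightarrow> 'v mform"
  where
  "form_rep M c b x vs = (let p = chart_inv c x in
     b p (map (frechet_derivative (coord_rep c (chart_at M p) id) (at x)) vs))"

definition differential_form ::
  "('m, 'v::real_normed_vector) manifold \<Rightarrow> nat \<Rightarrow> ('m \<Rightarrow> 'v mform) \<Rightarrow> bool" where
  "differential_form M k b \<longleftrightarrow>
     (\<forall>p\<in>points M. alternating_form k (b p)) \<and>
     (\<forall>c\<in>atlas M. \<forall>vs. smooth_on (snd c ` fst c) (\<lambda>x. form_rep M c b x vs))"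

definition pullback ::
  "('m, 'v::real_normed_vector) manifold \<Rightarrow> ('n, 'w::real_normed_vector) manifold \<Rightarrow> ('m \<Rightarrow> 'n) \<Rightarrow>
   ('n \<Rightarrow> 'w mform) \<Rightarrow> 'm \<Rightarrow> 'v mform" where
  "pullback M N f b p vs = b (f p) (map (tangent_map M N f p) vs)"

definition ext_deriv ::
  "('m, 'v::real_normed_vector) manifold \<Rightarrow> ('m \<Rightarrow> 'v mform) \<Rightarrow> 'm \<Rightarrow> 'v mform" where
  "ext_deriv M b p vs = (\<Sum>i<length vs. (- 1) ^ i *
     frechet_derivative (\<lambda>x. form_rep M (chart_at M p) b x (take i vs @ drop (Suc i) vs))
       (at (coord_at M p)) (vs ! i))"

definition volume_form :: "('m, 'v::real_normed_vector) manifold \<Rightarrow> ('m \<Rightarrow> 'v mform) \<Rightarrow> bool" where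
  "volume_form M b \<longleftrightarrow> differential_form M (mdim M) b \<and> (\<forall>p\<in>points M. \<exists>vs. b p vs \<noteq> 0)"


section \<open>Lie groups\<close>

definition compact_lie_group :: "('a, 'x) monoid_scheme \<Rightarrow> ('a, 'v::real_normed_vector) manifold \<Rightarrow> bool" where
  "compact_lie_group G L \<longleftrightarrow> group G \<and> smooth_manifold L \<and> points L = carrier G \<and>
     smooth_map (prod_manifold L L) L (\<lambda>(g, h). g \<otimes>\<^bsub>G\<^esub> h) \<and>
     smooth_map L L (\<lambda>g. inv\<^bsub>G\<^esub> g) \<and>
     compact_space (mtop L)"

text \<open>The Lie algebra is the tangent space at the identity, i.e. the model space \<open>'v\<close> of \<open>L\<close>.\<close>

definition left_invariant ::
  "('a, 'x) monoid_scheme \<Rightarrow> ('a, 'v::real_normed_vector) manifold \<Rightarrow> 'v \<Rightarrow> 'a \<Rightarrow> 'v" where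
  "left_invariant G L \<xi> g = tangent_map L L (\<lambda>h. g \<otimes>\<^bsub>G\<^esub> h) \<one>\<^bsub>G\<^esub> \<xi>"

definition lie_alg_bracket ::
  "('a, 'x) monoid_scheme \<Rightarrow> ('a, 'v::real_normed_vector) manifold \<Rightarrow> 'v \<Rightarrow> 'v \<Rightarrow> 'v" where
  "lie_alg_bracket G L \<xi> \<zeta> = lie_bracket L (left_invariant G L \<xi>) (left_invariant G L \<zeta>) \<one>\<^bsub>G\<^esub>"

definition Ad :: "('a, 'x) monoid_scheme \<Rightarrow> ('a, 'v::real_normed_vector) manifold \<Rightarrow> 'a \<Rightarrow> 'v \<Rightarrow> 'v" where
  "Ad G L g = tangent_map L L (\<lambda>h. g \<otimes>\<^bsub>G\<^esub> h \<otimes>\<^bsub>G\<^esub> inv\<^bsub>G\<^esub> g) \<one>\<^bsub>G\<^esub>"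

definition one_param_subgroup ::
  "('a, 'x) monoid_scheme \<Rightarrow> ('a, 'v::real_normed_vector) manifold \<Rightarrow> (real \<Rightarrow> 'a) \<Rightarrow> bool" where
  "one_param_subgroup G L \<gamma> \<longleftrightarrow> smooth_map real_line L \<gamma> \<and> (\<forall>s t. \<gamma> (s + t) = \<gamma> s \<otimes>\<^bsub>G\<^esub> \<gamma> t)"

definition lie_exp :: "('a, 'x) monoid_scheme \<Rightarrow> ('a, 'v::real_normed_vector) manifold \<Rightarrow> 'v \<Rightarrow> 'a" where
  "lie_exp G L \<xi> = (THE \<gamma>. one_param_subgroup G L \<gamma> \<and> tangent_map real_line L \<gamma> 0 1 = \<xi>) 1"

definition theta_L ::
  "('a, 'x) monoid_scheme \<Rightarrow> ('a, 'v::real_normed_vector) manifold \<Rightarrow> 'a \<Rightarrow> 'v \<Rightarrow> 'v" where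
  "theta_L G L g = tangent_map L L (\<lambda>h. inv\<^bsub>G\<^esub> g \<otimes>\<^bsub>G\<^esub> h) g"

definition theta_R ::
  "('a, 'x) monoid_scheme \<Rightarrow> ('a, 'v::real_normed_vector) manifold \<Rightarrow> 'a \<Rightarrow> 'v \<Rightarrow> 'v" where
  "theta_R G L g = tangent_map L L (\<lambda>h. h \<otimes>\<^bsub>G\<^esub> inv\<^bsub>G\<^esub> g) g"

definition inner_product :: "('v::real_vector \<Rightarrow> 'v \<Rightarrow> real) \<Rightarrow> bool" where
  "inner_product ip \<longleftrightarrow> bilinear ip \<and> (\<forall>x y. ip x y = ip y x) \<and> (\<forall>x. x \<noteq> 0 \<longrightarrow> ip x x > 0)"

definition Ad_invariant ::
  "('a, 'x) monoid_scheme \<Rightarrow> ('a, 'v::real_normed_vector) manifold \<Rightarrow> ('v \<Rightarrow> 'v \<Rightarrow> real) \<Rightarrow> bool" where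
  "Ad_invariant G L ip \<longleftrightarrow> (\<forall>g\<in>carrier G. \<forall>x y. ip (Ad G L g x) (Ad G L g y) = ip x y)"

definition orthonormal_basis :: "('v::real_vector \<Rightarrow> 'v \<Rightarrow> real) \<Rightarrow> 'v list \<Rightarrow> bool" where
  "orthonormal_basis ip es \<longleftrightarrow> span (set es) = UNIV \<and>
     (\<forall>i<length es. \<forall>j<length es. ip (es ! i) (es ! j) = (if i = j then 1 else 0))"

text \<open>Expanding \<open>\<theta>\<^sup>L \<cdot> [\<theta>\<^sup>L, \<theta>\<^sup>L]\<close> in components \<open>\<theta>\<^sup>L \<cdot> e\<^sub>i\<close> with respect to an orthonormal basis.\<close>

definition eta_form ::
  "('a, 'x) monoid_scheme \<Rightarrow> ('a, 'v::real_normed_vector) manifold \<Rightarrow> ('v \<Rightarrow> 'v \<Rightarrow> real) \<Rightarrow> 'v list \<Rightarrow>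
   'a \<Rightarrow> 'v mform" where
  "eta_form G L ip es g vs = 1 / 12 * (\<Sum>i<length es. \<Sum>j<length es. \<Sum>k<length es.
     ip (es ! i) (lie_alg_bracket G L (es ! j) (es ! k)) *
     wedge_list (map (\<lambda>l. one_form (\<lambda>v. ip (theta_L G L g v) (es ! l))) [i, j, k]) vs)"


section \<open>Group valued Hamiltonian manifolds\<close>

text \<open>\<open>group_action\<close> also asks that \<open>act g\<close> be extensional, i.e. \<open>undefined\<close> off \<open>points M\<close>.\<close>

definition G_manifold ::
  "('a, 'x) monoid_scheme \<Rightarrow> ('a, 'v::real_normed_vector) manifold \<Rightarrow>
   ('m, 'w::real_normed_vector) manifold \<Rightarrow> ('a \<Rightarrow> 'm \<Rightarrow> 'm) \<Rightarrow> bool" where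
  "G_manifold G L M act \<longleftrightarrow> smooth_manifold M \<and> group_action G (points M) act \<and>
     smooth_map (prod_manifold L M) M (\<lambda>(g, m). act g m)"

definition generating_vf ::
  "('a, 'x) monoid_scheme \<Rightarrow> ('a, 'v::real_normed_vector) manifold \<Rightarrow>
   ('m, 'w::real_normed_vector) manifold \<Rightarrow> ('a \<Rightarrow> 'm \<Rightarrow> 'm) \<Rightarrow> 'v \<Rightarrow> 'm \<Rightarrow> 'w" where
  "generating_vf G L M act \<xi> m =
     tangent_map real_line M (\<lambda>t. act (lie_exp G L (- (t *\<^sub>R \<xi>))) m) 0 1"

definition group_valued_hamiltonian ::
  "('a, 'x) monoid_scheme \<Rightarrow> ('a, 'v::real_normed_vector) manifold \<Rightarrow> ('v \<Rightarrow> 'v \<Rightarrow> real) \<Rightarrow> 'v list \<Rightarrow>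
   ('m, 'w::real_normed_vector) manifold \<Rightarrow> ('a \<Rightarrow> 'm \<Rightarrow> 'm) \<Rightarrow> ('m \<Rightarrow> 'w mform) \<Rightarrow> ('m \<Rightarrow> 'a) \<Rightarrow> bool"
  where
  "group_valued_hamiltonian G L ip es M act \<omega> \<Phi> \<longleftrightarrow>
     G_manifold G L M act \<and>
     differential_form M 2 \<omega> \<and>
     (\<forall>g\<in>carrier G. \<forall>m\<in>points M. pullback M M (act g) \<omega> m = \<omega> m) \<and>
     smooth_map M L \<Phi> \<and>
     (\<forall>g\<in>carrier G. \<forall>m\<in>points M. \<Phi> (act g m) = g \<otimes>\<^bsub>G\<^esub> \<Phi> m \<otimes>\<^bsub>G\<^esub> inv\<^bsub>G\<^esub> g) \<and>
     (\<forall>m\<in>points M. ext_deriv M \<omega> m = pullback M L \<Phi> (eta_form G L ip es) m) \<and>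
     (\<forall>m\<in>points M. \<forall>\<xi> v. \<omega> m [generating_vf G L M act \<xi> m, v] =
        1 / 2 * ip (theta_L G L (\<Phi> m) (tangent_map M L \<Phi> m v)
                    + theta_R G L (\<Phi> m) (tangent_map M L \<Phi> m v)) \<xi>) \<and>
     (\<forall>m\<in>points M. form_kernel (\<omega> m) =
        {generating_vf G L M act \<xi> m |\<xi>. Ad G L (\<Phi> m) \<xi> + \<xi> = 0})"


section \<open>Clifford algebra and Pin group\<close>

text \<open>Both \<open>Cl(\<gg>)\<close> and \<open>\<wedge>\<gg>\<close>, for \<open>n = dim \<gg>\<close>, are represented by real coefficient families on
  subsets \<open>I = {i\<^sub>1 < \<dots> < i\<^sub>s}\<close> of \<open>{..<n}\<close>: the coefficient at \<open>I\<close> belongs to the monomial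
  \<open>x\<^sub>I = x\<^bsub>i\<^sub>1\<^esub> \<cdots> x\<^bsub>i\<^sub>s\<^esub>\<close> resp. \<open>y\<^sub>I\<close>.  The relations \<open>x\<^sub>i x\<^sub>j + x\<^sub>j x\<^sub>i = \<delta>\<^sub>i\<^sub>j\<close> give
  \<open>x\<^sub>I x\<^sub>J = \<plusminus> (1/2)\<^bsup>|I \<inter> J|\<^esup> x\<^sub>K\<close> with \<open>K\<close> the symmetric difference and the sign the parity of
  the number of pairs \<open>(i, j) \<in> I \<times> J\<close> with \<open>i > j\<close>.\<close>

type_synonym clifford = "nat set \<Rightarrow> real"
type_synonym exterior = "nat set \<Rightarrow> real"

definition cl_mult :: "nat \<Rightarrow> clifford \<Rightarrow> clifford \<Rightarrow> clifford" where
  "cl_mult n a b = (\<lambda>K. \<Sum>I\<in>Pow {..<n}. \<Sum>J\<in>Pow {..<n}.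
     if (I - J) \<union> (J - I) = K
     then (- 1) ^ card {(i, j). i \<in> I \<and> j \<in> J \<and> i > j} * (1 / 2) ^ card (I \<inter> J) * a I * b J
     else 0)"

definition cl_monomial :: "nat set \<Rightarrow> clifford" where
  "cl_monomial I = (\<lambda>K. if K = I then 1 else 0)"

definition clifford_monoid :: "nat \<Rightarrow> clifford monoid" where
  "clifford_monoid n = \<lparr>carrier = {a. \<forall>I. a I \<noteq> 0 \<longrightarrow> I \<subseteq> {..<n}},
     monoid.mult = cl_mult n, one = cl_monomial {}\<rparr>"

lemma cl_mult_monomial:
  assumes "I \<subseteq> {..<n}" "J \<subseteq> {..<n}"
  shows "cl_mult n (cl_monomial I) (cl_monomial J) =
    (\<lambda>K. (- 1) ^ card {(i, j). i \<in> I \<and> j \<in> J \<and> i > j} * (1 / 2) ^ card (I \<inter> J)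
      * cl_monomial ((I - J) \<union> (J - I)) K)"
proof
  fix K
  let ?c = "\<lambda>I J. (- 1) ^ card {(i, j). i \<in> I \<and> j \<in> J \<and> i > j} * (1 / 2 :: real) ^ card (I \<inter> J)"
  let ?t = "if (I - J) \<union> (J - I) = K then ?c I J else 0"
  have "cl_mult n (cl_monomial I) (cl_monomial J) K =
    (\<Sum>I'\<in>Pow {..<n}. \<Sum>J'\<in>Pow {..<n}. if J' = J then if I' = I then ?t else 0 else 0)"
    unfolding cl_mult_def cl_monomial_def
    by (intro sum.cong refl) (simp split: if_split)
  also have "\<dots> = ?t"
    using assms by (simp add: sum.delta)
  finally show "cl_mult n (cl_monomial I) (cl_monomial J) K =
     ?c I J * cl_monomial ((I - J) \<union> (J - I)) K"
    by (auto simp: cl_monomial_def)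
qed

lemma clifford_relations:
  assumes "i < n" "j < n"
  shows "cl_mult n (cl_monomial {i}) (cl_monomial {j}) K + cl_mult n (cl_monomial {j}) (cl_monomial {i}) K
    = (if i = j then cl_monomial {} K else 0)"
proof -
  have *: "{(a, b). a = i \<and> b = j \<and> b < a} = (if j < i then {(i, j)} else {})" for i j :: nat
    by auto
  have sd: "({i} - {j}) \<union> ({j} - {i}) = (if i = j then {} else {i, j})" for i j :: nat
    by auto
  show ?thesis
    using assms by (cases i j rule: linorder_cases)
      (auto simp: cl_mult_monomial * sd insert_commute)
qed

definition cl_parity :: "clifford \<Rightarrow> clifford" where
  "cl_parity a = (\<lambda>I. (- 1) ^ card I * a I)"

definition cl_vec :: "('v \<Rightarrow> 'v \<Rightarrow> real) \<Rightarrow> 'v list \<Rightarrow> 'v \<Rightarrow> clifford" where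
  "cl_vec ip es \<xi> = (\<lambda>I. \<Sum>i<length es. ip \<xi> (es ! i) * cl_monomial {i} I)"

definition pin_group :: "('v \<Rightarrow> 'v \<Rightarrow> real) \<Rightarrow> 'v list \<Rightarrow> clifford monoid" where
  "pin_group ip es = (let U = units_of (clifford_monoid (length es)) in
     U\<lparr>carrier := generate U {cl_vec ip es \<xi> |\<xi>. ip \<xi> \<xi> = 2}\<rparr>)"

definition Ad_tilde :: "nat \<Rightarrow> clifford \<Rightarrow> clifford \<Rightarrow> clifford" where
  "Ad_tilde n x y = cl_mult n (cl_mult n (cl_parity x) y) (inv\<^bsub>clifford_monoid n\<^esub> x)"

text \<open>Homomorphisms of Lie groups are smooth; since the Pin group is an embedded submanifold of the
  vector space \<open>Cl(\<gg>)\<close>, smoothness can be expressed through the coefficients.\<close>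

definition pin_lift ::
  "('a, 'x) monoid_scheme \<Rightarrow> ('a, 'v::real_normed_vector) manifold \<Rightarrow> ('v \<Rightarrow> 'v \<Rightarrow> real) \<Rightarrow> 'v list \<Rightarrow>
   ('a \<Rightarrow> clifford) \<Rightarrow> bool" where
  "pin_lift G L ip es \<tau> \<longleftrightarrow>
     \<tau> \<in> hom G (pin_group ip es) \<and>
     (\<forall>I. smooth_map L real_line (\<lambda>g. \<tau> g I)) \<and>
     (\<forall>g\<in>carrier G. \<forall>\<xi>. Ad_tilde (length es) (\<tau> g) (cl_vec ip es \<xi>) = cl_vec ip es (Ad G L g \<xi>))"

text \<open>In the present representation the symbol map \<open>x\<^sub>I \<mapsto> y\<^sub>I\<close> does not change the coefficients.\<close>

definition symbol :: "clifford \<Rightarrow> exterior" where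
  "symbol a = (\<lambda>I. a I)"

definition substitute_forms :: "nat \<Rightarrow> (nat \<Rightarrow> 'v mform) \<Rightarrow> exterior \<Rightarrow> 'v mform" where
  "substitute_forms n b y vs =
     (\<Sum>I\<in>Pow {..<n}. y I * wedge_list (map b (sorted_list_of_set I)) vs)"

definition T_form ::
  "('a, 'x) monoid_scheme \<Rightarrow> ('a, 'v::real_normed_vector) manifold \<Rightarrow> ('v \<Rightarrow> 'v \<Rightarrow> real) \<Rightarrow> 'v list \<Rightarrow>
   ('a \<Rightarrow> clifford) \<Rightarrow> 'a \<Rightarrow> 'v mform" where
  "T_form G L ip es \<tau> g = substitute_forms (length es)
     (\<lambda>i. one_form (\<lambda>v. 1 / 2 * ip (theta_R G L g v) (es ! i))) (symbol (\<tau> g))"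

definition Gamma_form ::
  "('a, 'x) monoid_scheme \<Rightarrow> ('a, 'v::real_normed_vector) manifold \<Rightarrow> ('v \<Rightarrow> 'v \<Rightarrow> real) \<Rightarrow> 'v list \<Rightarrow>
   ('a \<Rightarrow> clifford) \<Rightarrow> ('m, 'w::real_normed_vector) manifold \<Rightarrow> ('m \<Rightarrow> 'w mform) \<Rightarrow> ('m \<Rightarrow> 'a) \<Rightarrow>
   'm \<Rightarrow> 'w mform" where
  "Gamma_form G L ip es \<tau> M \<omega> \<Phi> m =
     wedge (exp_form (\<omega> m)) (pullback M L \<Phi> (T_form G L ip es \<tau>) m)"

text \<open>Determinant of a linear endomorphism, through its matrix in the orthonormal basis \<open>es\<close>.\<close>

definition endo_det :: "('v \<Rightarrow> 'v \<Rightarrow> real) \<Rightarrow> 'v list \<Rightarrow> ('v \<Rightarrow> 'v) \<Rightarrow> real" where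
  "endo_det ip es A = Determinant.det
     (Matrix.mat (length es) (length es) (\<lambda>(i, j). ip (es ! i) (A (es ! j))))"

end

theory Submission
  imports Defs
begin

text \<open>At a point \<open>m\<close> put \<open>A = Ad (\<Phi> m)\<close> and let \<open>\<phi>\<close> be \<open>\<theta>\<^sup>R\<close> composed with the derivative of \<open>\<Phi>\<close>. For \<open>u\<close> in the
  Clifford algebra let \<open>\<Lambda> u\<close> be the top degree part of \<open>exp \<omega> \<and> \<phi>\<^sup>* u\<close>, so that \<open>\<Lambda> \<tau>\<close> is the form in question and
  \<open>\<Lambda> 1\<close> is the top degree part of \<open>exp \<omega>\<close>. A form of degree above the dimension vanishes; contracting it with
  \<open>\<xi>\<^sub>M\<close>, where \<open>\<iota>(\<xi>\<^sub>M) \<omega> = \<phi>\<^sup>*(A \<xi> + \<xi>) / 2\<close> and \<open>\<phi>(\<xi>\<^sub>M) = A \<xi> - \<xi>\<close>, gives \<open>\<Lambda>((A \<xi>) x + \<alpha>(x) \<xi>) = 0\<close>. With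
  \<open>x = y \<tau>\<close> and \<open>\<alpha>(\<tau>) \<xi> = (A \<xi>) \<tau>\<close> this says that \<open>y \<mapsto> \<Lambda>(y \<tau>)\<close> kills every \<open>\<eta> y + \<alpha>(y) \<eta> = 2 \<eta> \<and> y\<close>, hence depends
  only on the scalar part \<open>y\<^sub>0\<close> of \<open>y\<close>: \<open>\<Lambda> x = \<Lambda>(\<tau>) (x \<tau>\<^sup>-\<^sup>1)\<^sub>0\<close>. So \<open>\<Lambda> \<tau>\<close> is nonzero as soon as \<open>\<Lambda>\<close> is, and this follows from
  the kernel condition. Moreover \<open>\<Lambda> 1 = \<Lambda>(\<tau>) (\<tau>\<^sup>-\<^sup>1)\<^sub>0\<close>, where \<open>(\<tau>\<^sup>-\<^sup>1)\<^sub>0 = \<tau>\<^sub>0\<close> and \<open>\<tau>\<^sub>0 (\<tau>\<^sup>-\<^sup>1)\<^sub>0 = det ((1 + A) / 2)\<close>; the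
  determinant appears when \<open>e\<^sub>1 \<and> \<dots> \<and> e\<^sub>n \<and> \<tau>\<close> is rewritten as a Clifford product with \<open>\<tau>\<close>.

  The identity \<open>\<phi>(\<xi>\<^sub>M) = A \<xi> - \<xi>\<close> rests on the existence and uniqueness of one-parameter subgroups, obtained
  from Picard iteration in a chart around the identity.\<close>

subsection \<open>Contraction and antisymmetry of forms\<close>

text \<open>A vector annihilated by all covectors
  \<open>\<iota>\<^sub>v \<omega> + \<phi>\<^sup>* \<eta>\<close> is zero: it lies in the kernel of
  \<omega>, so it is a generating vector with A \<xi> = - \<xi>, and there \<phi> takes the value -
  2 \<xi>. These covectors therefore span the dual space. In top degree such a factor can be traded
  for contractions and a change of u, so if \<Lambda> vanished, the wedge of a whole basis of
  covectors would vanish as well. Points where \<omega> degenerates thus need no separate argument.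

  The equality of the two scalar parts is a statement about adjoints: inverses in the Pin group are
  adjoints for an inner product on the Clifford algebra. The factor between \<Lambda> 1 and
  \<Lambda> \<tau> involves only the group element, so the sign is that of
  \<open>\<tau>\<^sub>0\<close>, the same for all M.

  On the analytic side, the model spaces are merely finite-dimensional normed spaces, and the chart
  that identifies a tangent space with the model space is an arbitrary choice at each point.
  Identities between tangent maps are therefore derived from a chain rule for velocities of maps out
  of a normed space.\<close>

definition contract :: "'v \<Rightarrow> 'v mform \<Rightarrow> 'v mform" where
  "contract v b vs = b (v # vs)"

text \<open>The grading automorphism. It carries the sign in the antiderivation rule for
  contraction, so that the rule holds for forms of mixed degree.\<close>

definition grade_inv :: "'v mform \<Rightarrow> 'v mform" where
  "grade_inv b vs = (- 1) ^ length vs * b vs"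

lemma grade_inv_grade_inv [simp]: "grade_inv (grade_inv b) = b"
  by (rule ext) (simp add: grade_inv_def flip: mult.assoc power_add)

lemma contract_grade_inv: "contract v (grade_inv b) = (\<lambda>vs. - grade_inv (contract v b) vs)"
  by (rule ext) (simp add: grade_inv_def contract_def)

lemma nths_Cons_Suc: "nths (x # xs) (Suc ` S) = nths xs S" "nths (x # xs) (insert 0 (Suc ` S)) = x # nths xs S"
  by (simp_all add: nths_Cons inj_image_mem_iff)

lemma wedge_Nil [simp]: "wedge a b [] = a [] * b []"
  by (simp add: wedge_def)

lemma card_inversions_Suc:
  "card {(i, j). i \<in> Suc ` A \<and> j \<in> Suc ` B \<and> i < j} = card {(i, j). i \<in> A \<and> j \<in> B \<and> i < j}"
  by (rule bij_betw_same_card[symmetric, of "map_prod Suc Suc"])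
    (auto simp: bij_betw_def inj_on_def image_iff)

text \<open>The shuffles are split by whether position 0 goes to the first factor. If it goes to the
  second, it precedes all of S and adds \<open>card S\<close> inversions, which is the sign in
  \<open>grade_inv a\<close>. This recursion turns the algebraic laws of the wedge product into
  inductions on the argument list.\<close>

lemma wedge_Cons:
  "wedge a b (v # vs) = wedge (contract v a) b vs + wedge (grade_inv a) (contract v b) vs"
proof -
  let ?n = "length vs"
  define F where "F S = (- 1) ^ card {(i, j). i \<in> {..<Suc ?n} - S \<and> j \<in> S \<and> i < j}
     * a (nths (v # vs) S) * b (nths (v # vs) ({..<Suc ?n} - S))" for S
  have split: "Pow {..<Suc ?n} = (\<lambda>S. insert 0 (Suc ` S)) ` Pow {..<?n} \<union> (\<lambda>S. Suc ` S) ` Pow {..<?n}"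
  proof -
    have "{..<Suc ?n} = insert 0 (Suc ` {..<?n})" by (simp add: lessThan_Suc_eq_insert_0)
    moreover have "(\<lambda>S. insert 0 (Suc ` S)) ` Pow {..<?n} = insert 0 ` (`) Suc ` Pow {..<?n}"
      by (simp add: image_image)
    moreover have "(`) Suc ` Pow {..<?n} = Pow (Suc ` {..<?n})"
      by (simp add: image_Pow_surj)
    ultimately show ?thesis by (metis Pow_insert Un_commute)
  qed
  have "wedge a b (v # vs) = (\<Sum>S\<in>Pow {..<Suc ?n}. F S)"
    by (simp add: wedge_def F_def)
  also have "\<dots> = (\<Sum>S\<in>(\<lambda>S. insert 0 (Suc ` S)) ` Pow {..<?n}. F S) + (\<Sum>S\<in>(\<lambda>S. Suc ` S) ` Pow {..<?n}. F S)"
    unfolding split by (rule sum.union_disjoint) auto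
  also have "(\<Sum>S\<in>(\<lambda>S. insert 0 (Suc ` S)) ` Pow {..<?n}. F S) = (\<Sum>S\<in>Pow {..<?n}. F (insert 0 (Suc ` S)))"
    by (rule sum.reindex_cong[where l="\<lambda>S. insert 0 (Suc ` S)"])
      (auto intro!: inj_onI dest: inj_image_eq_iff[THEN iffD1, rotated])
  also have "\<dots> = wedge (contract v a) b vs"
    unfolding wedge_def
  proof (rule sum.cong[OF refl])
    fix S assume "S \<in> Pow {..<?n}"
    have *: "{..<Suc ?n} - insert 0 (Suc ` S) = Suc ` ({..<?n} - S)"
      by (auto simp: lessThan_Suc_eq_insert_0)
    have **: "{(i, j). i \<in> Suc ` ({..<?n} - S) \<and> j \<in> insert 0 (Suc ` S) \<and> i < j}
       = {(i, j). i \<in> Suc ` ({..<?n} - S) \<and> j \<in> Suc ` S \<and> i < j}" by auto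
    show "F (insert 0 (Suc ` S)) = (- 1) ^ card {(i, j). i \<in> {..<?n} - S \<and> j \<in> S \<and> i < j} *
         contract v a (nths vs S) * b (nths vs ({..<?n} - S))"
      unfolding F_def * ** card_inversions_Suc nths_Cons_Suc contract_def ..
  qed
  also have "(\<Sum>S\<in>(\<lambda>S. Suc ` S) ` Pow {..<?n}. F S) = (\<Sum>S\<in>Pow {..<?n}. F (Suc ` S))"
    by (rule sum.reindex_cong[where l="\<lambda>S. Suc ` S"]) (auto intro!: inj_onI)
  also have "\<dots> = wedge (grade_inv a) (contract v b) vs"
    unfolding wedge_def
  proof (rule sum.cong[OF refl])
    fix S assume S: "S \<in> Pow {..<?n}"
    then have fin: "finite S" using finite_subset by auto
    have *: "{..<Suc ?n} - (Suc ` S) = insert 0 (Suc ` ({..<?n} - S))"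
      by (auto simp: lessThan_Suc_eq_insert_0)
    have **: "{(i, j). i \<in> insert 0 (Suc ` ({..<?n} - S)) \<and> j \<in> Suc ` S \<and> i < j}
       = {(i, j). i \<in> Suc ` ({..<?n} - S) \<and> j \<in> Suc ` S \<and> i < j} \<union> ({0} \<times> Suc ` S)" by auto
    have f: "finite {(i, j). i \<in> Suc ` ({..<?n} - S) \<and> j \<in> Suc ` S \<and> i < j}"
      by (rule finite_subset[of _ "Suc ` ({..<?n} - S) \<times> Suc ` S"]) (use fin in auto)
    have c: "card {(i, j). i \<in> insert 0 (Suc ` ({..<?n} - S)) \<and> j \<in> Suc ` S \<and> i < j}
       = card {(i, j). i \<in> ({..<?n} - S) \<and> j \<in> S \<and> i < j} + card S"
      unfolding ** by (subst card_Un_disjoint)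
        (use f fin in \<open>auto simp: card_inversions_Suc card_cartesian_product_singleton card_image\<close>)
    have l: "length (nths vs S) = card S"
      using S unfolding length_nths by (metis (no_types, lifting) PowD Collect_cong Collect_mem_eq inf.absorb_iff2 Int_def lessThan_iff)
    show "F (Suc ` S) = (- 1) ^ card {(i, j). i \<in> {..<?n} - S \<and> j \<in> S \<and> i < j} *
         grade_inv a (nths vs S) * contract v b (nths vs ({..<?n} - S))"
      unfolding F_def * c nths_Cons_Suc contract_def grade_inv_def l by (simp add: power_add)
  qed
  finally show ?thesis .
qed

lemma contract_wedge:
  "contract v (wedge a b) = (\<lambda>vs. wedge (contract v a) b vs + wedge (grade_inv a) (contract v b) vs)"
  by (rule ext) (simp add: contract_def[of v "wedge a b"] wedge_Cons)

section \<open>Algebraic laws of the wedge product\<close>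

lemma wedge_add_left: "wedge (\<lambda>vs. a vs + b vs) c vs = wedge a c vs + wedge b c vs"
  by (simp add: wedge_def sum.distrib algebra_simps)

lemma wedge_add_right: "wedge a (\<lambda>vs. b vs + c vs) vs = wedge a b vs + wedge a c vs"
  by (simp add: wedge_def sum.distrib algebra_simps)

lemma wedge_scale_left: "wedge (\<lambda>vs. r * a vs) b vs = r * wedge a b vs"
  by (simp add: wedge_def sum_distrib_left mult_ac)

lemma wedge_scale_right: "wedge a (\<lambda>vs. r * b vs) vs = r * wedge a b vs"
  by (simp add: wedge_def sum_distrib_left mult_ac)

lemma wedge_minus_left: "wedge (\<lambda>vs. - a vs) b vs = - wedge a b vs"
  using wedge_scale_left[of "-1"] by simp

lemma wedge_minus_right: "wedge a (\<lambda>vs. - b vs) vs = - wedge a b vs"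
  using wedge_scale_right[of a "-1"] by simp

lemma wedge_zero_left [simp]: "wedge (\<lambda>vs. 0) b vs = 0"
  by (simp add: wedge_def)

lemma wedge_zero_right [simp]: "wedge a (\<lambda>vs. 0) vs = 0"
  by (simp add: wedge_def)

lemma wedge_sum_left: "wedge (\<lambda>vs. \<Sum>i\<in>I. a i vs) b vs = (\<Sum>i\<in>I. wedge (a i) b vs)"
  by (induction I rule: infinite_finite_induct) (simp_all add: wedge_add_left)

lemma wedge_sum_right: "wedge a (\<lambda>vs. \<Sum>i\<in>I. b i vs) vs = (\<Sum>i\<in>I. wedge a (b i) vs)"
  by (induction I rule: infinite_finite_induct) (simp_all add: wedge_add_right)

lemma grade_inv_wedge: "grade_inv (wedge a b) = wedge (grade_inv a) (grade_inv b)"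
proof -
  have "grade_inv (wedge a b) vs = wedge (grade_inv a) (grade_inv b) vs" for vs
  proof (induction vs arbitrary: a b)
    case (Cons v vs)
    have "grade_inv (wedge a b) (v # vs) = - (grade_inv (wedge (contract v a) b) vs + grade_inv (wedge (grade_inv a) (contract v b)) vs)"
      by (simp add: grade_inv_def wedge_Cons algebra_simps)
    also have "\<dots> = wedge (grade_inv a) (grade_inv b) (v # vs)"
      by (simp add: wedge_Cons Cons contract_grade_inv wedge_minus_left wedge_minus_right)
    finally show ?case .
  qed (simp add: grade_inv_def)
  then show ?thesis by blast
qed

text \<open>Contracting either side with the first argument gives the same three terms, because
  contraction is an antiderivation and \<open>grade_inv\<close> is multiplicative.\<close>

lemma wedge_assoc: "wedge (wedge a b) c = wedge a (wedge b c)"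
proof -
  have "wedge (wedge a b) c vs = wedge a (wedge b c) vs" for vs
  proof (induction vs arbitrary: a b c)
    case (Cons v vs)
    show ?case
      by (simp add: wedge_Cons contract_wedge grade_inv_wedge wedge_add_left wedge_add_right Cons)
  qed simp
  then show ?thesis by blast
qed

lemma contract_unit [simp]: "contract v unit_form = (\<lambda>vs. 0)"
  by (rule ext) (simp add: contract_def unit_form_def)

lemma grade_inv_unit [simp]: "grade_inv unit_form = unit_form"
  by (rule ext) (simp add: grade_inv_def unit_form_def)

lemma wedge_unit_left [simp]: "wedge unit_form b = b"
proof -
  have "wedge unit_form b vs = b vs" for vs
    by (induction vs arbitrary: b) (simp_all add: wedge_Cons unit_form_def[of "[]"] contract_def[of _ b for b])
  then show ?thesis by blast
qed

lemma wedge_unit_right [simp]: "wedge a unit_form = a"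
proof -
  have "wedge a unit_form vs = a vs" for vs
    by (induction vs arbitrary: a) (simp_all add: wedge_Cons unit_form_def[of "[]"] contract_def[of _ a for a])
  then show ?thesis by blast
qed

lemma contract_one_form: "contract v (one_form f) = (\<lambda>vs. f v * unit_form vs)"
  by (rule ext) (simp add: contract_def one_form_def unit_form_def split: list.split)

lemma grade_inv_one_form: "grade_inv (one_form f) = (\<lambda>vs. - one_form f vs)"
  by (rule ext) (simp add: grade_inv_def one_form_def split: list.split)

text \<open>Even and odd a share one induction because contraction exchanges the two parities; b may
  be of mixed degree.\<close>

lemma wedge_graded_commute:
  "grade_inv a = a \<Longrightarrow> wedge a b = wedge b a"
  "grade_inv a = (\<lambda>vs. - a vs) \<Longrightarrow> wedge a b = wedge (grade_inv b) a"
proof -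
  have "(grade_inv a = a \<longrightarrow> wedge a b vs = wedge b a vs) \<and>
    (grade_inv a = (\<lambda>vs. - a vs) \<longrightarrow> wedge a b vs = wedge (grade_inv b) a vs)" for vs
  proof (induction vs arbitrary: a b)
    case (Cons v vs)
    have even: "wedge a b (v # vs) = wedge b a (v # vs)" if a: "grade_inv a = a"
    proof -
      have "contract v a = (\<lambda>vs. - grade_inv (contract v a) vs)"
        using a contract_grade_inv[of v a] by simp
      then have o: "grade_inv (contract v a) = (\<lambda>vs. - contract v a vs)" by (metis (no_types, lifting) add.inverse_inverse)
      have "wedge (contract v a) b vs = wedge (grade_inv b) (contract v a) vs" using Cons o by blast
      moreover have "wedge a (contract v b) vs = wedge (contract v b) a vs" using Cons a by blast
      ultimately show ?thesis unfolding wedge_Cons a by simp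
    qed
    have odd: "wedge a b (v # vs) = wedge (grade_inv b) a (v # vs)" if a: "grade_inv a = (\<lambda>vs. - a vs)"
    proof -
      have "contract v (\<lambda>vs. - a vs) = (\<lambda>vs. - grade_inv (contract v a) vs)"
        using a contract_grade_inv[of v a] by simp
      then have o: "grade_inv (contract v a) = contract v a" by (auto simp: fun_eq_iff contract_def)
      have "wedge (contract v a) b vs = wedge b (contract v a) vs" using Cons o by blast
      moreover have "wedge a (contract v b) vs = wedge (grade_inv (contract v b)) a vs" using Cons a by blast
      ultimately show ?thesis unfolding wedge_Cons a contract_grade_inv wedge_minus_left grade_inv_grade_inv by simp
    qed
    show ?case using even odd by blast
  qed (simp add: grade_inv_def)
  then show "grade_inv a = a \<Longrightarrow> wedge a b = wedge b a"
    "grade_inv a = (\<lambda>vs. - a vs) \<Longrightarrow> wedge a b = wedge (grade_inv b) a" by blast+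
qed

lemma one_form_wedge_commute: "wedge (one_form f) b = wedge (grade_inv b) (one_form f)"
  by (rule wedge_graded_commute(2)[OF grade_inv_one_form])

lemma wedge_comp_map: "wedge a b (map f vs) = wedge (a \<circ> map f) (b \<circ> map f) vs"
  by (simp add: wedge_def nths_map)

lemma wedge_list_Nil [simp]: "wedge_list [] = unit_form"
  and wedge_list_Cons [simp]: "wedge_list (a # as) = wedge a (wedge_list as)"
  by (simp_all add: wedge_list_def)

lemma wedge_list_comp_map: "wedge_list as (map f vs) = wedge_list (map (\<lambda>a. a \<circ> map f) as) vs"
proof (induction as arbitrary: vs)
  case (Cons a as)
  have "wedge_list as \<circ> map f = wedge_list (map (\<lambda>a. a \<circ> map f) as)"
    by (rule ext) (simp only: o_apply[of "wedge_list as"] Cons)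
  then show ?case by (simp add: wedge_comp_map o_def)
qed (simp add: unit_form_def)

lemma one_form_comp_map: "one_form h \<circ> map f = one_form (\<lambda>v. h (f v))"
  by (rule ext) (simp add: one_form_def split: list.split)

text \<open>Multilinearity, and vanishing on adjacent equal entries; the latter is
  compatible with the recursion for \<open>wedge\<close> and implies full antisymmetry.\<close>

definition multilinear :: "('v::real_vector) mform \<Rightarrow> bool" where
  "multilinear b \<longleftrightarrow> (\<forall>us ws. linear (\<lambda>x. b (us @ x # ws)))"

definition vanishes_adjacent :: "'v mform \<Rightarrow> bool" where
  "vanishes_adjacent b \<longleftrightarrow> (\<forall>us v ws. b (us @ v # v # ws) = 0)"

definition alternating :: "('v::real_vector) mform \<Rightarrow> bool" where
  "alternating b \<longleftrightarrow> multilinear b \<and> vanishes_adjacent b"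

lemma linear_contract: assumes "multilinear b" shows "linear (\<lambda>x. contract x b vs)"
proof -
  have "linear (\<lambda>x. b ([] @ x # vs))" using assms unfolding multilinear_def by blast
  then show ?thesis by (simp add: contract_def)
qed

lemma multilinear_contract: assumes "multilinear b" shows "multilinear (contract v b)"
proof -
  have "linear (\<lambda>x. b ((v # us) @ x # ws))" for us ws using assms unfolding multilinear_def by blast
  then show ?thesis by (simp add: multilinear_def contract_def)
qed

lemma multilinear_grade_inv: assumes "multilinear b" shows "multilinear (grade_inv b)"
proof -
  have "linear (\<lambda>x. c *\<^sub>R b (us @ x # ws))" for c us ws
    using assms unfolding multilinear_def by (intro linear_compose_scale_right) blast
  then show ?thesis
    unfolding multilinear_def grade_inv_def length_append list.size real_scaleR_def by blast
qed

lemma vanishes_adjacent_contract: assumes "vanishes_adjacent b" shows "vanishes_adjacent (contract v b)"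
proof -
  have "b ((v # us) @ x # x # ws) = 0" for us x ws using assms unfolding vanishes_adjacent_def by blast
  then show ?thesis by (simp add: vanishes_adjacent_def contract_def)
qed

lemma vanishes_adjacent_grade_inv: "vanishes_adjacent b \<Longrightarrow> vanishes_adjacent (grade_inv b)"
  unfolding vanishes_adjacent_def grade_inv_def by simp

lemma multilinear_wedge:
  assumes "multilinear a" "multilinear b" shows "multilinear (wedge a b)"
proof -
  have "linear (\<lambda>x. wedge a b (us @ x # ws))" for us ws
    using assms
  proof (induction us arbitrary: a b)
    case Nil
    have "linear (\<lambda>x. wedge (contract x a) b ws)"
      using linear_contract[OF Nil(1)] by (simp add: wedge_def linear_iff sum.distrib sum_distrib_left algebra_simps)
    moreover have "linear (\<lambda>x. wedge (grade_inv a) (contract x b) ws)"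
      using linear_contract[OF Nil(2)] by (simp add: wedge_def linear_iff sum.distrib sum_distrib_left algebra_simps)
    ultimately have "linear (\<lambda>x. wedge (contract x a) b ws + wedge (grade_inv a) (contract x b) ws)"
      by (rule linear_compose_add)
    then show ?case by (simp add: wedge_Cons)
  next
    case (Cons u us)
    have "linear (\<lambda>x. wedge (contract u a) b (us @ x # ws) + wedge (grade_inv a) (contract u b) (us @ x # ws))"
      by (intro linear_compose_add Cons multilinear_contract multilinear_grade_inv)
    then show ?case by (simp add: wedge_Cons)
  qed
  then show ?thesis by (simp add: multilinear_def)
qed

lemma vanishes_adjacent_wedge:
  assumes "vanishes_adjacent a" "vanishes_adjacent b" shows "vanishes_adjacent (wedge a b)"
proof -
  have "wedge a b (us @ v # v # ws) = 0" for us v ws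
    using assms
  proof (induction us arbitrary: a b)
    case Nil
    have z: "contract v (contract v c) = (\<lambda>vs. 0)" if "vanishes_adjacent c" for c
    proof (rule ext)
      fix vs
      have "c ([] @ v # v # vs) = 0" using that unfolding vanishes_adjacent_def by blast
      then show "contract v (contract v c) vs = 0" by (simp add: contract_def)
    qed
    \<comment> \<open>Contracting twice with v leaves two mixed terms, which cancel because
      \<open>contract v\<close> anticommutes with \<open>grade_inv\<close>.\<close>
    show ?case
      by (simp only: append_Nil wedge_Cons z[OF Nil(1)] z[OF Nil(2)] contract_grade_inv wedge_minus_left
          grade_inv_grade_inv wedge_zero_left wedge_zero_right add_0 minus_zero)
  next
    case (Cons u us)
    show ?case
      by (simp only: append_Cons wedge_Cons Cons.IH Cons.prems vanishes_adjacent_contract vanishes_adjacent_grade_inv add_0)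
  qed
  then show ?thesis by (simp add: vanishes_adjacent_def)
qed

lemma alternating_wedge: "alternating a \<Longrightarrow> alternating b \<Longrightarrow> alternating (wedge a b)"
  by (simp add: alternating_def multilinear_wedge vanishes_adjacent_wedge)

lemma linear_zero_fun: "linear (\<lambda>x. 0)"
  by (simp add: linear_iff)

lemma alternating_unit: "alternating unit_form"
  unfolding alternating_def multilinear_def vanishes_adjacent_def unit_form_def
  using linear_zero_fun by simp

lemma alternating_one_form: assumes "linear f" shows "alternating (one_form f)"
proof -
  have "linear (\<lambda>x. one_form f (us @ x # ws))" for us ws
  proof (cases us)
    case Nil
    then show ?thesis using assms linear_zero_fun by (cases ws) (simp_all add: one_form_def)
  next
    case (Cons u us')
    then have "(\<lambda>x. one_form f (us @ x # ws)) = (\<lambda>x. 0)"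
      by (auto simp: one_form_def split: list.split)
    then show ?thesis using linear_zero_fun by simp
  qed
  moreover have "one_form f (us @ x # x # ws) = 0" for us x ws
    by (cases us) (auto simp: one_form_def split: list.split)
  ultimately show ?thesis by (simp add: alternating_def multilinear_def vanishes_adjacent_def)
qed

lemma alternating_scale: assumes "alternating a" shows "alternating (\<lambda>vs. r * a vs)"
proof -
  have "linear (\<lambda>x. a (us @ x # ws))" for us ws
    using assms by (simp add: alternating_def multilinear_def)
  from linear_compose_scale_right[OF this, of r]
  show ?thesis using assms by (simp add: alternating_def multilinear_def vanishes_adjacent_def)
qed

lemma alternating_add: "alternating a \<Longrightarrow> alternating b \<Longrightarrow> alternating (\<lambda>vs. a vs + b vs)"
  unfolding alternating_def multilinear_def vanishes_adjacent_def by (auto intro!: linear_compose_add)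

lemma alternating_zero: "alternating (\<lambda>vs. 0)"
  using linear_zero_fun by (simp add: alternating_def multilinear_def vanishes_adjacent_def)

lemma alternating_sum: "(\<And>i. i \<in> I \<Longrightarrow> alternating (a i)) \<Longrightarrow> alternating (\<lambda>vs. \<Sum>i\<in>I. a i vs)"
  by (induction I rule: infinite_finite_induct) (simp_all add: alternating_add alternating_zero)

lemma alternating_wedge_list: "(\<And>a. a \<in> set as \<Longrightarrow> alternating a) \<Longrightarrow> alternating (wedge_list as)"
  by (induction as) (simp_all add: alternating_unit alternating_wedge)

lemma alternating_form_imp_alternating: assumes "alternating_form k b" shows "alternating b"
  unfolding alternating_def multilinear_def vanishes_adjacent_def
proof (intro conjI allI)
  fix us ws
  show "linear (\<lambda>x. b (us @ x # ws))"
  proof (cases "Suc (length us + length ws) = k")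
    case True
    \<comment> \<open>The entry \<open>undefined\<close> is a placeholder that the list update
      overwrites with x.\<close>
    then have "length (us @ undefined # ws) = k" "length us < k" by simp_all
    then have "linear (\<lambda>x. b ((us @ undefined # ws)[length us := x]))"
      using assms unfolding alternating_form_def by blast
    then show ?thesis by simp
  next
    case False
    then have "(\<lambda>x. b (us @ x # ws)) = (\<lambda>x. 0)" using assms by (simp add: alternating_form_def)
    then show ?thesis using linear_zero_fun by simp
  qed
next
  fix us ws v
  show "b (us @ v # v # ws) = 0"
  proof (cases "Suc (Suc (length us + length ws)) = k")
    case True
    let ?vs = "us @ v # v # ws"
    have "length ?vs = k" "length us < Suc (length us)" "Suc (length us) < k" "?vs ! length us = ?vs ! Suc (length us)"
      using True by (simp_all add: nth_append)
    then show ?thesis using assms unfolding alternating_form_def by blast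
  next
    case False
    then show ?thesis using assms by (simp add: alternating_form_def)
  qed
qed

lemma alternating_swap:
  assumes "alternating b" shows "b (us @ v # w # ws) = - b (us @ w # v # ws)"
proof -
  have lin: "linear (\<lambda>x. b (us @ x # ws))" for us ws using assms by (simp add: alternating_def multilinear_def)
  have z: "b (us @ x # x # ws) = 0" for x using assms by (simp add: alternating_def vanishes_adjacent_def)
  have "b (us @ (v + w) # (v + w) # ws) = b (us @ v # (v + w) # ws) + b (us @ w # (v + w) # ws)"
    by (rule linear_add[OF lin])
  moreover have "b (us @ x # (v + w) # ws) = b (us @ x # v # ws) + b (us @ x # w # ws)" for x
    using linear_add[OF lin[of "us @ [x]" ws], of v w] by simp
  ultimately show ?thesis using z by simp
qed

lemma alternating_equal:
  assumes "alternating b" shows "b (us @ v # ws @ v # zs) = 0"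
proof (induction ws arbitrary: us)
  case Nil then show ?case using assms by (simp add: alternating_def vanishes_adjacent_def)
next
  case (Cons w ws)
  have "b (us @ v # (w # ws) @ v # zs) = - b ((us @ [w]) @ v # ws @ v # zs)"
    using alternating_swap[OF assms, of us v w] by simp
  then show ?case using Cons[of "us @ [w]"] by simp
qed

lemma alternating_form_degree_part:
  assumes "alternating b" shows "alternating_form k (degree_part k b)"
  unfolding alternating_form_def
proof (intro conjI allI impI)
  fix vs :: "'a list" and i assume "length vs = k" "i < k"
  moreover have "linear (\<lambda>x. b (take i vs @ x # drop (Suc i) vs))"
    using assms by (simp add: alternating_def multilinear_def)
  ultimately show "linear (\<lambda>x. degree_part k b (vs[i := x]))"
    by (simp add: degree_part_def upd_conv_take_nth_drop)
next
  fix vs :: "'a list" and i j assume ij: "length vs = k" "i < j" "j < k" "vs ! i = vs ! j"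
  have "vs = take i vs @ vs ! i # drop (Suc i) vs" using ij by (intro id_take_nth_drop) simp
  also have "drop (Suc i) vs = take (j - Suc i) (drop (Suc i) vs) @ vs ! j # drop (Suc j) vs"
    using ij id_take_nth_drop[of "j - Suc i" "drop (Suc i) vs"] by simp
  finally have "b vs = b (take i vs @ vs ! i # take (j - Suc i) (drop (Suc i) vs) @ vs ! i # drop (Suc j) vs)"
    using ij(4) by simp
  also have "\<dots> = 0" by (rule alternating_equal[OF assms])
  finally show "degree_part k b vs = 0" by (simp add: degree_part_def)
qed (simp add: degree_part_def)

text \<open>With more arguments than the dimension, one argument lies in the span of the others; in
  that slot the form is linear and vanishes on each of the others. A repeated argument is treated
  first, since it would be invisible in \<open>set vs\<close>.\<close>

lemma alternating_eq_0:
  fixes b :: "('v::real_vector) mform"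
  assumes b: "alternating b" and fin: "finite B" "span B = (UNIV :: 'v set)" and len: "dim (UNIV :: 'v set) < length vs"
  shows "b vs = 0"
proof (cases "distinct vs")
  case False
  then obtain xs ys zs y where "vs = xs @ [y] @ ys @ [y] @ zs" using not_distinct_decomp by blast
  then show ?thesis using alternating_equal[OF b] by simp
next
  case True
  obtain C where C: "independent C" "span C = (UNIV :: 'v set)" "card C = dim (UNIV :: 'v set)"
    using basis_exists[of "UNIV :: 'v set"] by (metis top.extremum_uniqueI)
  have finC: "finite C" using independent_span_bound[OF fin(1) C(1)] fin(2) by auto
  have "dependent (set vs)"
  proof (rule ccontr)
    assume "\<not> dependent (set vs)"
    from independent_span_bound[OF finC this] C have "card (set vs) \<le> dim (UNIV :: 'v set)" by auto
    then show False using len distinct_card[OF True] by simp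
  qed
  then obtain v where v: "v \<in> set vs" "v \<in> span (set vs - {v})" unfolding dependent_def by blast
  then obtain us ws where vs: "vs = us @ v # ws" using split_list by metis
  have lin: "linear (\<lambda>x. b (us @ x # ws))" using b by (simp add: alternating_def multilinear_def)
  have z: "b (us @ x # ws) = 0" if x: "x \<in> set vs - {v}" for x
  proof -
    from x vs have "x \<in> set us \<or> x \<in> set ws" by auto
    then show ?thesis
    proof
      assume "x \<in> set us"
      then obtain us1 us2 where "us = us1 @ x # us2" using split_list by metis
      then show ?thesis using alternating_equal[OF b, of us1 x us2 ws] by simp
    next
      assume "x \<in> set ws"
      then obtain us1 us2 where "ws = us1 @ x # us2" using split_list by metis
      then show ?thesis using alternating_equal[OF b, of us x us1 us2] by simp
    qed
  qed
  show ?thesis using linear_eq_0_on_span[OF lin _ v(2)] z vs by auto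
qed

subsection \<open>The Clifford algebra\<close>

definition symdiff :: "'a set \<Rightarrow> 'a set \<Rightarrow> 'a set" where
  "symdiff I J = (I - J) \<union> (J - I)"

lemma symdiff_simps [simp]:
  "symdiff I {} = I" "symdiff {} I = I" "symdiff I (symdiff I J) = J" "symdiff I I = {}"
  "finite I \<Longrightarrow> finite J \<Longrightarrow> finite (symdiff I J)"
  by (auto simp: symdiff_def)

lemma symdiff_subset: "I \<subseteq> U \<Longrightarrow> J \<subseteq> U \<Longrightarrow> symdiff I J \<subseteq> U"
  by (auto simp: symdiff_def)

lemma symdiff_singleton: "symdiff {i} K = (if i \<in> K then K - {i} else insert i K)"
  by (auto simp: symdiff_def)

lemma symdiff_eq_iff: "symdiff I J = K \<longleftrightarrow> J = symdiff I K"
  by (auto simp: symdiff_def)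

lemma sign_square: "(if P then - 1 else 1) * (if P then - 1 else 1) = (1 :: real)"
  by simp

text \<open>On the right the factors over the intersection occur twice and cancel as
  squares.\<close>

lemma prod_symdiff:
  fixes f :: "'a \<Rightarrow> 'b::comm_ring_1"
  assumes "finite I" "finite J" "\<And>i. f i * f i = 1"
  shows "prod f (symdiff I J) = prod f I * prod f J"
proof -
  have "prod f I = prod f (I - J) * prod f (I \<inter> J)" "prod f J = prod f (J - I) * prod f (I \<inter> J)"
    using assms prod.Int_Diff[of I f J] prod.Int_Diff[of J f I] by (simp_all add: mult.commute Int_commute)
  moreover have "prod f (I \<inter> J) * prod f (I \<inter> J) = 1"
    by (simp add: assms flip: prod.distrib)
  moreover have "prod f (symdiff I J) = prod f (I - J) * prod f (J - I)"
    unfolding symdiff_def by (rule prod.union_disjoint) (use assms in auto)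
  ultimately show ?thesis by (simp add: mult_ac)
qed

text \<open>The structure constants: \<open>x\<^sub>I x\<^sub>J = cl_coeff I J x\<^sub>K\<close> with \<open>K\<close> the symmetric difference.\<close>

definition inv_sign :: "nat set \<Rightarrow> nat set \<Rightarrow> real" where
  "inv_sign I J = (\<Prod>i\<in>I. \<Prod>j\<in>J. if j < i then -1 else 1)"

definition cl_coeff :: "nat set \<Rightarrow> nat set \<Rightarrow> real" where
  "cl_coeff I J = inv_sign I J * (1 / 2) ^ card (I \<inter> J)"

lemma prod_minus_one_if:
  "finite A \<Longrightarrow> (\<Prod>i\<in>A. if P i then - 1 else 1 :: real) = (- 1) ^ card {i \<in> A. P i}"
  by (simp add: prod.If_cases Int_def)

lemma inv_sign_eq:
  assumes "finite I" "finite J"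
  shows "(- 1) ^ card {(i, j). i \<in> I \<and> j \<in> J \<and> i > j} = inv_sign I J"
proof -
  have "inv_sign I J = (\<Prod>(i, j)\<in>I \<times> J. if j < i then - 1 else 1)"
    by (simp add: inv_sign_def prod.cartesian_product)
  also have "\<dots> = (\<Prod>p\<in>I \<times> J. if snd p < fst p then - 1 else 1)"
    by (rule prod.cong) auto
  also have "\<dots> = (- 1) ^ card {p \<in> I \<times> J. snd p < fst p}"
    using assms by (intro prod_minus_one_if) simp
  also have "{p \<in> I \<times> J. snd p < fst p} = {(i, j). i \<in> I \<and> j \<in> J \<and> i > j}" by auto
  finally show ?thesis by simp
qed

text \<open>The reason for writing the sign as a product over pairs: in each argument it is
  multiplicative for the symmetric difference.\<close>

lemma inv_sign_symdiff_right:
  assumes "finite J" "finite K"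
  shows "inv_sign I (symdiff J K) = inv_sign I J * inv_sign I K"
  unfolding inv_sign_def using assms by (subst prod_symdiff) (auto simp: prod.distrib)

lemma inv_sign_symdiff_left:
  assumes "finite I" "finite J"
  shows "inv_sign (symdiff I J) K = inv_sign I K * inv_sign J K"
  unfolding inv_sign_def using assms by (subst prod_symdiff) (simp_all add: sign_square flip: prod.distrib)

lemma half_power_card:
  assumes "finite U" "A \<subseteq> U"
  shows "(1 / 2 :: real) ^ card A = (\<Prod>k\<in>U. if k \<in> A then 1 / 2 else 1)"
proof -
  have "U \<inter> {k. k \<in> A} = A" using assms by auto
  then show ?thesis using assms by (simp add: prod.If_cases)
qed

text \<open>The cocycle identity behind associativity. For the signs it follows from
  multiplicativity in both arguments; the powers of 1/2 are compared one index at a time.\<close>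

lemma cl_coeff_cocycle:
  assumes "finite I" "finite J" "finite K"
  shows "cl_coeff (symdiff I J) K * cl_coeff I J = cl_coeff I (symdiff J K) * cl_coeff J K"
proof -
  let ?U = "I \<union> J \<union> K"
  have U: "finite ?U" using assms by auto
  have "(1 / 2 :: real) ^ card (symdiff I J \<inter> K) * (1 / 2) ^ card (I \<inter> J)
     = (1 / 2) ^ card (I \<inter> symdiff J K) * (1 / 2) ^ card (J \<inter> K)"
    by (subst (1 2 3 4) half_power_card[OF U])
      (auto simp: symdiff_def simp flip: prod.distrib intro!: prod.cong)
  then show ?thesis
    using assms by (simp add: cl_coeff_def inv_sign_symdiff_left inv_sign_symdiff_right mult_ac)
qed

text \<open>Symmetric difference with I is an involution, so the condition on J in the definition
  has exactly one solution and the double sum collapses.\<close>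

lemma cl_mult_eq:
  assumes "K \<subseteq> {..<n}"
  shows "cl_mult n a b K = (\<Sum>I\<in>Pow {..<n}. cl_coeff I (symdiff I K) * a I * b (symdiff I K))"
  unfolding cl_mult_def
proof (rule sum.cong[OF refl])
  fix I assume I: "I \<in> Pow {..<n}"
  then have fI: "finite I" using finite_subset by auto
  have "(\<Sum>J\<in>Pow {..<n}. if I - J \<union> (J - I) = K
     then (- 1) ^ card {(i, j). i \<in> I \<and> j \<in> J \<and> i > j} * (1 / 2) ^ card (I \<inter> J) * a I * b J else 0)
    = (\<Sum>J\<in>Pow {..<n}. if J = symdiff I K then cl_coeff I J * a I * b J else 0)"
  proof (rule sum.cong[OF refl])
    fix J assume "J \<in> Pow {..<n}"
    then have fJ: "finite J" using finite_subset by auto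
    have "I - J \<union> (J - I) = K \<longleftrightarrow> J = symdiff I K" unfolding symdiff_eq_iff[symmetric] by (simp add: symdiff_def)
    then show "(if I - J \<union> (J - I) = K
     then (- 1) ^ card {(i, j). i \<in> I \<and> j \<in> J \<and> i > j} * (1 / 2) ^ card (I \<inter> J) * a I * b J else 0)
      = (if J = symdiff I K then cl_coeff I J * a I * b J else 0)"
      using inv_sign_eq[OF fI fJ] by (cases "J = symdiff I K") (simp_all add: cl_coeff_def)
  qed
  also have "\<dots> = cl_coeff I (symdiff I K) * a I * b (symdiff I K)"
    using I assms symdiff_subset[of I "{..<n}" K] by simp
  finally show "(\<Sum>J\<in>Pow {..<n}. if I - J \<union> (J - I) = K
     then (- 1) ^ card {(i, j). i \<in> I \<and> j \<in> J \<and> i > j} * (1 / 2) ^ card (I \<inter> J) * a I * b J else 0)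
    = cl_coeff I (symdiff I K) * a I * b (symdiff I K)" .
qed

lemma cl_mult_outside: "\<not> K \<subseteq> {..<n} \<Longrightarrow> cl_mult n a b K = 0"
  unfolding cl_mult_def by (intro sum.neutral ballI) (auto split: if_splits)

definition cl_carrier :: "nat \<Rightarrow> clifford set" where
  "cl_carrier n = {a. \<forall>I. a I \<noteq> 0 \<longrightarrow> I \<subseteq> {..<n}}"

lemma clifford_monoid_simps [simp]:
  "carrier (clifford_monoid n) = cl_carrier n"
  "a \<otimes>\<^bsub>clifford_monoid n\<^esub> b = cl_mult n a b"
  "\<one>\<^bsub>clifford_monoid n\<^esub> = cl_monomial {}"
  by (simp_all add: clifford_monoid_def cl_carrier_def)

lemma cl_carrierD: "a \<in> cl_carrier n \<Longrightarrow> \<not> I \<subseteq> {..<n} \<Longrightarrow> a I = 0"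
  by (auto simp: cl_carrier_def)

lemma cl_carrier_eqI:
  assumes "a \<in> cl_carrier n" "b \<in> cl_carrier n" "\<And>K. K \<subseteq> {..<n} \<Longrightarrow> a K = b K"
  shows "a = b"
  using assms by (auto simp: fun_eq_iff) (metis cl_carrierD)

lemma cl_mult_closed [simp]: "cl_mult n a b \<in> cl_carrier n"
  using cl_mult_outside unfolding cl_carrier_def by blast

lemma cl_monomial_closed: "I \<subseteq> {..<n} \<Longrightarrow> cl_monomial I \<in> cl_carrier n"
  by (simp add: cl_monomial_def cl_carrier_def)

lemma bij_symdiff: "I \<subseteq> {..<n} \<Longrightarrow> bij_betw (symdiff I) (Pow {..<n}) (Pow {..<n})"
  by (rule bij_betw_byWitness[where f'="symdiff I"]) (auto dest: symdiff_subset[of I _])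

lemma cl_mult_assoc: "cl_mult n (cl_mult n a b) c = cl_mult n a (cl_mult n b c)"
proof (rule cl_carrier_eqI)
  fix K assume K: "K \<subseteq> {..<n}"
  let ?P = "Pow {..<n}"
  have fin: "finite I" if "I \<subseteq> {..<n}" for I using that finite_subset by auto
  have "cl_mult n (cl_mult n a b) c K
     = (\<Sum>M\<in>?P. \<Sum>I\<in>?P. cl_coeff M (symdiff M K) * (cl_coeff I (symdiff I M) * a I * b (symdiff I M)) * c (symdiff M K))"
    by (simp add: cl_mult_eq K sum_distrib_left sum_distrib_right)
  also have "\<dots> = (\<Sum>I\<in>?P. \<Sum>M\<in>?P. cl_coeff M (symdiff M K) * (cl_coeff I (symdiff I M) * a I * b (symdiff I M)) * c (symdiff M K))"
    by (rule sum.swap)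
  \<comment> \<open>The substitution M = \<open>symdiff I J\<close> makes both sides sums over the
    same pairs I, J.\<close>
  also have "\<dots> = (\<Sum>I\<in>?P. \<Sum>J\<in>?P. cl_coeff (symdiff I J) (symdiff (symdiff I J) K) * (cl_coeff I J * a I * b J) * c (symdiff (symdiff I J) K))"
  proof (rule sum.cong[OF refl])
    fix I assume "I \<in> ?P"
    then have "bij_betw (symdiff I) ?P ?P" by (intro bij_symdiff) simp
    from sum.reindex_bij_betw[OF this, of "\<lambda>M. cl_coeff M (symdiff M K) * (cl_coeff I (symdiff I M) * a I * b (symdiff I M)) * c (symdiff M K)"]
    show "(\<Sum>M\<in>?P. cl_coeff M (symdiff M K) * (cl_coeff I (symdiff I M) * a I * b (symdiff I M)) * c (symdiff M K))
      = (\<Sum>J\<in>?P. cl_coeff (symdiff I J) (symdiff (symdiff I J) K) * (cl_coeff I J * a I * b J) * c (symdiff (symdiff I J) K))"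
      by simp
  qed
  also have "\<dots> = (\<Sum>I\<in>?P. \<Sum>J\<in>?P. cl_coeff I (symdiff I K) * a I * (cl_coeff J (symdiff J (symdiff I K)) * b J * c (symdiff J (symdiff I K))))"
  proof (intro sum.cong refl)
    fix I J assume IJ: "I \<in> ?P" "J \<in> ?P"
    let ?L = "symdiff (symdiff I J) K"
    have L: "symdiff J (symdiff I K) = ?L" "symdiff J ?L = symdiff I K" by (auto simp: symdiff_def)
    have "cl_coeff (symdiff I J) ?L * cl_coeff I J = cl_coeff I (symdiff I K) * cl_coeff J ?L"
      using cl_coeff_cocycle[of I J ?L] fin IJ K by (simp add: L)
    then show "cl_coeff (symdiff I J) ?L * (cl_coeff I J * a I * b J) * c ?L
      = cl_coeff I (symdiff I K) * a I * (cl_coeff J (symdiff J (symdiff I K)) * b J * c (symdiff J (symdiff I K)))"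
      unfolding L by (simp add: mult_ac)
  qed
  also have "\<dots> = cl_mult n a (cl_mult n b c) K"
    using K by (simp add: cl_mult_eq symdiff_subset sum_distrib_left)
  finally show "cl_mult n (cl_mult n a b) c K = cl_mult n a (cl_mult n b c) K" .
qed simp_all

lemma cl_coeff_empty [simp]: "cl_coeff {} J = 1" "cl_coeff I {} = 1"
  by (simp_all add: cl_coeff_def inv_sign_def)

lemma cl_mult_one_left [simp]: "a \<in> cl_carrier n \<Longrightarrow> cl_mult n (cl_monomial {}) a = a"
proof (rule cl_carrier_eqI)
  fix K assume K: "K \<subseteq> {..<n}"
  have "cl_mult n (cl_monomial {}) a K = (\<Sum>I\<in>Pow {..<n}. if I = {} then a K else 0)"
    unfolding cl_mult_eq[OF K] by (rule sum.cong) (auto simp: cl_monomial_def)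
  then show "cl_mult n (cl_monomial {}) a K = a K" by simp
qed simp_all

lemma cl_mult_one_right [simp]: "a \<in> cl_carrier n \<Longrightarrow> cl_mult n a (cl_monomial {}) = a"
proof (rule cl_carrier_eqI)
  fix K assume K: "K \<subseteq> {..<n}"
  have "cl_mult n a (cl_monomial {}) K = (\<Sum>I\<in>Pow {..<n}. if I = K then a K else 0)"
    unfolding cl_mult_eq[OF K] by (rule sum.cong) (auto simp: cl_monomial_def symdiff_eq_iff)
  then show "cl_mult n a (cl_monomial {}) K = a K" using K by simp
qed simp_all

lemma monoid_clifford: "Group.monoid (clifford_monoid n)"
  by unfold_locales (simp_all add: cl_mult_assoc cl_monomial_closed)

lemma cl_mult_add_left: "cl_mult n (\<lambda>K. a K + b K) c = (\<lambda>K. cl_mult n a c K + cl_mult n b c K)"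
proof (rule ext)
  show "cl_mult n (\<lambda>K. a K + b K) c K = cl_mult n a c K + cl_mult n b c K" for K
    by (cases "K \<subseteq> {..<n}") (simp_all add: cl_mult_outside cl_mult_eq sum.distrib algebra_simps)
qed

lemma cl_mult_scale_left: "cl_mult n (\<lambda>K. r * a K) c = (\<lambda>K. r * cl_mult n a c K)"
proof (rule ext)
  show "cl_mult n (\<lambda>K. r * a K) c K = r * cl_mult n a c K" for K
    by (cases "K \<subseteq> {..<n}") (simp_all add: cl_mult_outside cl_mult_eq sum_distrib_left mult_ac)
qed

lemma cl_mult_scale_right: "cl_mult n a (\<lambda>K. r * c K) = (\<lambda>K. r * cl_mult n a c K)"
proof (rule ext)
  show "cl_mult n a (\<lambda>K. r * c K) K = r * cl_mult n a c K" for K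
    by (cases "K \<subseteq> {..<n}") (simp_all add: cl_mult_outside cl_mult_eq sum_distrib_left mult_ac)
qed

lemma cl_mult_sum_left: "cl_mult n (\<lambda>K. \<Sum>i\<in>S. a i K) c = (\<lambda>K. \<Sum>i\<in>S. cl_mult n (a i) c K)"
proof (rule ext)
  show "cl_mult n (\<lambda>K. \<Sum>i\<in>S. a i K) c K = (\<Sum>i\<in>S. cl_mult n (a i) c K)" for K
    by (cases "K \<subseteq> {..<n}")
      (simp_all add: cl_mult_outside cl_mult_eq sum_distrib_left sum_distrib_right sum.swap[of _ S])
qed

lemma cl_mult_sum_right: "cl_mult n a (\<lambda>K. \<Sum>i\<in>S. c i K) = (\<lambda>K. \<Sum>i\<in>S. cl_mult n a (c i) K)"
proof (rule ext)
  show "cl_mult n a (\<lambda>K. \<Sum>i\<in>S. c i K) K = (\<Sum>i\<in>S. cl_mult n a (c i) K)" for K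
    by (cases "K \<subseteq> {..<n}")
      (simp_all add: cl_mult_outside cl_mult_eq sum_distrib_left sum.swap[of _ S])
qed

lemma cl_parity_mult: "cl_parity (cl_mult n a b) = cl_mult n (cl_parity a) (cl_parity b)"
proof (rule ext)
  fix K
  show "cl_parity (cl_mult n a b) K = cl_mult n (cl_parity a) (cl_parity b) K"
  proof (cases "K \<subseteq> {..<n}")
    case True
    \<comment> \<open>The parity sign is multiplicative for the symmetric difference: this is
      \<open>prod_symdiff\<close> with all factors equal to -1.\<close>
    have s: "(- 1 :: real) ^ card K = (- 1) ^ card I * (- 1) ^ card (symdiff I K)" if "I \<subseteq> {..<n}" for I
    proof -
      have "finite I" "finite K" using that True finite_subset by auto
      then have "(\<Prod>i\<in>symdiff I (symdiff I K). - 1 :: real) = (\<Prod>i\<in>I. - 1) * (\<Prod>i\<in>symdiff I K. - 1)"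
        by (intro prod_symdiff) auto
      then show ?thesis by simp
    qed
    show ?thesis
      unfolding cl_parity_def cl_mult_eq[OF True] sum_distrib_left
    proof (rule sum.cong[OF refl])
      fix I assume "I \<in> Pow {..<n}"
      then have sI: "(- 1 :: real) ^ card K = (- 1) ^ card I * (- 1) ^ card (symdiff I K)" using s by blast
      show "(- 1) ^ card K * (cl_coeff I (symdiff I K) * a I * b (symdiff I K))
        = cl_coeff I (symdiff I K) * ((- 1) ^ card I * a I) * ((- 1) ^ card (symdiff I K) * b (symdiff I K))"
        by (subst sI) (simp only: mult_ac)
    qed
  qed (simp add: cl_parity_def cl_mult_outside)
qed

text \<open>Exterior and interior multiplication by a generator. Left Clifford multiplication is
  \<open>ext_mult + int_mult / 2\<close>, and \<open>x \<mapsto> \<alpha>(x) x\<^sub>i\<close> is \<open>ext_mult - int_mult / 2\<close>.\<close>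

definition pos_sign :: "nat \<Rightarrow> nat set \<Rightarrow> real" where
  "pos_sign i K = (- 1) ^ card {j \<in> K. j < i}"

definition ext_mult :: "nat \<Rightarrow> clifford \<Rightarrow> clifford" where
  "ext_mult i x K = (if i \<in> K then pos_sign i K * x (K - {i}) else 0)"

definition int_mult :: "nat \<Rightarrow> clifford \<Rightarrow> clifford" where
  "int_mult i x K = (if i \<notin> K then pos_sign i K * x (insert i K) else 0)"

lemma pos_sign_Diff [simp]: "pos_sign i (K - {i}) = pos_sign i K"
  unfolding pos_sign_def by (rule arg_cong[of _ _ "\<lambda>S. _ ^ card S"]) auto

lemma pos_sign_insert [simp]: "pos_sign i (insert i K) = pos_sign i K"
  unfolding pos_sign_def by (rule arg_cong[of _ _ "\<lambda>S. _ ^ card S"]) auto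

lemma inv_sign_singleton: "finite K \<Longrightarrow> inv_sign {i} K = pos_sign i K"
  by (simp add: inv_sign_def pos_sign_def prod_minus_one_if)

text \<open>The extra sign is the one that the parity automorphism compensates: after twisting,
  right multiplication by a generator has the same exterior part as left multiplication and the
  opposite interior part.\<close>

lemma inv_sign_singleton_right: "finite K \<Longrightarrow> inv_sign K {i} = pos_sign i K * (- 1) ^ card (K - {i})"
proof -
  assume fin: "finite K"
  have "K - {i} = {j \<in> K. j < i} \<union> {j \<in> K. i < j}" by auto
  then have "card (K - {i}) = card {j \<in> K. j < i} + card {j \<in> K. i < j}"
    using fin by (simp add: card_Un_disjoint disjoint_iff)
  moreover have "inv_sign K {i} = (- 1) ^ card {j \<in> K. i < j}"
    using fin prod_minus_one_if[of K "\<lambda>k. i < k"] by (simp add: inv_sign_def)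
  ultimately show ?thesis
    by (simp add: pos_sign_def power_add flip: mult.assoc power_mult_distrib)
qed

lemma cl_mult_generator_left:
  assumes "i < n" "x \<in> cl_carrier n"
  shows "cl_mult n (cl_monomial {i}) x = (\<lambda>K. ext_mult i x K + int_mult i x K / 2)"
proof (rule ext)
  fix K
  show "cl_mult n (cl_monomial {i}) x K = ext_mult i x K + int_mult i x K / 2"
  proof (cases "K \<subseteq> {..<n}")
    case True
    then have fin: "finite K" using finite_subset by auto
    have "cl_mult n (cl_monomial {i}) x K
      = (\<Sum>I\<in>Pow {..<n}. if I = {i} then cl_coeff {i} (symdiff {i} K) * x (symdiff {i} K) else 0)"
      unfolding cl_mult_eq[OF True] by (rule sum.cong) (auto simp: cl_monomial_def)
    also have "\<dots> = cl_coeff {i} (symdiff {i} K) * x (symdiff {i} K)" using assms by simp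
    also have "\<dots> = ext_mult i x K + int_mult i x K / 2"
      using fin by (simp add: symdiff_singleton cl_coeff_def inv_sign_singleton ext_mult_def int_mult_def)
    finally show ?thesis .
  next
    case False
    then have "\<not> insert i K \<subseteq> {..<n}" "\<not> K - {i} \<subseteq> {..<n}" using assms by auto
    then show ?thesis using False assms by (simp add: cl_mult_outside ext_mult_def int_mult_def cl_carrierD)
  qed
qed

lemma cl_mult_generator_right:
  assumes "i < n" "x \<in> cl_carrier n"
  shows "cl_mult n (cl_parity x) (cl_monomial {i}) = (\<lambda>K. ext_mult i x K - int_mult i x K / 2)"
proof (rule ext)
  fix K
  show "cl_mult n (cl_parity x) (cl_monomial {i}) K = ext_mult i x K - int_mult i x K / 2"
  proof (cases "K \<subseteq> {..<n}")
    case True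
    then have fin: "finite K" using finite_subset by auto
    let ?I = "symdiff {i} K"
    have eq: "symdiff I K = {i} \<longleftrightarrow> I = ?I" for I by (auto simp: symdiff_def)
    have "cl_mult n (cl_parity x) (cl_monomial {i}) K
      = (\<Sum>I\<in>Pow {..<n}. if I = ?I then cl_coeff ?I {i} * cl_parity x ?I else 0)"
      unfolding cl_mult_eq[OF True] cl_monomial_def eq
    proof (rule sum.cong[OF refl])
      fix I
      have "symdiff ?I K = {i}" by (auto simp: symdiff_def)
      then show "cl_coeff I (symdiff I K) * cl_parity x I * (if I = ?I then 1 else 0)
        = (if I = ?I then cl_coeff ?I {i} * cl_parity x ?I else 0)" by simp
    qed
    also have "\<dots> = cl_coeff ?I {i} * cl_parity x ?I"
      using assms True symdiff_subset[of "{i}" "{..<n}" K] by simp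
    also have "\<dots> = ext_mult i x K - int_mult i x K / 2"
    proof (cases "i \<in> K")
      case True
      then show ?thesis using fin
        by (simp add: symdiff_singleton cl_coeff_def inv_sign_singleton_right ext_mult_def int_mult_def cl_parity_def
           flip: mult.assoc power_mult_distrib)
    next
      case False
      then show ?thesis using fin
        by (simp add: symdiff_singleton cl_coeff_def inv_sign_singleton_right ext_mult_def int_mult_def cl_parity_def
           flip: power_mult_distrib)
    qed
    finally show ?thesis .
  next
    case False
    then have "\<not> insert i K \<subseteq> {..<n}" "\<not> K - {i} \<subseteq> {..<n}" using assms by auto
    then show ?thesis using False assms by (simp add: cl_mult_outside ext_mult_def int_mult_def cl_carrierD)
  qed
qed

lemma ext_mult_closed: "i < n \<Longrightarrow> x \<in> cl_carrier n \<Longrightarrow> ext_mult i x \<in> cl_carrier n"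
  by (auto simp: cl_carrier_def ext_mult_def split: if_splits)

lemma int_mult_closed: "i < n \<Longrightarrow> x \<in> cl_carrier n \<Longrightarrow> int_mult i x \<in> cl_carrier n"
  by (auto simp: cl_carrier_def int_mult_def split: if_splits)

text \<open>Multiplication by a generator mixes only the two members of a pair K,
  \<open>insert i K\<close>, so identities about it are checked pair by pair.\<close>

lemma sum_Pow_split:
  fixes F :: "nat set \<Rightarrow> real"
  assumes "i < n"
  shows "(\<Sum>K\<in>Pow {..<n}. F K) = (\<Sum>K\<in>Pow ({..<n} - {i}). F K + F (insert i K))"
proof -
  have "{..<n} = insert i ({..<n} - {i})" using assms by auto
  then have "Pow {..<n} = Pow ({..<n} - {i}) \<union> insert i ` Pow ({..<n} - {i})" by (metis Pow_insert)
  then have "(\<Sum>K\<in>Pow {..<n}. F K) = (\<Sum>K\<in>Pow ({..<n} - {i}). F K) + (\<Sum>K\<in>insert i ` Pow ({..<n} - {i}). F K)"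
    by (simp add: sum.union_disjoint[symmetric] disjoint_iff) (subst sum.union_disjoint; auto)
  also have "(\<Sum>K\<in>insert i ` Pow ({..<n} - {i}). F K) = (\<Sum>K\<in>Pow ({..<n} - {i}). F (insert i K))"
    by (subst sum.reindex) (auto intro!: inj_onI simp: o_def dest!: insert_ident[THEN iffD1, rotated 2])
  finally show ?thesis by (simp add: sum.distrib)
qed

text \<open>For the weights below, left multiplication by a vector is self-adjoint; hence elements of the
  Pin group act orthogonally, and have the same scalar part as their inverses.\<close>

definition cl_inner :: "nat \<Rightarrow> clifford \<Rightarrow> clifford \<Rightarrow> real" where
  "cl_inner n x y = (\<Sum>I\<in>Pow {..<n}. (1 / 2) ^ card I * x I * y I)"

lemma cl_inner_one_right: "cl_inner n x (cl_monomial {}) = x {}"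
proof -
  have "cl_inner n x (cl_monomial {}) = (\<Sum>I\<in>Pow {..<n}. if I = {} then x {} else 0)"
    unfolding cl_inner_def by (rule sum.cong) (auto simp: cl_monomial_def)
  then show ?thesis by simp
qed

lemma cl_inner_commute: "cl_inner n x y = cl_inner n y x"
  by (simp add: cl_inner_def mult_ac)

lemma cl_inner_sum_left: "cl_inner n (\<lambda>K. \<Sum>i\<in>S. c i * x i K) y = (\<Sum>i\<in>S. c i * cl_inner n (x i) y)"
  unfolding cl_inner_def
  by (simp add: sum_distrib_left sum_distrib_right mult_ac sum.swap[of _ S])

text \<open>On a pair K, \<open>insert i K\<close> left multiplication by the generator adds i with
  coefficient 1 and removes it with coefficient 1/2, up to a common sign. The ratio 1/2 of the two
  weights makes this symmetric.\<close>

lemma cl_inner_generator: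
  assumes i: "i < n" and x: "x \<in> cl_carrier n" and y: "y \<in> cl_carrier n"
  shows "cl_inner n (cl_mult n (cl_monomial {i}) x) y = cl_inner n x (cl_mult n (cl_monomial {i}) y)"
  unfolding cl_inner_def cl_mult_generator_left[OF i x] cl_mult_generator_left[OF i y] sum_Pow_split[OF i]
proof (rule sum.cong[OF refl])
  fix K assume K: "K \<in> Pow ({..<n} - {i})"
  then have "finite K" "i \<notin> K" using finite_subset[of K "{..<n} - {i}"] by auto
  then show "(1 / 2) ^ card K * (ext_mult i x K + int_mult i x K / 2) * y K +
         (1 / 2) ^ card (insert i K) * (ext_mult i x (insert i K) + int_mult i x (insert i K) / 2) * y (insert i K) =
         (1 / 2) ^ card K * x K * (ext_mult i y K + int_mult i y K / 2) +
         (1 / 2) ^ card (insert i K) * x (insert i K) * (ext_mult i y (insert i K) + int_mult i y (insert i K) / 2)"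
    by (simp add: ext_mult_def int_mult_def mult_ac)
qed

definition cl_coord_vec :: "nat \<Rightarrow> (nat \<Rightarrow> real) \<Rightarrow> clifford" where
  "cl_coord_vec n c = (\<lambda>I. \<Sum>i<n. c i * cl_monomial {i} I)"

lemma cl_vec_eq: "cl_vec ip es \<xi> = cl_coord_vec (length es) (\<lambda>i. ip \<xi> (es ! i))"
  by (simp add: cl_vec_def cl_coord_vec_def)

lemma cl_coord_vec_closed [simp]: "cl_coord_vec n c \<in> cl_carrier n"
proof -
  have "cl_coord_vec n c I = 0" if "\<not> I \<subseteq> {..<n}" for I
    unfolding cl_coord_vec_def cl_monomial_def by (rule sum.neutral) (use that in auto)
  then show ?thesis unfolding cl_carrier_def by blast
qed

lemma cl_mult_coord_vec_left:
  assumes "x \<in> cl_carrier n"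
  shows "cl_mult n (cl_coord_vec n c) x = (\<lambda>K. \<Sum>i<n. c i * (ext_mult i x K + int_mult i x K / 2))"
  unfolding cl_coord_vec_def cl_mult_sum_left cl_mult_scale_left
  using assms by (intro ext sum.cong refl) (simp add: cl_mult_generator_left)

lemma cl_mult_coord_vec_right:
  assumes "x \<in> cl_carrier n"
  shows "cl_mult n (cl_parity x) (cl_coord_vec n c) = (\<lambda>K. \<Sum>i<n. c i * (ext_mult i x K - int_mult i x K / 2))"
  unfolding cl_coord_vec_def cl_mult_sum_right cl_mult_scale_right
  using assms by (intro ext sum.cong refl) (simp add: cl_mult_generator_right)

lemma cl_inner_coord_vec:
  assumes "x \<in> cl_carrier n" "y \<in> cl_carrier n"
  shows "cl_inner n (cl_mult n (cl_coord_vec n c) x) y = cl_inner n x (cl_mult n (cl_coord_vec n c) y)"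
proof -
  have *: "cl_inner n (cl_mult n (cl_coord_vec n c) x) y = (\<Sum>i<n. c i * cl_inner n (cl_mult n (cl_monomial {i}) x) y)"
    if "x \<in> cl_carrier n" for x y
    unfolding cl_coord_vec_def cl_mult_sum_left cl_mult_scale_left by (rule cl_inner_sum_left)
  show ?thesis
    unfolding *[OF assms(1)] cl_inner_commute[of n x] *[OF assms(2)]
    using assms by (intro sum.cong refl) (simp add: cl_inner_generator cl_inner_commute[of n x])
qed

subsection \<open>Forms obtained by substitution and elements of the Pin group\<close>

lemma contract_wedge_list_one_forms:
  "contract v (wedge_list (map one_form fs)) vs
   = (\<Sum>r<length fs. (- 1) ^ r * (fs ! r) v * wedge_list (map one_form (take r fs @ drop (Suc r) fs)) vs)"
proof (induction fs arbitrary: vs)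
  case (Cons f fs)
  have "contract v (wedge_list (map one_form (f # fs))) vs
    = f v * wedge_list (map one_form fs) vs - wedge (one_form f) (contract v (wedge_list (map one_form fs))) vs"
    by (simp add: contract_wedge contract_one_form wedge_scale_left grade_inv_one_form wedge_minus_left)
  also have "contract v (wedge_list (map one_form fs))
    = (\<lambda>vs. \<Sum>r<length fs. ((- 1) ^ r * (fs ! r) v) * wedge_list (map one_form (take r fs @ drop (Suc r) fs)) vs)"
    using Cons by blast
  also have "wedge (one_form f) (\<lambda>vs. \<Sum>r<length fs. ((- 1) ^ r * (fs ! r) v) * wedge_list (map one_form (take r fs @ drop (Suc r) fs)) vs) vs
    = (\<Sum>r<length fs. (- 1) ^ r * (fs ! r) v * wedge_list (map one_form (f # take r fs @ drop (Suc r) fs)) vs)"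
    unfolding wedge_sum_right wedge_scale_right by simp
  finally show ?case
    by (simp add: sum.lessThan_Suc_shift sum_negf[symmetric] del: wedge_list_Cons sum.lessThan_Suc)
qed (simp add: contract_def unit_form_def)

text \<open>Contraction with the first vector is the Laplace expansion along the first
  column.\<close>

lemma wedge_list_one_forms_det:
  "length fs = n \<Longrightarrow> length vs = n \<Longrightarrow>
   wedge_list (map one_form fs) vs = Determinant.det (mat n n (\<lambda>(r, c). (fs ! r) (vs ! c)))"
proof (induction vs arbitrary: n fs)
  case Nil
  then show ?case by (simp add: unit_form_def Determinant.det_def permutes_empty sign_id)
next
  case (Cons v vs)
  let ?A = "mat n n (\<lambda>(r, c). (fs ! r) ((v # vs) ! c))"
  have n: "n = Suc (length vs)" using Cons by simp
  have "wedge_list (map one_form fs) (v # vs) = contract v (wedge_list (map one_form fs)) vs"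
    by (simp add: contract_def)
  also have "\<dots> = (\<Sum>r<n. ?A $$ (r, 0) * cofactor ?A r 0)"
    unfolding contract_wedge_list_one_forms Cons(2)
  proof (rule sum.cong[OF refl])
    fix r assume "r \<in> {..<n}"
    then have r: "r < n" by simp
    let ?gs = "take r fs @ drop (Suc r) fs"
    have "wedge_list (map one_form ?gs) vs = Determinant.det (mat (n - 1) (n - 1) (\<lambda>(r, c). (?gs ! r) (vs ! c)))"
      by (rule Cons.IH) (use Cons(2) r n in auto)
    also have "mat (n - 1) (n - 1) (\<lambda>(r, c). (?gs ! r) (vs ! c)) = mat_delete ?A r 0"
      unfolding mat_delete_def by (rule eq_matI) (use Cons(2) r n in \<open>auto simp: nth_append\<close>)
    finally show "(- 1) ^ r * (fs ! r) v * wedge_list (map one_form ?gs) vs = ?A $$ (r, 0) * cofactor ?A r 0"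
      using r by (simp add: cofactor_def)
  qed
  also have "\<dots> = Determinant.det ?A"
    using laplace_expansion_column[of ?A n 0] n by simp
  finally show ?case .
qed

lemma wedge_list_one_forms_degree:
  "length fs \<noteq> length vs \<Longrightarrow> wedge_list (map one_form fs) vs = 0"
proof (induction vs arbitrary: fs)
  case Nil
  then show ?case by (cases fs) (simp_all add: one_form_def)
next
  case (Cons v vs)
  have "wedge_list (map one_form fs) (v # vs) = contract v (wedge_list (map one_form fs)) vs"
    by (simp add: contract_def)
  also have "\<dots> = 0"
    unfolding contract_wedge_list_one_forms
  proof (rule sum.neutral, rule ballI)
    fix r assume "r \<in> {..<length fs}"
    then have "length (take r fs @ drop (Suc r) fs) \<noteq> length vs" using Cons.prems by auto
    from Cons.IH[OF this]
    show "(- 1) ^ r * (fs ! r) v * wedge_list (map one_form (take r fs @ drop (Suc r) fs)) vs = 0" by simp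
  qed
  finally show ?case .
qed

lemma pos_sign_insert_less:
  assumes "finite I" "x \<notin> I" "x < i"
  shows "pos_sign i (insert x I) = - pos_sign i I"
proof -
  have "{j \<in> insert x I. j < i} = insert x {j \<in> I. j < i}" using assms by auto
  then show ?thesis using assms by (simp add: pos_sign_def)
qed

lemma pos_sign_eq_1: "(\<And>j. j \<in> I \<Longrightarrow> i \<le> j) \<Longrightarrow> pos_sign i I = 1"
proof -
  assume "\<And>j. j \<in> I \<Longrightarrow> i \<le> j"
  then have "{j \<in> I. j < i} = {}" by fastforce
  then show ?thesis by (simp only: pos_sign_def card.empty power_0)
qed

definition wedge_monomial :: "(nat \<Rightarrow> 'v \<Rightarrow> real) \<Rightarrow> nat set \<Rightarrow> 'v mform" where
  "wedge_monomial \<beta> I = wedge_list (map (\<lambda>i. one_form (\<beta> i)) (sorted_list_of_set I))"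

lemma wedge_monomial_set:
  "sorted_wrt (<) xs \<Longrightarrow> wedge_monomial \<beta> (set xs) = wedge_list (map (\<lambda>i. one_form (\<beta> i)) xs)"
  unfolding wedge_monomial_def
  by (simp add: strict_sorted_iff sorted_list_of_set.idem_if_sorted_distinct)

lemma wedge_one_form_anticommute:
  "wedge (one_form f) (wedge (one_form g) b) vs = - wedge (one_form g) (wedge (one_form f) b) vs"
proof -
  have "wedge (one_form f) (one_form g) = (\<lambda>vs. - wedge (one_form g) (one_form f) vs)"
    by (subst one_form_wedge_commute) (simp add: grade_inv_one_form wedge_minus_left fun_eq_iff)
  then show ?thesis by (simp add: wedge_minus_left flip: wedge_assoc)
qed

lemma wedge_one_form_twice: "wedge (one_form f) (wedge (one_form f) b) vs = 0"
  using wedge_one_form_anticommute[of f f b vs] by simp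

text \<open>The new factor is moved past the smaller indices to its place in the increasing order,
  with one sign for each of them; hence \<open>pos_sign\<close>.\<close>

lemma wedge_one_form_monomial:
  assumes "finite I"
  shows "wedge (one_form (\<beta> i)) (wedge_monomial \<beta> I) vs
    = (if i \<in> I then 0 else pos_sign i I * wedge_monomial \<beta> (insert i I) vs)"
proof -
  have "wedge (one_form (\<beta> i)) (wedge_monomial \<beta> (set xs)) vs
    = (if i \<in> set xs then 0 else pos_sign i (set xs) * wedge_monomial \<beta> (insert i (set xs)) vs)"
    if "sorted_wrt (<) xs" for xs vs
    using that
  proof (induction xs arbitrary: vs)
    case Nil
    have "wedge_monomial \<beta> {i} = wedge_monomial \<beta> (set [i])" by simp
    also have "\<dots> = one_form (\<beta> i)" by (subst wedge_monomial_set) simp_all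
    finally have "wedge_monomial \<beta> {i} = one_form (\<beta> i)" .
    moreover have "wedge_monomial \<beta> {} = unit_form" by (simp add: wedge_monomial_def)
    ultimately show ?case by (simp add: pos_sign_def)
  next
    case (Cons x xs)
    have xs: "sorted_wrt (<) xs" "x \<notin> set xs" and less: "\<And>j. j \<in> set xs \<Longrightarrow> x < j"
      using Cons.prems by auto
    have x: "wedge_monomial \<beta> (set (x # xs)) = wedge (one_form (\<beta> x)) (wedge_monomial \<beta> (set xs))"
      using Cons.prems xs by (simp only: wedge_monomial_set) simp
    consider "i < x" | "i = x" | "x < i" by linarith
    then show ?case
    proof cases
      case 1
      then have s: "sorted_wrt (<) (i # x # xs)" using Cons.prems by auto
      have "wedge_monomial \<beta> (insert i (set (x # xs))) = wedge_monomial \<beta> (set (i # x # xs))" by simp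
      also have "\<dots> = wedge (one_form (\<beta> i)) (wedge_monomial \<beta> (set (x # xs)))"
        using s Cons.prems by (simp only: wedge_monomial_set) simp
      finally have "wedge (one_form (\<beta> i)) (wedge_monomial \<beta> (set (x # xs))) vs
        = wedge_monomial \<beta> (insert i (set (x # xs))) vs" by simp
      moreover have "i \<notin> set (x # xs)" using s by auto
      moreover have "pos_sign i (set (x # xs)) = 1"
        by (rule pos_sign_eq_1) (use 1 less in \<open>auto intro: less_imp_le less_trans\<close>)
      ultimately show ?thesis by simp
    next
      case 2
      then show ?thesis unfolding x by (simp add: wedge_one_form_twice)
    next
      case 3
      have "wedge (one_form (\<beta> i)) (wedge_monomial \<beta> (set (x # xs))) vs
        = - wedge (one_form (\<beta> x)) (wedge (one_form (\<beta> i)) (wedge_monomial \<beta> (set xs))) vs"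
        unfolding x by (rule wedge_one_form_anticommute)
      also have "wedge (one_form (\<beta> i)) (wedge_monomial \<beta> (set xs)) = (\<lambda>vs. (if i \<in> set xs then 0 else pos_sign i (set xs)) * wedge_monomial \<beta> (insert i (set xs)) vs)"
        using Cons.IH[OF xs(1)] by (auto simp: fun_eq_iff)
      also have "wedge (one_form (\<beta> x)) \<dots> vs = (if i \<in> set xs then 0 else pos_sign i (set xs)) * wedge (one_form (\<beta> x)) (wedge_monomial \<beta> (insert i (set xs))) vs"
        by (rule wedge_scale_right)
      also have "wedge (one_form (\<beta> x)) (wedge_monomial \<beta> (insert i (set xs))) = wedge_monomial \<beta> (insert i (set (x # xs)))"
      proof -
        define zs where "zs = sorted_list_of_set (insert i (set xs))"
        have zs: "sorted_wrt (<) zs" "set zs = insert i (set xs)"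
          unfolding zs_def by (simp_all del: sorted_list_of_set_insert_remove sorted_list_of_set.sorted_key_list_of_set_insert_remove)
        then have "sorted_wrt (<) (x # zs)" using less 3 by auto
        then have "wedge_monomial \<beta> (set (x # zs)) = wedge (one_form (\<beta> x)) (wedge_monomial \<beta> (set zs))"
          using zs(1) by (simp only: wedge_monomial_set) simp
        then show ?thesis using zs by (simp add: insert_commute)
      qed
      finally show ?thesis
        using 3 xs pos_sign_insert_less[of "set xs" x i] by auto
    qed
  qed
  from this[of "sorted_list_of_set I"] show ?thesis using assms by simp
qed

lemma contract_wedge_monomial:
  assumes "finite I"
  shows "contract v (wedge_monomial \<beta> I) vs = (\<Sum>j\<in>I. pos_sign j I * \<beta> j v * wedge_monomial \<beta> (I - {j}) vs)"
proof -
  have "contract v (wedge_monomial \<beta> (set xs)) vs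
     = (\<Sum>j\<in>set xs. pos_sign j (set xs) * \<beta> j v * wedge_monomial \<beta> (set xs - {j}) vs)"
    if "sorted_wrt (<) xs" for xs vs
    using that
  proof (induction xs arbitrary: vs)
    case Nil
    then show ?case by (simp add: wedge_monomial_def)
  next
    case (Cons x xs)
    have xs: "sorted_wrt (<) xs" "x \<notin> set xs" and less: "\<And>j. j \<in> set xs \<Longrightarrow> x < j"
      using Cons.prems by auto
    have x: "wedge_monomial \<beta> (set (x # xs)) = wedge (one_form (\<beta> x)) (wedge_monomial \<beta> (set xs))"
      using Cons.prems xs by (simp only: wedge_monomial_set) simp
    have "contract v (wedge_monomial \<beta> (set (x # xs))) vs
      = \<beta> x v * wedge_monomial \<beta> (set xs) vs - wedge (one_form (\<beta> x)) (contract v (wedge_monomial \<beta> (set xs))) vs"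
      unfolding x by (simp add: contract_wedge contract_one_form wedge_scale_left grade_inv_one_form wedge_minus_left)
    also have "contract v (wedge_monomial \<beta> (set xs)) =
      (\<lambda>vs. \<Sum>j\<in>set xs. (pos_sign j (set xs) * \<beta> j v) * wedge_monomial \<beta> (set xs - {j}) vs)"
      using Cons.IH[OF xs(1)] by blast
    also have "wedge (one_form (\<beta> x)) \<dots> vs = (\<Sum>j\<in>set xs. (pos_sign j (set xs) * \<beta> j v) * wedge (one_form (\<beta> x)) (wedge_monomial \<beta> (set xs - {j})) vs)"
      unfolding wedge_sum_right wedge_scale_right ..
    also have "\<dots> = (\<Sum>j\<in>set xs. - (pos_sign j (set (x # xs)) * \<beta> j v * wedge_monomial \<beta> (set (x # xs) - {j}) vs))"
    proof (rule sum.cong[OF refl])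
      fix j assume j: "j \<in> set xs"
      have "pos_sign x (set xs - {j}) = 1"
        by (rule pos_sign_eq_1) (use less in \<open>auto intro: less_imp_le\<close>)
      moreover have "insert x (set xs - {j}) = set (x # xs) - {j}" using j less by auto
      ultimately show "(pos_sign j (set xs) * \<beta> j v) * wedge (one_form (\<beta> x)) (wedge_monomial \<beta> (set xs - {j})) vs
        = - (pos_sign j (set (x # xs)) * \<beta> j v * wedge_monomial \<beta> (set (x # xs) - {j}) vs)"
        using xs j less pos_sign_insert_less[of "set xs" x j] by (simp add: wedge_one_form_monomial)
    qed
    also have "\<beta> x v * wedge_monomial \<beta> (set xs) vs = pos_sign x (set (x # xs)) * \<beta> x v * wedge_monomial \<beta> (set (x # xs) - {x}) vs"
      using xs less by (subst pos_sign_eq_1) (auto intro: less_imp_le)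
    finally show ?case using xs by (simp add: sum_negf)
  qed
  from this[of "sorted_list_of_set I"] show ?thesis using assms by simp
qed

text \<open>The algebra map \<open>y\<^sub>i \<mapsto> \<beta>\<^sub>i\<close> on coefficient families.\<close>

definition subst_ext :: "nat \<Rightarrow> (nat \<Rightarrow> 'v \<Rightarrow> real) \<Rightarrow> clifford \<Rightarrow> 'v mform" where
  "subst_ext n \<beta> x vs = (\<Sum>I\<in>Pow {..<n}. x I * wedge_monomial \<beta> I vs)"

lemma subst_ext_ext_mult:
  assumes i: "i < n"
  shows "subst_ext n \<beta> (ext_mult i x) = wedge (one_form (\<beta> i)) (subst_ext n \<beta> x)"
proof (rule ext)
  fix vs
  have "wedge (one_form (\<beta> i)) (subst_ext n \<beta> x) vs
     = (\<Sum>I\<in>Pow {..<n}. x I * wedge (one_form (\<beta> i)) (wedge_monomial \<beta> I) vs)"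
    unfolding subst_ext_def wedge_sum_right wedge_scale_right ..
  also have "\<dots> = (\<Sum>I\<in>Pow {..<n}. x I * (if i \<in> I then 0 else pos_sign i I * wedge_monomial \<beta> (insert i I) vs))"
    by (intro sum.cong refl arg_cong[where f="(*) _"] wedge_one_form_monomial) (auto intro: finite_subset)
  also have "\<dots> = subst_ext n \<beta> (ext_mult i x) vs"
    unfolding subst_ext_def sum_Pow_split[OF i]
    by (intro sum.cong refl) (auto simp: ext_mult_def insert_Diff_if)
  finally show "subst_ext n \<beta> (ext_mult i x) vs = wedge (one_form (\<beta> i)) (subst_ext n \<beta> x) vs" ..
qed

text \<open>Contraction becomes interior multiplication on coefficients. Together with
  \<open>subst_ext_ext_mult\<close> this carries the calculus of forms over to the Clifford
  algebra.\<close>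

lemma contract_subst_ext:
  "contract v (subst_ext n \<beta> x) = subst_ext n \<beta> (\<lambda>K. \<Sum>i<n. \<beta> i v * int_mult i x K)"
proof (rule ext)
  fix vs
  have "contract v (subst_ext n \<beta> x) vs = (\<Sum>I\<in>Pow {..<n}. x I * contract v (wedge_monomial \<beta> I) vs)"
    by (simp add: contract_def subst_ext_def)
  also have "\<dots> = (\<Sum>I\<in>Pow {..<n}. x I * (\<Sum>j<n. if j \<in> I then pos_sign j I * \<beta> j v * wedge_monomial \<beta> (I - {j}) vs else 0))"
  proof (intro sum.cong refl arg_cong[where f="(*) _"])
    fix I assume I: "I \<in> Pow {..<n}"
    then have "finite I" "{..<n} \<inter> I = I" using finite_subset by auto
    then show "contract v (wedge_monomial \<beta> I) vs = (\<Sum>j<n. if j \<in> I then pos_sign j I * \<beta> j v * wedge_monomial \<beta> (I - {j}) vs else 0)"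
      by (simp add: contract_wedge_monomial sum.inter_restrict[symmetric])
  qed
  also have "\<dots> = (\<Sum>j<n. \<Sum>I\<in>Pow {..<n}. if j \<in> I then x I * (pos_sign j I * \<beta> j v * wedge_monomial \<beta> (I - {j}) vs) else 0)"
    unfolding sum_distrib_left by (subst sum.swap) (intro sum.cong refl, simp)
  also have "\<dots> = (\<Sum>j<n. \<Sum>I\<in>Pow {..<n}. \<beta> j v * int_mult j x I * wedge_monomial \<beta> I vs)"
  proof (rule sum.cong[OF refl])
    fix j assume "j \<in> {..<n}"
    then have j: "j < n" by simp
    show "(\<Sum>I\<in>Pow {..<n}. if j \<in> I then x I * (pos_sign j I * \<beta> j v * wedge_monomial \<beta> (I - {j}) vs) else 0)
      = (\<Sum>I\<in>Pow {..<n}. \<beta> j v * int_mult j x I * wedge_monomial \<beta> I vs)"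
      unfolding sum_Pow_split[OF j] by (intro sum.cong refl) (auto simp: int_mult_def)
  qed
  also have "\<dots> = subst_ext n \<beta> (\<lambda>K. \<Sum>i<n. \<beta> i v * int_mult i x K) vs"
    unfolding subst_ext_def sum_distrib_right by (rule sum.swap)
  finally show "contract v (subst_ext n \<beta> x) vs = subst_ext n \<beta> (\<lambda>K. \<Sum>i<n. \<beta> i v * int_mult i x K) vs" .
qed

lemma subst_ext_sum: "subst_ext n \<beta> (\<lambda>K. \<Sum>i\<in>S. c i * x i K) vs = (\<Sum>i\<in>S. c i * subst_ext n \<beta> (x i) vs)"
  unfolding subst_ext_def by (simp add: sum_distrib_left sum_distrib_right mult_ac sum.swap[of _ S])

lemma subst_ext_one: "subst_ext n \<beta> (cl_monomial {}) = unit_form"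
proof (rule ext)
  fix vs
  have "subst_ext n \<beta> (cl_monomial {}) vs = (\<Sum>I\<in>Pow {..<n}. if I = {} then wedge_monomial \<beta> {} vs else 0)"
    unfolding subst_ext_def by (rule sum.cong) (auto simp: cl_monomial_def)
  then show "subst_ext n \<beta> (cl_monomial {}) vs = unit_form vs" by (simp add: wedge_monomial_def)
qed

lemma wedge_one_form_sum:
  "wedge (one_form (\<lambda>v. \<Sum>i\<in>S. c i * \<beta> i v)) b vs = (\<Sum>i\<in>S. c i * wedge (one_form (\<beta> i)) b vs)"
proof -
  have "one_form (\<lambda>v. \<Sum>i\<in>S. c i * \<beta> i v) = (\<lambda>vs. \<Sum>i\<in>S. c i * one_form (\<beta> i) vs)"
    by (rule ext) (simp add: one_form_def split: list.split)
  then show ?thesis by (simp only: wedge_sum_left wedge_scale_left)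
qed


section \<open>Functionals on the Clifford algebra and the scalar part\<close>

lemma cl_sum_monomials:
  assumes "z \<in> cl_carrier n"
  shows "z = (\<lambda>K. \<Sum>I\<in>Pow {..<n}. z I * cl_monomial I K)"
proof (rule ext)
  fix K
  have "(\<Sum>I\<in>Pow {..<n}. z I * cl_monomial I K) = (\<Sum>I\<in>Pow {..<n}. if I = K then z K else 0)"
    by (rule sum.cong) (auto simp: cl_monomial_def)
  then show "z K = (\<Sum>I\<in>Pow {..<n}. z I * cl_monomial I K)"
    using cl_carrierD[OF assms, of K] by auto
qed

text \<open>A linear functional encoded by its values w on the monomials, so that linearity holds by
  construction.\<close>

definition coeff_functional :: "nat \<Rightarrow> (nat set \<Rightarrow> real) \<Rightarrow> clifford \<Rightarrow> real" where
  "coeff_functional n w u = (\<Sum>I\<in>Pow {..<n}. u I * w I)"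

lemma coeff_functional_sum:
  "coeff_functional n w (\<lambda>K. \<Sum>i\<in>S. c i * x i K) = (\<Sum>i\<in>S. c i * coeff_functional n w (x i))"
  unfolding coeff_functional_def by (simp add: sum_distrib_left sum_distrib_right mult_ac sum.swap[of _ S])

lemma coeff_functional_add:
  "coeff_functional n w (\<lambda>K. x K + y K) = coeff_functional n w x + coeff_functional n w y"
  unfolding coeff_functional_def by (simp add: distrib_right sum.distrib)

lemma coeff_functional_scale:
  "coeff_functional n w (\<lambda>K. r * x K) = r * coeff_functional n w x"
  unfolding coeff_functional_def by (simp add: sum_distrib_left mult_ac)

text \<open>An invertible element intertwining the twisted right action of \<open>x\<^sub>i\<close> with the left action of
  column \<open>i\<close> of an orthogonal matrix \<open>a\<close>.\<close>

locale pin_element =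
  fixes n :: nat and \<tau> \<tau>' :: clifford and a :: "nat \<Rightarrow> nat \<Rightarrow> real"
  assumes closed: "\<tau> \<in> cl_carrier n" "\<tau>' \<in> cl_carrier n"
    and inverse: "cl_mult n \<tau> \<tau>' = cl_monomial {}" "cl_mult n \<tau>' \<tau> = cl_monomial {}"
    and twist: "\<And>i. i < n \<Longrightarrow>
      cl_mult n (cl_parity \<tau>) (cl_monomial {i}) = cl_mult n (cl_coord_vec n (\<lambda>j. a j i)) \<tau>"
begin

text \<open>A functional vanishing on all \<open>(A \<xi>) x + \<alpha>(x) \<xi>\<close> vanishes, after right translation by \<open>\<tau>\<close>, on all
  \<open>\<eta> y + \<alpha>(y) \<eta> = 2 \<eta> \<and> y\<close>, so it sees only the scalar part of \<open>y\<close>.\<close>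

lemma functional_eq_scalar_part:
  assumes orth: "\<And>j k. j < n \<Longrightarrow> k < n \<Longrightarrow> (\<Sum>i<n. a j i * a k i) = (if j = k then 1 else 0)"
    and ann: "\<And>i x. i < n \<Longrightarrow> x \<in> cl_carrier n \<Longrightarrow>
      coeff_functional n w (cl_mult n (cl_coord_vec n (\<lambda>j. a j i)) x)
      + coeff_functional n w (cl_mult n (cl_parity x) (cl_monomial {i})) = 0"
    and x: "x \<in> cl_carrier n"
  shows "coeff_functional n w x = coeff_functional n w \<tau> * cl_mult n x \<tau>' {}"
proof -
  let ?F = "coeff_functional n w"
  \<comment> \<open>The rows of a are orthonormal, so each generator is recovered from the columns
    \<open>A e\<^sub>i\<close>, for which the hypothesis is available.\<close>
  have rows: "(\<lambda>K. \<Sum>i<n. a j i * cl_coord_vec n (\<lambda>k. a k i) K) = cl_monomial {j}" if j: "j < n" for j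
  proof (rule ext)
    fix K
    have "(\<Sum>i<n. a j i * cl_coord_vec n (\<lambda>k. a k i) K) = (\<Sum>k<n. (\<Sum>i<n. a j i * a k i) * cl_monomial {k} K)"
      unfolding cl_coord_vec_def sum_distrib_left sum_distrib_right
      by (subst sum.swap) (simp add: mult_ac)
    also have "\<dots> = (\<Sum>k<n. if k = j then cl_monomial {j} K else 0)"
      by (rule sum.cong) (auto simp: orth[OF j])
    finally show "(\<Sum>i<n. a j i * cl_coord_vec n (\<lambda>k. a k i) K) = cl_monomial {j} K" using j by simp
  qed
  have ext: "?F (cl_mult n (ext_mult j y) \<tau>) = 0" if j: "j < n" and y: "y \<in> cl_carrier n" for j y
  proof -
    let ?v = "\<lambda>i. cl_coord_vec n (\<lambda>k. a k i)"
    have 1: "?F (cl_mult n (?v i) (cl_mult n y \<tau>)) + ?F (cl_mult n (cl_parity y) (cl_mult n (?v i) \<tau>)) = 0" if "i < n" for i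
      using ann[OF that, of "cl_mult n y \<tau>"] by (simp add: cl_parity_mult cl_mult_assoc twist[OF that])
    have "cl_mult n (cl_monomial {j}) (cl_mult n y \<tau>) = (\<lambda>K. \<Sum>i<n. a j i * cl_mult n (?v i) (cl_mult n y \<tau>) K)"
      unfolding rows[OF j, symmetric] cl_mult_sum_left cl_mult_scale_left ..
    moreover have "cl_mult n (cl_parity y) (cl_mult n (cl_monomial {j}) \<tau>)
       = (\<lambda>K. \<Sum>i<n. a j i * cl_mult n (cl_parity y) (cl_mult n (?v i) \<tau>) K)"
      unfolding rows[OF j, symmetric] cl_mult_sum_left cl_mult_scale_left cl_mult_sum_right cl_mult_scale_right ..
    ultimately have "?F (cl_mult n (cl_monomial {j}) (cl_mult n y \<tau>)) + ?F (cl_mult n (cl_parity y) (cl_mult n (cl_monomial {j}) \<tau>))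
       = (\<Sum>i<n. a j i * (?F (cl_mult n (?v i) (cl_mult n y \<tau>)) + ?F (cl_mult n (cl_parity y) (cl_mult n (?v i) \<tau>))))"
      by (simp add: coeff_functional_sum distrib_left sum.distrib)
    also have "\<dots> = 0" using 1 by simp
    finally have "?F (cl_mult n (\<lambda>K. cl_mult n (cl_monomial {j}) y K + cl_mult n (cl_parity y) (cl_monomial {j}) K) \<tau>) = 0"
      by (simp add: cl_mult_add_left coeff_functional_add cl_mult_assoc)
    also have "(\<lambda>K. cl_mult n (cl_monomial {j}) y K + cl_mult n (cl_parity y) (cl_monomial {j}) K) = (\<lambda>K. 2 * ext_mult j y K)"
      by (simp add: cl_mult_generator_left[OF j y] cl_mult_generator_right[OF j y])
    finally show ?thesis by (simp add: cl_mult_scale_left coeff_functional_scale)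
  qed
  have mono: "?F (cl_mult n (cl_monomial I) \<tau>) = (if I = {} then ?F \<tau> else 0)" if I: "I \<subseteq> {..<n}" for I
  proof (cases "I = {}")
    case True
    then show ?thesis using closed by simp
  next
    case False
    then obtain j where j: "j \<in> I" by auto
    \<comment> \<open>A monomial of positive degree is, up to sign, an exterior product with a
      generator, so its right translate by \<tau> is annihilated.\<close>
    have "ext_mult j (cl_monomial (I - {j})) = (\<lambda>K. pos_sign j I * cl_monomial I K)"
      using j by (auto simp: ext_mult_def cl_monomial_def fun_eq_iff)
    moreover have "?F (cl_mult n (ext_mult j (cl_monomial (I - {j}))) \<tau>) = 0"
      using j I by (intro ext cl_monomial_closed) auto
    moreover have "pos_sign j I \<noteq> 0" by (simp add: pos_sign_def)
    ultimately show ?thesis using False by (simp add: cl_mult_scale_left coeff_functional_scale)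
  qed
  let ?z = "cl_mult n x \<tau>'"
  have "?F x = ?F (cl_mult n ?z \<tau>)" using x by (simp add: cl_mult_assoc inverse)
  also have "cl_mult n ?z \<tau> = (\<lambda>K. \<Sum>I\<in>Pow {..<n}. ?z I * cl_mult n (cl_monomial I) \<tau> K)"
    by (subst cl_sum_monomials[OF cl_mult_closed]) (simp only: cl_mult_sum_left cl_mult_scale_left)
  also have "?F \<dots> = (\<Sum>I\<in>Pow {..<n}. ?z I * ?F (cl_mult n (cl_monomial I) \<tau>))"
    by (rule coeff_functional_sum)
  also have "\<dots> = (\<Sum>I\<in>Pow {..<n}. if I = {} then ?z {} * ?F \<tau> else 0)"
    by (rule sum.cong) (auto simp: mono)
  finally show ?thesis by simp
qed

text \<open>The matrix of (1 + A) / 2, with j the row and i the column.\<close>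

definition half_id_plus :: "nat \<Rightarrow> nat \<Rightarrow> real" where
  "half_id_plus j i = ((if i = j then 1 else 0) + a j i) / 2"

text \<open>The element Y for which wedging \<tau> with the listed generators gives the Clifford
  product Y \<tau>. Each step averages a left multiplication by the generator and a twisted right
  multiplication by its image under A.\<close>

fun cayley_product :: "nat list \<Rightarrow> clifford" where
  "cayley_product [] = cl_monomial {}"
| "cayley_product (i # is) = (\<lambda>K. (cl_mult n (cl_monomial {i}) (cayley_product is) K
     + cl_mult n (cl_parity (cayley_product is)) (cl_coord_vec n (\<lambda>j. a j i)) K) / 2)"

text \<open>The wedge of the columns of (1 + A) / 2, which is the part of
  \<open>cayley_product\<close> of highest possible degree.\<close>

fun leading_product :: "nat list \<Rightarrow> clifford" where
  "leading_product [] = cl_monomial {}"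
| "leading_product (i # is) = (\<lambda>K. \<Sum>j<n. half_id_plus j i * ext_mult j (leading_product is) K)"

lemma cayley_product_closed: "cayley_product is \<in> cl_carrier n"
proof (cases "is")
  case Nil
  then show ?thesis by (simp add: cl_monomial_closed)
next
  case (Cons i js)
  then show ?thesis by (auto simp: cl_carrier_def) (metis cl_mult_outside add_0 lessThan_iff subset_iff)
qed

text \<open>Exterior multiplication by \<open>x\<^sub>i\<close> is the average of its left and twisted right multiplications, and
  on multiples of \<open>\<tau>\<close> the latter is a left multiplication again.\<close>

lemma ext_mult_cayley_product:
  assumes "set is \<subseteq> {..<n}"
  shows "foldr ext_mult is \<tau> = cl_mult n (cayley_product is) \<tau>"
  using assms
proof (induction "is")
  case Nil
  then show ?case using closed by simp
next
  case (Cons i "is")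
  then have i: "i < n" by simp
  let ?Y = "cayley_product is"
  have "foldr ext_mult (i # is) \<tau> = ext_mult i (cl_mult n ?Y \<tau>)" using Cons by simp
  also have "\<dots> = (\<lambda>K. (cl_mult n (cl_monomial {i}) (cl_mult n ?Y \<tau>) K
     + cl_mult n (cl_parity (cl_mult n ?Y \<tau>)) (cl_monomial {i}) K) / 2)"
    by (simp add: cl_mult_generator_left[OF i cl_mult_closed] cl_mult_generator_right[OF i cl_mult_closed])
  also have "cl_mult n (cl_parity (cl_mult n ?Y \<tau>)) (cl_monomial {i}) = cl_mult n (cl_mult n (cl_parity ?Y) (cl_coord_vec n (\<lambda>j. a j i))) \<tau>"
    by (simp add: cl_parity_mult cl_mult_assoc twist[OF i])
  also have "(\<lambda>K. (cl_mult n (cl_monomial {i}) (cl_mult n ?Y \<tau>) K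
     + cl_mult n (cl_mult n (cl_parity ?Y) (cl_coord_vec n (\<lambda>j. a j i))) \<tau> K) / 2) = cl_mult n (cayley_product (i # is)) \<tau>"
    using cl_mult_scale_left[of n "1/2"] by (simp add: cl_mult_add_left cl_mult_assoc)
  finally show ?case .
qed

text \<open>Each step raises the degree by at most one, and only through exterior parts: half of the
  generator from the left and half of its image under A from the right. Together they are a column
  of (1 + A) / 2.\<close>

lemma cayley_product_degree:
  assumes "finite K" "length is \<le> card K" "set is \<subseteq> {..<n}"
  shows "cayley_product is K = (if card K = length is then leading_product is K else 0)"
  using assms
proof (induction "is" arbitrary: K)
  case Nil
  then show ?case by (auto simp: cl_monomial_def)
next
  case (Cons i "is")
  let ?Y = "cayley_product is"
  have i: "i < n" using Cons by simp
  \<comment> \<open>Enlarging K by j gives a set with more elements than the remaining list has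
    entries, where the coefficient is zero by induction.\<close>
  have int: "int_mult j ?Y K = 0" for j
  proof (cases "j \<in> K")
    case False
    then show ?thesis using Cons.IH[of "insert j K"] Cons.prems by (simp add: int_mult_def)
  qed (simp add: int_mult_def)
  have ext: "ext_mult j ?Y K = (if card K = length (i # is) then ext_mult j (leading_product is) K else 0)" for j
  proof (cases "j \<in> K")
    case True
    then show ?thesis using Cons.IH[of "K - {j}"] Cons.prems by (auto simp: ext_mult_def)
  qed (simp add: ext_mult_def)
  have "cayley_product (i # is) K = (ext_mult i ?Y K + (\<Sum>j<n. a j i * ext_mult j ?Y K)) / 2"
    by (simp add: cl_mult_generator_left[OF i cayley_product_closed] cl_mult_coord_vec_right[OF cayley_product_closed] int)
  also have "\<dots> = (\<Sum>j<n. half_id_plus j i * ext_mult j ?Y K)"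
  proof -
    have "(\<Sum>j<n. half_id_plus j i * ext_mult j ?Y K) = (\<Sum>j<n. ((if j = i then ext_mult i ?Y K else 0) + a j i * ext_mult j ?Y K) / 2)"
      by (rule sum.cong) (auto simp: half_id_plus_def algebra_simps)
    also have "\<dots> = (ext_mult i ?Y K + (\<Sum>j<n. a j i * ext_mult j ?Y K)) / 2"
      using i by (simp add: sum.distrib flip: sum_divide_distrib)
    finally show ?thesis by simp
  qed
  finally show ?case unfolding ext by simp
qed

text \<open>The generators are replaced by Kronecker functions on indices. The value of the
  resulting form on the list of all indices is the top coefficient, and the determinant formula for
  wedges of one-forms applies.\<close>

lemma leading_product_det:
  "leading_product [0..<n] {..<n} = Determinant.det (mat n n (\<lambda>(r, c). half_id_plus c r))"
proof -
  define \<beta> where "\<beta> = (\<lambda>j k :: nat. if j = k then 1 else 0 :: real)"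
  have p: "subst_ext n \<beta> (leading_product is) = wedge_list (map (\<lambda>i. one_form (\<lambda>k. \<Sum>j<n. half_id_plus j i * \<beta> j k)) is)" for "is"
  proof (induction "is")
    case (Cons i "is")
    have "subst_ext n \<beta> (leading_product (i # is)) vs = (\<Sum>j<n. half_id_plus j i * subst_ext n \<beta> (ext_mult j (leading_product is)) vs)" for vs
      by (simp add: subst_ext_sum)
    also have "\<dots> vs = wedge (one_form (\<lambda>k. \<Sum>j<n. half_id_plus j i * \<beta> j k)) (subst_ext n \<beta> (leading_product is)) vs" for vs
      unfolding wedge_one_form_sum by (rule sum.cong) (simp_all add: subst_ext_ext_mult)
    finally have "subst_ext n \<beta> (leading_product (i # is)) = wedge (one_form (\<lambda>k. \<Sum>j<n. half_id_plus j i * \<beta> j k)) (subst_ext n \<beta> (leading_product is))"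
      by (rule ext)
    then show ?case unfolding Cons.IH list.map wedge_list_Cons .
  qed (simp add: subst_ext_one)
  have "subst_ext n \<beta> (leading_product [0..<n]) [0..<n]
    = wedge_list (map one_form (map (\<lambda>i k. \<Sum>j<n. half_id_plus j i * \<beta> j k) [0..<n])) [0..<n]"
    unfolding p by (simp add: o_def)
  also have "\<dots> = Determinant.det (mat n n (\<lambda>(r, c). (map (\<lambda>i k. \<Sum>j<n. half_id_plus j i * \<beta> j k) [0..<n] ! r) ([0..<n] ! c)))"
    by (rule wedge_list_one_forms_det) simp_all
  also have "mat n n (\<lambda>(r, c). (map (\<lambda>i k. \<Sum>j<n. half_id_plus j i * \<beta> j k) [0..<n] ! r) ([0..<n] ! c)) = mat n n (\<lambda>(r, c). half_id_plus c r)"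
    by (rule eq_matI) (auto simp: \<beta>_def if_distrib[of "(*) _"] cong: if_cong)
  finally have "subst_ext n \<beta> (leading_product [0..<n]) [0..<n] = Determinant.det (mat n n (\<lambda>(r, c). half_id_plus c r))" .
  moreover have "subst_ext n \<beta> z [0..<n] = z {..<n}" for z
  proof -
    have "wedge_monomial \<beta> I [0..<n] = (if I = {..<n} then 1 else 0)" if "I \<in> Pow {..<n}" for I
    proof (cases "I = {..<n}")
      case True
      have "wedge_monomial \<beta> {..<n} [0..<n] = wedge_list (map one_form (map \<beta> [0..<n])) [0..<n]"
        using wedge_monomial_set[of "[0..<n]" \<beta>] by (simp add: atLeast0LessThan o_def)
      also have "\<dots> = Determinant.det (mat n n (\<lambda>(r, c). (map \<beta> [0..<n] ! r) ([0..<n] ! c)))"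
        by (rule wedge_list_one_forms_det) simp_all
      also have "mat n n (\<lambda>(r, c). (map \<beta> [0..<n] ! r) ([0..<n] ! c)) = 1\<^sub>m n"
        by (rule eq_matI) (auto simp: \<beta>_def)
      finally show ?thesis using True by simp
    next
      case False
      then have "card I \<noteq> n" using that by (metis Pow_iff card_lessThan card_subset_eq finite_lessThan)
      then have "wedge_list (map one_form (map \<beta> (sorted_list_of_set I))) [0..<n] = 0"
        by (intro wedge_list_one_forms_degree) simp
      then show ?thesis using False by (simp add: wedge_monomial_def o_def)
    qed
    then have "subst_ext n \<beta> z [0..<n] = (\<Sum>I\<in>Pow {..<n}. if I = {..<n} then z {..<n} else 0)"
      unfolding subst_ext_def by (intro sum.cong) auto
    then show ?thesis by simp
  qed
  ultimately show ?thesis by simp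
qed

lemma foldr_ext_mult_support: "foldr ext_mult is x K \<noteq> 0 \<Longrightarrow> set is \<subseteq> K"
proof (induction "is" arbitrary: K)
  case (Cons i "is")
  then have "i \<in> K" "foldr ext_mult is x (K - {i}) \<noteq> 0"
    by (simp_all add: ext_mult_def[of i "foldr ext_mult is x"] split: if_splits)
  then show ?case using Cons.IH by auto
qed simp

lemma foldr_ext_mult_upt: "m \<le> n \<Longrightarrow> foldr ext_mult [m..<n] x {m..<n} = x {}"
proof (induction m rule: inc_induct)
  case (step m)
  have "{m..<n} - {m} = {Suc m..<n}" using step by auto
  moreover have "pos_sign m {m..<n} = 1" by (rule pos_sign_eq_1) simp
  ultimately show ?case using step by (simp add: upt_conv_Cons ext_mult_def)
qed simp

text \<open>Wedging \<tau> with all generators keeps only its scalar part, times the volume element.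
  Right multiplication by \<tau>' turns this into \<open>cayley_product\<close>, and the two
  descriptions are compared in their top coefficient.\<close>

theorem scalar_part_mult_inverse:
  "\<tau> {} * \<tau>' {} = Determinant.det (mat n n (\<lambda>(r, c). half_id_plus c r))"
proof -
  let ?X = "foldr ext_mult [0..<n] \<tau>" and ?U = "{..<n}"
  have X: "?X = cl_mult n (cayley_product [0..<n]) \<tau>" by (rule ext_mult_cayley_product) auto
  have "?X K = (\<tau> {} * cl_monomial ?U K)" for K
  proof (cases "K = ?U")
    case True
    then show ?thesis using foldr_ext_mult_upt[of 0 \<tau>] by (simp add: cl_monomial_def atLeast0LessThan)
  next
    case False
    then have "?X K = 0"
      using foldr_ext_mult_support[of "[0..<n]" \<tau> K] cl_carrierD[of ?X n K] unfolding X by (auto simp: atLeast0LessThan)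
    then show ?thesis using False by (simp add: cl_monomial_def)
  qed
  then have X': "?X = (\<lambda>K. \<tau> {} * cl_monomial ?U K)" by blast
  have "cayley_product [0..<n] = cl_mult n ?X \<tau>'"
    unfolding X using cayley_product_closed by (simp add: cl_mult_assoc inverse)
  then have "cayley_product [0..<n] ?U = \<tau> {} * cl_mult n (cl_monomial ?U) \<tau>' ?U"
    unfolding X' by (simp add: cl_mult_scale_left)
  \<comment> \<open>The top coefficient of a product with the volume element sees only the scalar
    part of the other factor, because \<open>symdiff ?U ?U\<close> is empty.\<close>
  also have "cl_mult n (cl_monomial ?U) \<tau>' ?U = (\<Sum>I\<in>Pow ?U. if I = ?U then \<tau>' {} else 0)"
    unfolding cl_mult_eq[OF order_refl] by (rule sum.cong) (auto simp: cl_monomial_def)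
  finally have "cayley_product [0..<n] ?U = \<tau> {} * \<tau>' {}" by simp
  then show ?thesis
    using cayley_product_degree[of ?U "[0..<n]"] leading_product_det by (simp add: atLeast0LessThan)
qed

end

text \<open>Induction over the generators: a vector with \<xi> \<cdot> \<xi> = 2 squares to 1, so it
  is its own inverse, and it is self-adjoint. Taking inverses and taking adjoints both reverse
  products.\<close>

lemma pin_group_adjoint:
  assumes "x \<in> carrier (pin_group ip es)"
  defines "n \<equiv> length es"
  assumes onb: "\<And>\<xi>. ip \<xi> \<xi> = (\<Sum>i<length es. ip \<xi> (es ! i) * ip \<xi> (es ! i))"
  shows "x \<in> Group.Units (clifford_monoid n) \<and>
    (\<forall>y\<in>cl_carrier n. \<forall>z\<in>cl_carrier n. cl_inner n (cl_mult n x y) z = cl_inner n y (cl_mult n (inv\<^bsub>clifford_monoid n\<^esub> x) z))"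
proof -
  interpret C: Group.monoid "clifford_monoid n" by (rule monoid_clifford)
  let ?C = "clifford_monoid n" and ?H = "{cl_vec ip es \<xi> |\<xi>. ip \<xi> \<xi> = 2}"
  interpret U: Group.group "units_of ?C" by (rule C.units_group)
  have gen: "x \<in> generate (units_of ?C) ?H"
    using assms(1) by (simp add: pin_group_def Let_def n_def)
  have H: "h \<in> Group.Units ?C" "inv\<^bsub>?C\<^esub> h = h" if h: "h \<in> ?H" for h
  proof -
    obtain \<xi> where \<xi>: "h = cl_vec ip es \<xi>" "ip \<xi> \<xi> = 2" using h by blast
    define c where "c = (\<lambda>i. ip \<xi> (es ! i))"
    have hc: "h = cl_coord_vec n c" using \<xi> by (simp add: cl_vec_eq c_def n_def)
    have sq: "cl_mult n h h = cl_monomial {}"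
    proof (rule ext)
      fix K
      have "cl_mult n h h K = (\<Sum>i<n. \<Sum>j<n. c i * c j * cl_mult n (cl_monomial {i}) (cl_monomial {j}) K)"
        unfolding hc cl_coord_vec_def cl_mult_sum_left cl_mult_scale_left cl_mult_sum_right cl_mult_scale_right
        by (simp add: sum_distrib_left mult_ac)
      \<comment> \<open>Symmetrising the double sum produces anticommutators, to which the Clifford
        relations apply.\<close>
      then have "2 * cl_mult n h h K = (\<Sum>i<n. \<Sum>j<n. c i * c j * cl_mult n (cl_monomial {i}) (cl_monomial {j}) K)
         + (\<Sum>j<n. \<Sum>i<n. c i * c j * cl_mult n (cl_monomial {i}) (cl_monomial {j}) K)"
        by (subst (2) sum.swap) simp
      also have "\<dots> = (\<Sum>i<n. \<Sum>j<n. c i * c j * (cl_mult n (cl_monomial {i}) (cl_monomial {j}) K + cl_mult n (cl_monomial {j}) (cl_monomial {i}) K))"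
        by (simp add: sum.distrib distrib_left mult_ac)
      also have "\<dots> = (\<Sum>i<n. \<Sum>j<n. if j = i then c i * c i * cl_monomial {} K else 0)"
        by (intro sum.cong refl) (simp add: clifford_relations)
      also have "\<dots> = (\<Sum>i<n. c i * c i) * cl_monomial {} K" by (simp add: sum_distrib_right)
      also have "(\<Sum>i<n. c i * c i) = 2" using onb[of \<xi>] \<xi> by (simp add: c_def n_def)
      finally show "cl_mult n h h K = cl_monomial {} K" by simp
    qed
    then show "h \<in> Group.Units ?C" unfolding Group.Units_def using hc by auto
    show "inv\<^bsub>?C\<^esub> h = h" by (rule C.inv_unique'[symmetric]) (use sq hc in auto)
  qed
  show ?thesis
    using gen
  proof (induction rule: generate.induct)
    case one
    have "inv\<^bsub>?C\<^esub> (cl_monomial {}) = cl_monomial {}" using C.inv_one by simp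
    then show ?case using C.Units_one_closed by (simp add: units_of_one)
  next
    case (incl h)
    then obtain c where "h = cl_coord_vec n c" by (auto simp: cl_vec_eq n_def)
    then show ?case using H[OF incl] by (auto simp: cl_inner_coord_vec)
  next
    case (inv h)
    then obtain c where "h = cl_coord_vec n c" by (auto simp: cl_vec_eq n_def)
    then show ?case using H[OF inv] C.units_of_inv[of h] by (auto simp: cl_inner_coord_vec)
  next
    case (eng h1 h2)
    let ?i = "\<lambda>x. inv\<^bsub>?C\<^esub> x"
    have u: "h1 \<in> Group.Units ?C" "h2 \<in> Group.Units ?C" using eng by auto
    then have c: "h1 \<in> cl_carrier n" "h2 \<in> cl_carrier n" "?i h1 \<in> cl_carrier n" "?i h2 \<in> cl_carrier n"
      using C.Units_closed C.Units_inv_closed by auto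
    have "?i (cl_mult n h1 h2) = cl_mult n (?i h2) (?i h1)"
    proof (rule C.inv_unique'[symmetric])
      have r: "cl_mult n h1 (?i h1) = cl_monomial {}" "cl_mult n h2 (?i h2) = cl_monomial {}"
        "cl_mult n (?i h1) h1 = cl_monomial {}" "cl_mult n (?i h2) h2 = cl_monomial {}"
        using C.Units_r_inv[OF u(1)] C.Units_r_inv[OF u(2)] C.Units_l_inv[OF u(1)] C.Units_l_inv[OF u(2)] by simp_all
      have "cl_mult n h2 (cl_mult n (?i h2) (?i h1)) = ?i h1" "cl_mult n (?i h1) (cl_mult n h1 h2) = h2"
        using c by (simp_all add: r flip: cl_mult_assoc)
      then show "cl_mult n h1 h2 \<otimes>\<^bsub>?C\<^esub> cl_mult n (?i h2) (?i h1) = \<one>\<^bsub>?C\<^esub>"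
        "cl_mult n (?i h2) (?i h1) \<otimes>\<^bsub>?C\<^esub> cl_mult n h1 h2 = \<one>\<^bsub>?C\<^esub>"
        by (simp_all add: cl_mult_assoc r)
    qed simp_all
    moreover have "cl_mult n h1 h2 \<in> Group.Units ?C" using C.Units_m_closed[OF u] by simp
    ultimately show ?case using eng c by (simp add: units_of_mult cl_mult_assoc)
  qed
qed

text \<open>The adjoint relation evaluated on the unit: the scalar part is the inner product with
  1.\<close>

lemma pin_group_scalar_part_inv:
  assumes "x \<in> carrier (pin_group ip es)"
  defines "n \<equiv> length es"
  assumes onb: "\<And>\<xi>. ip \<xi> \<xi> = (\<Sum>i<length es. ip \<xi> (es ! i) * ip \<xi> (es ! i))"
  shows "(inv\<^bsub>clifford_monoid n\<^esub> x) {} = x {}"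
proof -
  interpret C: Group.monoid "clifford_monoid n" by (rule monoid_clifford)
  have u: "x \<in> Group.Units (clifford_monoid n)"
    and adj: "\<And>y z. y \<in> cl_carrier n \<Longrightarrow> z \<in> cl_carrier n \<Longrightarrow>
      cl_inner n (cl_mult n x y) z = cl_inner n y (cl_mult n (inv\<^bsub>clifford_monoid n\<^esub> x) z)"
    using pin_group_adjoint[OF assms(1) onb] by (auto simp: n_def)
  have c: "x \<in> cl_carrier n" "inv\<^bsub>clifford_monoid n\<^esub> x \<in> cl_carrier n"
    using C.Units_closed[OF u] C.Units_inv_closed[OF u] by auto
  have "cl_monomial {} \<in> cl_carrier n" by (simp add: cl_monomial_closed)
  from adj[OF this this] show ?thesis
    using c by (simp add: cl_inner_one_right cl_inner_commute[of n "cl_monomial {}"])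
qed

text \<open>Only sublists of vs reach the second factor. This matters for \<open>exp_form\<close>,
  whose number of terms depends on the length of its argument.\<close>

lemma wedge_cong_right:
  assumes "\<And>us. length us \<le> length vs \<Longrightarrow> b us = b' us"
  shows "wedge a b vs = wedge a b' vs"
proof -
  have "length (nths vs S) \<le> length vs" for S
    by (simp add: length_nths) (metis (no_types, lifting) card_mono card_lessThan finite_lessThan lessThan_iff mem_Collect_eq subsetI)
  then show ?thesis unfolding wedge_def by (intro sum.cong refl) (simp add: assms)
qed

lemma wedge_top_degree:
  assumes "\<And>us. length us \<noteq> length vs \<Longrightarrow> b us = 0"
  shows "wedge a b vs = a [] * b vs"
  using assms
proof (induction vs arbitrary: a b)
  case (Cons v vs)
  have "wedge (contract v a) b vs = wedge (contract v a) (\<lambda>vs. 0) vs"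
    by (rule wedge_cong_right) (use Cons.prems in auto)
  moreover have "wedge (grade_inv a) (contract v b) vs = grade_inv a [] * contract v b vs"
    by (rule Cons.IH) (use Cons.prems in \<open>auto simp: contract_def\<close>)
  ultimately show ?case by (simp add: wedge_Cons grade_inv_def contract_def)
qed simp

lemma grade_inv_wedge_list_one_forms:
  "grade_inv (wedge_list (map one_form fs)) = (\<lambda>vs. (- 1) ^ length fs * wedge_list (map one_form fs) vs)"
proof (rule ext)
  fix vs
  show "grade_inv (wedge_list (map one_form fs)) vs = (- 1) ^ length fs * wedge_list (map one_form fs) vs"
    by (cases "length vs = length fs") (simp_all add: grade_inv_def wedge_list_one_forms_degree)
qed

subsection \<open>The exponential of a two-form\<close>

lemma wedge_power_degree:
  assumes "\<And>us. length us \<noteq> 2 \<Longrightarrow> a us = 0"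
  shows "length vs \<noteq> 2 * k \<Longrightarrow> (wedge a ^^ k) unit_form vs = 0"
proof (induction k arbitrary: vs)
  case 0
  then show ?case by (simp add: unit_form_def)
next
  case (Suc k)
  have "a (nths vs S) * (wedge a ^^ k) unit_form (nths vs ({..<length vs} - S)) = 0" if "S \<subseteq> {..<length vs}" for S
  proof (cases "card S = 2")
    case True
    have "length (nths vs ({..<length vs} - S)) = card ({..<length vs} - S)"
      unfolding length_nths by (rule arg_cong[of _ _ card]) auto
    also have "\<dots> = length vs - 2" using that True by (simp add: card_Diff_subset finite_subset)
    finally have "length (nths vs ({..<length vs} - S)) \<noteq> 2 * k"
      using Suc.prems card_mono[OF _ that] True by auto
    then show ?thesis using Suc.IH by simp
  next
    case False
    have "length (nths vs S) = card S"
      unfolding length_nths using that by (intro arg_cong[of _ _ card]) auto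
    then show ?thesis using False assms by simp
  qed
  then have "wedge a ((wedge a ^^ k) unit_form) vs = 0"
    unfolding wedge_def[of a "(wedge a ^^ k) unit_form"] mult.assoc by (intro sum.neutral ballI) simp
  then show ?case by simp
qed

context
  fixes a :: "'v mform"
  assumes deg: "\<And>us. length us \<noteq> 2 \<Longrightarrow> a us = 0"
begin

lemma grade_inv_two_form: "grade_inv a = a"
proof (rule ext)
  show "grade_inv a vs = a vs" for vs
    by (cases "length vs = 2") (simp_all add: grade_inv_def deg)
qed

lemma grade_inv_exp_form: "grade_inv (exp_form a) = exp_form a"
proof (rule ext)
  fix vs
  show "grade_inv (exp_form a) vs = exp_form a vs"
  proof (cases "even (length vs)")
    case False
    then have "length vs \<noteq> 2 * k" for k by auto
    then have "exp_form a vs = 0" by (simp add: exp_form_def wedge_power_degree[OF deg])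
    then show ?thesis by (simp add: grade_inv_def)
  qed (simp add: grade_inv_def)
qed

lemma contract_two_form: "contract v a = one_form (\<lambda>u. a [v, u])"
proof (rule ext)
  show "contract v a vs = one_form (\<lambda>u. a [v, u]) vs" for vs
    by (cases "length vs = 1") (auto simp: contract_def one_form_def length_Suc_conv deg split: list.split)
qed

text \<open>A two-form is even and commutes with everything, so contraction acts on its powers like
  an ordinary derivative.\<close>

lemma contract_wedge_power:
  "contract v ((wedge a ^^ Suc k) unit_form) = (\<lambda>vs. real (Suc k) * wedge (one_form (\<lambda>u. a [v, u])) ((wedge a ^^ k) unit_form) vs)"
proof (induction k)
  case 0
  then show ?case by (simp add: contract_two_form)
next
  case (Suc k)
  let ?W = "(wedge a ^^ k) unit_form" and ?f = "one_form (\<lambda>u. a [v, u])"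
  have "contract v (wedge a ((wedge a ^^ Suc k) unit_form)) vs
    = wedge ?f ((wedge a ^^ Suc k) unit_form) vs + wedge a (contract v ((wedge a ^^ Suc k) unit_form)) vs" for vs
    by (simp add: contract_wedge contract_two_form grade_inv_two_form)
  also have "\<dots> vs = real (Suc (Suc k)) * wedge ?f ((wedge a ^^ Suc k) unit_form) vs" for vs
  proof -
    have "wedge a (wedge ?f ?W) = wedge ?f (wedge a ?W)"
      unfolding wedge_assoc[symmetric] wedge_graded_commute(1)[OF grade_inv_two_form, of ?f] ..
    then show ?thesis unfolding Suc wedge_scale_right by (simp add: algebra_simps)
  qed
  finally show ?case by (auto simp: fun_eq_iff)
qed

text \<open>Higher powers vanish for degree reasons, so the series may be cut off anywhere beyond
  the length. A common cut-off allows arguments of different lengths to be compared.\<close>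

lemma exp_form_eq: "length vs \<le> N \<Longrightarrow> exp_form a vs = (\<Sum>k\<le>N. (wedge a ^^ k) unit_form vs / fact k)"
  unfolding exp_form_def
  by (rule sum.mono_neutral_left) (auto simp: wedge_power_degree[OF deg])

lemma contract_exp_form: "contract v (exp_form a) = wedge (one_form (\<lambda>u. a [v, u])) (exp_form a)"
proof (rule ext)
  fix vs :: "'v list"
  let ?f = "one_form (\<lambda>u. a [v, u])" and ?N = "length vs"
  let ?W = "\<lambda>k. (wedge a ^^ k) unit_form"
  have "contract v (exp_form a) vs = (\<Sum>k\<le>Suc ?N. ?W k (v # vs) / fact k)"
    unfolding contract_def by (rule exp_form_eq) simp
  also have "\<dots> = (\<Sum>k\<le>?N. ?W (Suc k) (v # vs) / fact (Suc k))"
    unfolding sum.atMost_Suc_shift by (simp add: unit_form_def)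
  also have "\<dots> = (\<Sum>k\<le>?N. (1 / fact k) * wedge ?f (?W k) vs)"
  proof (rule sum.cong[OF refl])
    fix k
    have "?W (Suc k) (v # vs) = contract v (?W (Suc k)) vs" by (simp add: contract_def)
    also have "\<dots> = real (Suc k) * wedge ?f (?W k) vs" by (simp only: contract_wedge_power)
    finally show "?W (Suc k) (v # vs) / fact (Suc k) = (1 / fact k) * wedge ?f (?W k) vs"
      by (simp del: funpow.simps of_nat_Suc)
  qed
  also have "\<dots> = wedge ?f (\<lambda>us. \<Sum>k\<le>?N. (1 / fact k) * ?W k us) vs"
    unfolding wedge_sum_right wedge_scale_right ..
  also have "\<dots> = wedge ?f (exp_form a) vs"
    by (rule wedge_cong_right) (simp add: exp_form_eq)
  finally show "contract v (exp_form a) vs = wedge ?f (exp_form a) vs" .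
qed

lemma exp_form_Nil: "exp_form a [] = 1"
  by (simp add: exp_form_def unit_form_def)

end

text \<open>Each condition concerns argument lists of one fixed length, on which the exponential is
  a fixed finite sum of alternating forms.\<close>

lemma alternating_exp_form:
  fixes a :: "('v::real_vector) mform"
  assumes "alternating_form 2 a" shows "alternating (exp_form a)"
proof -
  have alt: "alternating ((wedge a ^^ k) unit_form)" for k
    by (induction k) (simp_all add: alternating_unit alternating_wedge alternating_form_imp_alternating[OF assms])
  have deg: "a us = 0" if "length us \<noteq> 2" for us using assms that by (simp add: alternating_form_def)
  have alt_sum: "alternating (\<lambda>vs. \<Sum>k\<le>N. (1 / fact k) * (wedge a ^^ k) unit_form vs)" for N
    by (intro alternating_sum alternating_scale alt)
  have eq: "exp_form a vs = (\<Sum>k\<le>N. (1 / fact k) * (wedge a ^^ k) unit_form vs)" if "length vs \<le> N" for vs N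
    using exp_form_eq[OF deg that] by simp
  have "exp_form a (us @ x # ws) = (\<Sum>k\<le>Suc (length us + length ws). (1 / fact k) * (wedge a ^^ k) unit_form (us @ x # ws))" for us x ws
    by (rule eq) simp
  moreover have "exp_form a (us @ x # x # ws) = (\<Sum>k\<le>Suc (Suc (length us + length ws)). (1 / fact k) * (wedge a ^^ k) unit_form (us @ x # x # ws))" for us x ws
    by (rule eq) simp
  ultimately show ?thesis
    using alt_sum unfolding alternating_def multilinear_def vanishes_adjacent_def by presburger
qed

subsection \<open>Orthonormal bases\<close>

locale onb =
  fixes ip :: "'v::real_vector \<Rightarrow> 'v \<Rightarrow> real" and es :: "'v list"
  assumes ip: "inner_product ip" and basis: "orthonormal_basis ip es"
begin

lemma ip_linear: "linear (ip x)" "linear (\<lambda>x. ip x y)"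
  using ip by (simp_all add: inner_product_def bilinear_def)

lemma ip_commute: "ip x y = ip y x"
  using ip by (simp add: inner_product_def)

lemma ip_eq_0: "ip x x = 0 \<Longrightarrow> x = 0"
  using ip by (force simp: inner_product_def)

lemma ip_nonneg: "0 \<le> ip x x"
  using ip linear_0[OF ip_linear(1), of x] by (cases "x = 0") (auto simp: inner_product_def less_imp_le)

lemma ip_es: "i < length es \<Longrightarrow> j < length es \<Longrightarrow> ip (es ! i) (es ! j) = (if i = j then 1 else 0)"
  using basis by (simp add: orthonormal_basis_def)

lemma ip_sum_left: "ip (\<Sum>i\<in>S. c i *\<^sub>R f i) y = (\<Sum>i\<in>S. c i * ip (f i) y)"
  by (simp add: linear_sum[OF ip_linear(2)] linear_scale[OF ip_linear(2)])

text \<open>The difference of the two sides is orthogonal to a spanning list, hence to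
  itself.\<close>

lemma expand: "(\<Sum>i<length es. ip x (es ! i) *\<^sub>R es ! i) = x"
proof -
  let ?y = "\<Sum>i<length es. ip x (es ! i) *\<^sub>R es ! i"
  have y: "ip (x - ?y) (es ! j) = 0" if "j < length es" for j
  proof -
    have "ip ?y (es ! j) = (\<Sum>i<length es. if i = j then ip x (es ! j) else 0)"
      unfolding ip_sum_left by (rule sum.cong) (use that in \<open>auto simp: ip_es\<close>)
    then show ?thesis using that linear_diff[OF ip_linear(2)] by simp
  qed
  have "ip (x - ?y) z = 0" for z
  proof (rule linear_eq_0_on_span[OF ip_linear(1)])
    show "ip (x - ?y) e = 0" if "e \<in> set es" for e using that y by (auto simp: in_set_conv_nth)
    show "z \<in> span (set es)" using basis by (simp add: orthonormal_basis_def)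
  qed
  then show ?thesis using ip_eq_0[of "x - ?y"] by simp
qed

lemma parseval: "ip x y = (\<Sum>i<length es. ip x (es ! i) * ip y (es ! i))"
proof -
  have "ip x y = ip (\<Sum>i<length es. ip x (es ! i) *\<^sub>R es ! i) y" by (simp add: expand)
  also have "\<dots> = (\<Sum>i<length es. ip x (es ! i) * ip (es ! i) y)" by (rule ip_sum_left)
  finally show ?thesis by (simp add: ip_commute[of _ y])
qed

end

subsection \<open>The linear algebra at a point\<close>

text \<open>The data of a Hamiltonian manifold at one point, with \<phi> for \<theta>^R after the
  derivative of \<Phi> and \<open>gen\<close> for the generating vectors. In the moment condition
  \<theta>^L has been eliminated through \<theta>^R = A \<theta>^L.\<close>

locale hamiltonian_point = onb ip es for ip :: "'v::real_vector \<Rightarrow> 'v \<Rightarrow> real" and es +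
  fixes \<omega> :: "('w::real_vector) mform" and \<phi> :: "'w \<Rightarrow> 'v" and A :: "'v \<Rightarrow> 'v" and gen :: "'v \<Rightarrow> 'w"
    and \<tau> :: clifford
  assumes finite_dim: "\<exists>B :: 'w set. finite B \<and> span B = UNIV"
    and \<omega>: "alternating_form 2 \<omega>"
    and \<phi>: "linear \<phi>"
    and A: "linear A" and A_isometry: "\<And>x y. ip (A x) (A y) = ip x y"
    and moment: "\<And>\<xi> v. \<omega> [gen \<xi>, v] = ip (\<phi> v) (A \<xi> + \<xi>) / 2"
    and \<phi>_gen: "\<And>\<xi>. \<phi> (gen \<xi>) = A \<xi> - \<xi>"
    and kernel: "form_kernel \<omega> = {gen \<xi> |\<xi>. A \<xi> + \<xi> = 0}"
    and \<tau>_pin: "\<tau> \<in> carrier (pin_group ip es)"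
    and \<tau>_lift: "\<And>\<xi>. Ad_tilde (length es) \<tau> (cl_vec ip es \<xi>) = cl_vec ip es (A \<xi>)"
begin

definition n where "n = length es"
definition a where "a j i = ip (es ! j) (A (es ! i))"
definition \<tau>' where "\<tau>' = inv\<^bsub>clifford_monoid n\<^esub> \<tau>"
definition \<beta> where "\<beta> i v = 1 / 2 * ip (\<phi> v) (es ! i)"

abbreviation "P \<equiv> subst_ext n \<beta>"
abbreviation "E \<equiv> exp_form \<omega>"

lemma \<omega>_degree: "length us \<noteq> 2 \<Longrightarrow> \<omega> us = 0"
  using \<omega> by (simp add: alternating_form_def)

lemma \<omega>_linear: "linear (\<lambda>x. \<omega> [x, y])" "linear (\<lambda>y. \<omega> [x, y])"
proof -
  have "multilinear \<omega>" using alternating_form_imp_alternating[OF \<omega>] by (simp add: alternating_def)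
  then have "linear (\<lambda>x. \<omega> ([] @ x # [y]))" "linear (\<lambda>y. \<omega> ([x] @ y # []))" unfolding multilinear_def by blast+
  then show "linear (\<lambda>x. \<omega> [x, y])" "linear (\<lambda>y. \<omega> [x, y])" by simp_all
qed

lemma \<omega>_swap: "\<omega> [x, y] = - \<omega> [y, x]"
  using alternating_swap[OF alternating_form_imp_alternating[OF \<omega>], of "[]" x y "[]"] by simp

lemma cl_vec_basis: "i < n \<Longrightarrow> cl_vec ip es (es ! i) = cl_monomial {i}"
proof (rule ext)
  fix I assume i: "i < n"
  have "cl_vec ip es (es ! i) I = (\<Sum>j<length es. if j = i then cl_monomial {i} I else 0)"
    unfolding cl_vec_def by (rule sum.cong) (use i in \<open>auto simp: ip_es n_def\<close>)
  then show "cl_vec ip es (es ! i) I = cl_monomial {i} I" using i by (simp add: n_def)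
qed

lemma \<tau>_unit: "\<tau> \<in> Group.Units (clifford_monoid n)"
  using pin_group_adjoint[OF \<tau>_pin parseval] unfolding n_def by blast

sublocale pin_element n \<tau> \<tau>' a
proof
  interpret C: Group.monoid "clifford_monoid n" by (rule monoid_clifford)
  show c: "\<tau> \<in> cl_carrier n" "\<tau>' \<in> cl_carrier n"
    using C.Units_closed[OF \<tau>_unit] C.Units_inv_closed[OF \<tau>_unit] by (auto simp: \<tau>'_def)
  show "cl_mult n \<tau> \<tau>' = cl_monomial {}" and l: "cl_mult n \<tau>' \<tau> = cl_monomial {}"
    using C.Units_r_inv[OF \<tau>_unit] C.Units_l_inv[OF \<tau>_unit] by (auto simp: \<tau>'_def)
  fix i assume i: "i < n"
  have "cl_mult n (cl_mult n (cl_parity \<tau>) (cl_monomial {i})) \<tau>' = cl_coord_vec n (\<lambda>j. a j i)"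
    using \<tau>_lift[of "es ! i"] cl_vec_basis[OF i]
    by (simp add: Ad_tilde_def n_def[symmetric] \<tau>'_def cl_vec_eq a_def ip_commute[of "A _"])
  \<comment> \<open>Right multiplication by \<tau> removes the inverse from the lift
    condition.\<close>
  then have "cl_mult n (cl_mult n (cl_mult n (cl_parity \<tau>) (cl_monomial {i})) \<tau>') \<tau> = cl_mult n (cl_coord_vec n (\<lambda>j. a j i)) \<tau>"
    by simp
  then show "cl_mult n (cl_parity \<tau>) (cl_monomial {i}) = cl_mult n (cl_coord_vec n (\<lambda>j. a j i)) \<tau>"
    using i by (simp add: cl_mult_assoc l cl_monomial_closed)
qed

lemma \<tau>'_scalar: "\<tau>' {} = \<tau> {}"
  unfolding \<tau>'_def n_def by (rule pin_group_scalar_part_inv[OF \<tau>_pin parseval])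

lemma A_orthogonal:
  assumes "j < n" "k < n"
  shows "(\<Sum>i<n. a j i * a k i) = (if j = k then 1 else 0)"
proof -
  text \<open>\<open>A\<^sup>T A = 1\<close> for the matrix of \<open>A\<close>, hence also \<open>A A\<^sup>T = 1\<close>.\<close>
  let ?M = "mat n n (\<lambda>(i, j). a i j)"
  have "transpose_mat ?M * ?M = 1\<^sub>m n"
  proof (rule eq_matI)
    fix i j assume "i < dim_row (1\<^sub>m n)" "j < dim_col (1\<^sub>m n)"
    then have ij: "i < n" "j < n" by simp_all
    have "(\<Sum>k<n. a k i * a k j) = ip (A (es ! i)) (A (es ! j))"
      unfolding parseval[of "A (es ! i)" "A (es ! j)"] n_def by (simp add: a_def ip_commute[of "A _"])
    also have "\<dots> = (if i = j then 1 else 0)" using ij by (simp add: A_isometry ip_es n_def)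
    finally show "(transpose_mat ?M * ?M) $$ (i, j) = 1\<^sub>m n $$ (i, j)"
      using ij by (simp add: scalar_prod_def atLeast0LessThan)
  qed simp_all
  then have "?M * transpose_mat ?M = 1\<^sub>m n"
    by (intro mat_mult_left_right_inverse[of "transpose_mat ?M" n]) simp_all
  then have "(?M * transpose_mat ?M) $$ (j, k) = 1\<^sub>m n $$ (j, k)" by simp
  then show ?thesis using assms by (simp add: scalar_prod_def atLeast0LessThan)
qed

lemma \<beta>_linear: "linear (\<beta> i)"
proof -
  have "linear (\<lambda>v. ip (\<phi> v) (es ! i))"
    using linear_compose[OF \<phi> ip_linear(2)] by (simp add: o_def)
  from linear_compose_scale_right[OF this, of "1/2"] show ?thesis by (simp add: \<beta>_def[abs_def])
qed

lemma alternating_P: "alternating (P u)"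
  unfolding subst_ext_def[abs_def] wedge_monomial_def
  by (intro alternating_sum alternating_scale alternating_wedge_list)
    (auto intro: alternating_one_form \<beta>_linear)

lemma alternating_E: "alternating E"
  by (rule alternating_exp_form[OF \<omega>])

lemma above_top_degree: "alternating b \<Longrightarrow> dim (UNIV :: 'w set) < length vs \<Longrightarrow> b (vs :: 'w list) = 0"
  using alternating_eq_0 finite_dim by blast

lemma wedge_E_even: "wedge E b = wedge b E"
  by (rule wedge_graded_commute(1)[OF grade_inv_exp_form[OF \<omega>_degree]])

text \<open>A form of degree above the dimension vanishes, hence so does its contraction.\<close>

lemma contract_top:
  assumes "alternating b" "length vs = dim (UNIV :: 'w set)"
  shows "wedge E (wedge (one_form (\<lambda>u. \<omega> [v, u])) b) vs + wedge E (contract v b) vs = 0"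
proof -
  have "0 = wedge E b (v # vs)"
    using above_top_degree[OF alternating_wedge[OF alternating_E assms(1)]] assms(2) by simp
  also have "\<dots> = wedge (contract v E) b vs + wedge E (contract v b) vs"
    by (simp add: wedge_Cons grade_inv_exp_form[OF \<omega>_degree])
  also have "wedge (contract v E) b = wedge E (wedge (one_form (\<lambda>u. \<omega> [v, u])) b)"
  proof -
    have "contract v E = wedge (one_form (\<lambda>u. \<omega> [v, u])) E" by (rule contract_exp_form[OF \<omega>_degree])
    then show ?thesis unfolding wedge_assoc[symmetric] wedge_E_even[of "one_form _"] by simp
  qed
  finally show ?thesis by simp
qed

lemma wedge_E_P: "wedge E (P u) vs = coeff_functional n (\<lambda>I. wedge E (wedge_monomial \<beta> I) vs) u"
  unfolding subst_ext_def[abs_def] wedge_sum_right wedge_scale_right coeff_functional_def ..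

text \<open>At a generating vector the two terms of \<open>contract_top\<close> are exterior
  multiplication by \<open>A e\<^sub>i + e\<^sub>i\<close> and interior multiplication by
  \<open>(A e\<^sub>i - e\<^sub>i) / 2\<close>. Collecting the terms with A and those without gives
  a left and a twisted right Clifford multiplication; the 1/2 in \<beta> is what makes it match the
  1/2 in the square of a generator.\<close>

lemma top_eq_scalar_part:
  assumes vs: "length vs = dim (UNIV :: 'w set)" and u: "u \<in> cl_carrier n"
  shows "wedge E (P u) vs = wedge E (P \<tau>) vs * cl_mult n u \<tau>' {}"
  unfolding wedge_E_P
proof (rule functional_eq_scalar_part[OF A_orthogonal _ u])
  fix i x assume i: "i < n" and x: "x \<in> cl_carrier n"
  let ?e = "es ! i"
  have "\<omega> [gen ?e, u] = (\<Sum>j<n. (a j i + (if j = i then 1 else 0)) * \<beta> j u)" for u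
  proof -
    have "(\<Sum>j<n. (a j i + (if j = i then 1 else 0)) * \<beta> j u) = (\<Sum>j<n. ip (\<phi> u) (es ! j) * ip (A ?e + ?e) (es ! j) / 2)"
      by (rule sum.cong)
        (use i in \<open>auto simp: a_def \<beta>_def linear_add[OF ip_linear(2)] ip_commute[of "A _"] ip_es n_def\<close>)
    then show ?thesis unfolding moment parseval[of "\<phi> u" "A ?e + ?e"] n_def by (simp add: sum_divide_distrib)
  qed
  then have "wedge (one_form (\<lambda>u. \<omega> [gen ?e, u])) (P x) = P (\<lambda>K. \<Sum>j<n. (a j i + (if j = i then 1 else 0)) * ext_mult j x K)"
    by (intro ext) (simp only: wedge_one_form_sum subst_ext_sum, intro sum.cong refl, simp add: subst_ext_ext_mult)
  moreover have "contract (gen ?e) (P x) = P (\<lambda>K. \<Sum>j<n. ((a j i - (if j = i then 1 else 0)) / 2) * int_mult j x K)"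
  proof -
    have "\<beta> j (gen ?e) = (a j i - (if j = i then 1 else 0)) / 2" if "j < n" for j
      using that i \<phi>_gen[of ?e] by (simp add: \<beta>_def a_def n_def linear_diff[OF ip_linear(2)] ip_es ip_commute[of "A _"])
    then show ?thesis
      unfolding contract_subst_ext by (intro arg_cong[where f="subst_ext n \<beta>"] ext sum.cong refl) simp
  qed
  ultimately have *: "coeff_functional n (\<lambda>I. wedge E (wedge_monomial \<beta> I) vs) (\<lambda>K. (\<Sum>j<n. (a j i + (if j = i then 1 else 0)) * ext_mult j x K)
     + (\<Sum>j<n. ((a j i - (if j = i then 1 else 0)) / 2) * int_mult j x K)) = 0"
    using contract_top[OF alternating_P[of x] vs, of "gen ?e"] by (simp add: wedge_E_P coeff_functional_add)
  have "(\<lambda>K. (\<Sum>j<n. (a j i + (if j = i then 1 else 0)) * ext_mult j x K)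
     + (\<Sum>j<n. ((a j i - (if j = i then 1 else 0)) / 2) * int_mult j x K))
    = (\<lambda>K. cl_mult n (cl_coord_vec n (\<lambda>j. a j i)) x K + cl_mult n (cl_parity x) (cl_monomial {i}) K)"
  proof (rule ext)
    fix K
    have "(\<Sum>j<n. (a j i + (if j = i then 1 else 0)) * ext_mult j x K)
     + (\<Sum>j<n. ((a j i - (if j = i then 1 else 0)) / 2) * int_mult j x K)
     = (\<Sum>j<n. a j i * (ext_mult j x K + int_mult j x K / 2) + (if j = i then ext_mult i x K - int_mult i x K / 2 else 0))"
      unfolding sum.distrib[symmetric] by (rule sum.cong) (auto simp: field_simps)
    then show "(\<Sum>j<n. (a j i + (if j = i then 1 else 0)) * ext_mult j x K)
     + (\<Sum>j<n. ((a j i - (if j = i then 1 else 0)) / 2) * int_mult j x K)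
     = cl_mult n (cl_coord_vec n (\<lambda>j. a j i)) x K + cl_mult n (cl_parity x) (cl_monomial {i}) K"
      using i by (simp add: cl_mult_coord_vec_left[OF x] cl_mult_generator_right[OF i x] sum.distrib)
  qed
  from *[unfolded this] show "coeff_functional n (\<lambda>I. wedge E (wedge_monomial \<beta> I) vs) (cl_mult n (cl_coord_vec n (\<lambda>j. a j i)) x)
    + coeff_functional n (\<lambda>I. wedge E (wedge_monomial \<beta> I) vs) (cl_mult n (cl_parity x) (cl_monomial {i})) = 0"
    by (simp add: coeff_functional_add)
qed

text \<open>On the eigenspace of A for -1 the map \<xi> \<mapsto> \<open>\<phi> (gen \<xi>)\<close>
  is multiplication by -2, hence injective.\<close>

lemma kernel_trivial: assumes "\<And>y. \<omega> [x, y] = 0" "\<phi> x = 0" shows "x = 0"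
proof -
  have z: "\<xi> = 0" if "\<phi> (gen \<xi>) = 0" "A \<xi> + \<xi> = 0" for \<xi>
  proof -
    have "\<phi> (gen \<xi>) + 2 *\<^sub>R \<xi> = A \<xi> + \<xi>" using \<phi>_gen[of \<xi>] that by (simp add: scaleR_2)
    then show ?thesis using that by simp
  qed
  have "x \<in> form_kernel \<omega>" using assms by (simp add: form_kernel_def)
  then obtain \<xi> where \<xi>: "x = gen \<xi>" "A \<xi> + \<xi> = 0" unfolding kernel by blast
  \<comment> \<open>Linearity of \<open>gen\<close> is not part of the locale; that it sends 0 to 0
    is read off from the zero vector being in the kernel.\<close>
  have "0 \<in> form_kernel \<omega>" using linear_0[OF \<omega>_linear(1)] by (simp add: form_kernel_def)
  then obtain \<zeta> where \<zeta>: "0 = gen \<zeta>" "A \<zeta> + \<zeta> = 0" unfolding kernel by blast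
  have "\<xi> = 0" using z \<xi> assms(2) by simp
  moreover have "\<zeta> = 0" using z[of \<zeta>] \<zeta> linear_0[OF \<phi>] by simp
  ultimately show ?thesis using \<xi> \<zeta> by simp
qed

text \<open>Covectors of the form \<open>\<iota>\<^sub>v \<omega> + \<phi>\<^sup>* \<eta>\<close> can be removed one at a time.\<close>

lemma top_covectors_eq_0:
  assumes zero: "\<And>u vs. u \<in> cl_carrier n \<Longrightarrow> length vs = dim (UNIV :: 'w set) \<Longrightarrow> wedge E (P u) vs = 0"
    and "\<And>f. f \<in> set fs \<Longrightarrow> \<exists>v \<eta>. f = (\<lambda>u. \<omega> [v, u] + ip (\<phi> u) \<eta>)"
    and "u \<in> cl_carrier n" "length vs = dim (UNIV :: 'w set)"
  shows "wedge E (wedge (wedge_list (map one_form fs)) (P u)) vs = 0"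
  using assms(2-)
\<comment> \<open>Contraction deletes an entry inside the list and changes the coefficients, so the
  induction is on the length, with u arbitrary.\<close>
proof (induction "length fs" arbitrary: fs u vs rule: less_induct)
  case less
  show ?case
  proof (cases fs)
    case Nil
    then show ?thesis using zero less by simp
  next
    case (Cons f gs)
    let ?W = "wedge_list (map one_form gs)"
    obtain v \<eta> where f: "f = (\<lambda>u. \<omega> [v, u] + ip (\<phi> u) \<eta>)" using less.prems(1)[of f] Cons by fastforce
    have lin: "linear g" if "g \<in> set gs" for g
    proof -
      have "g \<in> set fs" using Cons that by simp
      then obtain v \<eta> where g: "g = (\<lambda>u. \<omega> [v, u] + ip (\<phi> u) \<eta>)" using less.prems(1) by meson
      have "linear (\<lambda>u. ip (\<phi> u) \<eta>)" using linear_compose[OF \<phi> ip_linear(2)[of \<eta>]] by (simp add: o_def)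
      then show ?thesis unfolding g by (intro linear_compose_add \<omega>_linear)
    qed
    have alt: "alternating (wedge ?W (P u))"
      by (intro alternating_wedge alternating_P alternating_wedge_list) (auto intro: alternating_one_form lin)
    have IH: "wedge E (wedge (wedge_list (map one_form hs)) (P x)) vs = 0"
      if "length hs < length fs" "set hs \<subseteq> set fs" "x \<in> cl_carrier n" for hs x
      using less.hyps[OF that(1)] less.prems that by blast
    \<comment> \<open>The contraction either removes one of the remaining covectors or acts on
      \<open>P u\<close>; every resulting product has fewer covectors than
      \<open>fs\<close>.\<close>
    have "wedge E (contract v (wedge ?W (P u))) vs = 0"
    proof -
      have "contract v ?W = (\<lambda>vs. \<Sum>r<length gs. ((- 1) ^ r * (gs ! r) v) * wedge_list (map one_form (take r gs @ drop (Suc r) gs)) vs)"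
        by (rule ext) (rule contract_wedge_list_one_forms)
      then have "contract v (wedge ?W (P u)) = (\<lambda>vs. (\<Sum>r<length gs. ((- 1) ^ r * (gs ! r) v) * wedge (wedge_list (map one_form (take r gs @ drop (Suc r) gs))) (P u) vs)
        + (- 1) ^ length gs * wedge ?W (contract v (P u)) vs)"
        unfolding contract_wedge grade_inv_wedge_list_one_forms
        by (simp only: wedge_sum_left wedge_scale_left)
      then have "wedge E (contract v (wedge ?W (P u))) vs
        = (\<Sum>r<length gs. ((- 1) ^ r * (gs ! r) v) * wedge E (wedge (wedge_list (map one_form (take r gs @ drop (Suc r) gs))) (P u)) vs)
        + (- 1) ^ length gs * wedge E (wedge ?W (contract v (P u))) vs"
        by (simp only: wedge_add_right wedge_sum_right wedge_scale_right)
      moreover have "wedge E (wedge (wedge_list (map one_form (take r gs @ drop (Suc r) gs))) (P u)) vs = 0" for r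
        by (rule IH) (use Cons less.prems in \<open>auto dest: in_set_takeD in_set_dropD\<close>)
      moreover have "wedge E (wedge ?W (contract v (P u))) vs = 0"
        unfolding contract_subst_ext
      proof (rule IH)
        have "(\<Sum>i<n. \<beta> i v * int_mult i u K) = 0" if "\<not> K \<subseteq> {..<n}" for K
          by (rule sum.neutral) (use cl_carrierD[OF int_mult_closed[OF _ less.prems(2)] that] in auto)
        then show "(\<lambda>K. \<Sum>i<n. \<beta> i v * int_mult i u K) \<in> cl_carrier n" unfolding cl_carrier_def by blast
      qed (use Cons in auto)
      ultimately show ?thesis by simp
    qed
    then have 1: "wedge E (wedge (one_form (\<lambda>u. \<omega> [v, u])) (wedge ?W (P u))) vs = 0"
      using contract_top[OF alt less.prems(3), of v] by simp
    \<comment> \<open>The pulled-back covector is moved past \<open>?W\<close> and absorbed into the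
      coefficients of \<open>P\<close>; the factor 2 undoes the 1/2 in \<beta>.\<close>
    have "(\<lambda>u. ip (\<phi> u) \<eta>) = (\<lambda>u. \<Sum>j<n. (2 * ip \<eta> (es ! j)) * \<beta> j u)"
      by (rule ext) (simp add: parseval[of _ \<eta>] \<beta>_def n_def mult_ac)
    then have "wedge (one_form (\<lambda>u. ip (\<phi> u) \<eta>)) (P u) = P (\<lambda>K. \<Sum>j<n. (2 * ip \<eta> (es ! j)) * ext_mult j u K)"
      by (intro ext) (simp only: wedge_one_form_sum subst_ext_sum, intro sum.cong refl, simp add: subst_ext_ext_mult)
    moreover have "wedge E (wedge ?W (P (\<lambda>K. \<Sum>j<n. (2 * ip \<eta> (es ! j)) * ext_mult j u K))) vs = 0"
    proof (rule IH)
      have "(\<Sum>j<n. (2 * ip \<eta> (es ! j)) * ext_mult j u K) = 0" if "\<not> K \<subseteq> {..<n}" for K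
        by (rule sum.neutral) (use cl_carrierD[OF ext_mult_closed[OF _ less.prems(2)] that] in auto)
      then show "(\<lambda>K. \<Sum>j<n. (2 * ip \<eta> (es ! j)) * ext_mult j u K) \<in> cl_carrier n" unfolding cl_carrier_def by blast
    qed (use Cons in auto)
    moreover have "wedge (one_form (\<lambda>u. ip (\<phi> u) \<eta>)) (wedge ?W (P u))
      = (\<lambda>vs. (- 1) ^ length gs * wedge ?W (wedge (one_form (\<lambda>u. ip (\<phi> u) \<eta>)) (P u)) vs)"
      unfolding wedge_assoc[symmetric] one_form_wedge_commute[of _ ?W] grade_inv_wedge_list_one_forms
      by (rule ext) (simp add: wedge_assoc wedge_scale_left)
    ultimately have 2: "wedge E (wedge (one_form (\<lambda>u. ip (\<phi> u) \<eta>)) (wedge ?W (P u))) vs = 0"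
      by (simp only: wedge_scale_right mult_zero_right)
    have "one_form f = (\<lambda>vs. one_form (\<lambda>u. \<omega> [v, u]) vs + one_form (\<lambda>u. ip (\<phi> u) \<eta>) vs)"
      unfolding f by (rule ext) (simp add: one_form_def split: list.split)
    then have "wedge (wedge_list (map one_form fs)) (P u) = (\<lambda>vs. wedge (one_form (\<lambda>u. \<omega> [v, u])) (wedge ?W (P u)) vs + wedge (one_form (\<lambda>u. ip (\<phi> u) \<eta>)) (wedge ?W (P u)) vs)"
      by (intro ext) (simp only: Cons list.map wedge_list_Cons wedge_assoc wedge_add_left)
    then show ?thesis using 1 2 by (simp only: wedge_add_right add_0)
  qed
qed

text \<open>Otherwise all top degree products of admissible covectors with \<open>E\<close> and
  \<open>P u\<close> vanish. But a positive definite form Q can be built whose covectors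
  \<open>Q x\<close> are all admissible, and the wedge of those belonging to a basis has the Gram
  determinant as its value on that basis.\<close>

theorem top_nonzero: "\<exists>vs. length vs = dim (UNIV :: 'w set) \<and> wedge E (P \<tau>) vs \<noteq> 0"
proof (rule ccontr)
  assume "\<not> ?thesis"
  then have zero: "wedge E (P u) vs = 0" if "u \<in> cl_carrier n" "length vs = dim (UNIV :: 'w set)" for u vs
    using top_eq_scalar_part[OF that(2,1)] that by simp
  obtain B :: "'w set" where B: "independent B" "span B = UNIV" "card B = dim (UNIV :: 'w set)"
    using basis_exists[of "UNIV :: 'w set"] by (metis top.extremum_uniqueI)
  have "finite B" using independent_span_bound[OF _ B(1)] finite_dim by (metis top_greatest)
  then obtain us where us: "set us = B" "distinct us" using finite_distinct_list by blast
  define d where "d = length us"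
  have d: "d = dim (UNIV :: 'w set)" using us B distinct_card by (fastforce simp: d_def)
  \<comment> \<open>The covector \<open>Q x\<close> arises from the vector
    \<open>\<Sum>j<d. \<omega> [us ! j, x] *\<^sub>R us ! j\<close> and \<eta> =
    \<open>\<phi> x\<close>. Q is definite because \<open>Q x x = 0\<close> puts x in the kernel of
    \<omega> and of \<phi>.\<close>
  define Q where "Q x y = (\<Sum>j<d. \<omega> [us ! j, x] * \<omega> [us ! j, y]) + ip (\<phi> x) (\<phi> y)" for x y
  have Q1: "linear (Q x)" "linear (\<lambda>x. Q x y)" for x y
  proof -
    have "linear (\<lambda>y. ip (\<phi> x) (\<phi> y))" "linear (\<lambda>x. ip (\<phi> x) (\<phi> y))"
      using linear_compose[OF \<phi> ip_linear(1)] linear_compose[OF \<phi> ip_linear(2)] by (simp_all add: o_def)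
    moreover have "linear (\<lambda>y. \<Sum>j<d. \<omega> [us ! j, x] *\<^sub>R \<omega> [us ! j, y])" "linear (\<lambda>x. \<Sum>j<d. \<omega> [us ! j, y] *\<^sub>R \<omega> [us ! j, x])"
      by (intro linear_compose_sum ballI linear_compose_scale_right \<omega>_linear)+
    ultimately show "linear (Q x)" "linear (\<lambda>x. Q x y)"
      unfolding Q_def[abs_def] by (simp_all add: linear_compose_add mult.commute)
  qed
  have Q_form: "\<exists>v \<eta>. Q x = (\<lambda>u. \<omega> [v, u] + ip (\<phi> u) \<eta>)" for x
  proof (intro exI ext)
    fix u
    have "\<omega> [\<Sum>j<d. \<omega> [us ! j, x] *\<^sub>R us ! j, u] = (\<Sum>j<d. \<omega> [us ! j, x] * \<omega> [us ! j, u])"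
      by (simp add: linear_sum[OF \<omega>_linear(1)] linear_scale[OF \<omega>_linear(1)])
    then show "Q x u = \<omega> [\<Sum>j<d. \<omega> [us ! j, x] *\<^sub>R us ! j, u] + ip (\<phi> u) (\<phi> x)"
      by (simp add: Q_def ip_commute)
  qed
  have Q0: "x = 0" if "Q x x = 0" for x
  proof -
    have s: "0 \<le> (\<Sum>j<d. \<omega> [us ! j, x] * \<omega> [us ! j, x])" by (simp add: sum_nonneg)
    then have "(\<Sum>j<d. \<omega> [us ! j, x] * \<omega> [us ! j, x]) = 0" "ip (\<phi> x) (\<phi> x) = 0"
      using that ip_nonneg[of "\<phi> x"] unfolding Q_def by linarith+
    then have z: "\<omega> [us ! j, x] = 0" if "j < d" for j
      using that by (simp add: sum_nonneg_eq_0_iff)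
    have "\<omega> [x, y] = 0" for y
    proof (rule linear_eq_0_on_span[OF \<omega>_linear(2), where b=B])
      show "\<omega> [x, b] = 0" if "b \<in> B" for b
        using that z us \<omega>_swap[of x b] by (auto simp: in_set_conv_nth d_def)
    qed (simp add: B)
    then show ?thesis using kernel_trivial ip_eq_0 \<open>ip (\<phi> x) (\<phi> x) = 0\<close> by blast
  qed
  let ?fs = "map Q us"
  have one: "cl_monomial {} \<in> cl_carrier n" by (simp add: cl_monomial_closed)
  have "wedge E (wedge (wedge_list (map one_form ?fs)) (P (cl_monomial {}))) us = 0"
    by (rule top_covectors_eq_0[OF zero]) (use one d Q_form in \<open>auto simp: d_def\<close>)
  then have "wedge E (wedge_list (map one_form ?fs)) us = 0" by (simp add: subst_ext_one)
  \<comment> \<open>The covectors already exhaust the degree, so only the constant term 1 of the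
    exponential contributes.\<close>
  moreover have "wedge E (wedge_list (map one_form ?fs)) us = E [] * wedge_list (map one_form ?fs) us"
    by (rule wedge_top_degree) (rule wedge_list_one_forms_degree, simp)
  ultimately have "wedge_list (map one_form ?fs) us = 0" by (simp add: exp_form_Nil[OF \<omega>_degree])
  moreover have "wedge_list (map one_form ?fs) us = Determinant.det (mat d d (\<lambda>(r, c). (?fs ! r) (us ! c)))"
    by (rule wedge_list_one_forms_det) (simp_all add: d_def)
  ultimately have "Determinant.det (mat d d (\<lambda>(r, c). (?fs ! r) (us ! c))) = 0" by (simp only:)
  \<comment> \<open>A null vector of the Gram matrix gives y with \<open>Q (us ! r) y = 0\<close>
    for every r. Expanding the first y in the basis yields \<open>Q y y = 0\<close>.\<close>
  then obtain x where x: "x \<in> carrier_vec d" "x \<noteq> 0\<^sub>v d" "mat d d (\<lambda>(r, c). (?fs ! r) (us ! c)) *\<^sub>v x = 0\<^sub>v d"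
    using det_0_iff_vec_prod_zero[of "mat d d (\<lambda>(r, c). (?fs ! r) (us ! c))" d] by auto
  define y where "y = (\<Sum>c<d. x $ c *\<^sub>R us ! c)"
  have "Q (us ! r) y = 0" if "r < d" for r
  proof -
    have "(mat d d (\<lambda>(r, c). (?fs ! r) (us ! c)) *\<^sub>v x) $ r = 0" using x that by simp
    then have "(\<Sum>c<d. Q (us ! r) (us ! c) * x $ c) = 0"
      using that x(1) by (simp add: scalar_prod_def atLeast0LessThan d_def)
    then show ?thesis by (simp add: y_def linear_sum[OF Q1(1)] linear_scale[OF Q1(1)] mult.commute)
  qed
  then have "Q y y = 0" by (subst (1) y_def) (simp add: linear_sum[OF Q1(2)] linear_scale[OF Q1(2)])
  then have "y = 0" by (rule Q0)
  moreover have "y = (\<Sum>b\<in>B. (x $ (the_inv_into {..<d} ((!) us) b)) *\<^sub>R b)"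
  proof -
    have inj: "inj_on ((!) us) {..<d}" using us by (simp add: d_def inj_on_def nth_eq_iff_index_eq)
    have "(!) us ` {..<d} = B" using us by (auto simp: d_def in_set_conv_nth)
    then show ?thesis unfolding y_def
      by (subst sum.reindex_cong[OF inj, of B "\<lambda>b. (x $ (the_inv_into {..<d} ((!) us) b)) *\<^sub>R b"])
        (auto simp: the_inv_into_f_f[OF inj])
  qed
  ultimately have ind: "x $ (the_inv_into {..<d} ((!) us) b) = 0" if "b \<in> B" for b
    using independentD[OF B(1) \<open>finite B\<close> order_refl _ that] by metis
  have "x $ c = 0" if "c < d" for c
  proof -
    have inj: "inj_on ((!) us) {..<d}" using us by (simp add: d_def inj_on_def nth_eq_iff_index_eq)
    show ?thesis using ind[of "us ! c"] that us the_inv_into_f_f[OF inj, of c] by (auto simp: d_def)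
  qed
  then have "x = 0\<^sub>v d" using x(1) by (intro eq_vecI) auto
  then show False using x(2) by simp
qed

lemma scalar_part_square: "\<tau> {} * \<tau> {} = endo_det ip es (\<lambda>\<xi>. (1 / 2) *\<^sub>R (\<xi> + A \<xi>))"
proof -
  let ?M = "mat n n (\<lambda>(r, c). half_id_plus c r)"
  have "\<tau> {} * \<tau> {} = Determinant.det ?M" using scalar_part_mult_inverse \<tau>'_scalar by simp
  also have "\<dots> = Determinant.det (transpose_mat ?M)" by (rule det_transpose[OF mat_carrier, symmetric])
  also have "transpose_mat ?M = mat n n (\<lambda>(i, j). ip (es ! i) ((1 / 2) *\<^sub>R (es ! j + A (es ! j))))"
    by (rule eq_matI) (auto simp: half_id_plus_def a_def linear_scale[OF ip_linear(1)] linear_add[OF ip_linear(1)] ip_es n_def)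
  finally show ?thesis by (simp add: endo_det_def n_def)
qed

text \<open>If A \<xi> = - \<xi>, then \<open>gen \<xi>\<close> is in the kernel of \<omega>, hence
  zero, so A \<xi> = \<xi> as well and \<xi> = 0. The determinant and the scalar part of \<tau> are
  therefore nonzero, and the scalar part can be divided out; its absolute value is the root of the
  determinant and its sign remains.\<close>

theorem top_nondegenerate:
  assumes nd: "nondegenerate \<omega>" and vs: "length vs = dim (UNIV :: 'w set)"
  shows "wedge E (P \<tau>) vs = (if \<tau> {} < 0 then - 1 else 1) * E vs
    / sqrt \<bar>endo_det ip es (\<lambda>\<xi>. (1 / 2) *\<^sub>R (\<xi> + A \<xi>))\<bar>"
proof -
  let ?M = "mat n n (\<lambda>(i, j). ip (es ! i) ((1 / 2) *\<^sub>R (es ! j + A (es ! j))))"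
  have "Determinant.det ?M \<noteq> 0"
  proof
    assume "Determinant.det ?M = 0"
    then obtain x where x: "x \<in> carrier_vec n" "x \<noteq> 0\<^sub>v n" "?M *\<^sub>v x = 0\<^sub>v n"
      using det_0_iff_vec_prod_zero[of ?M n] by auto
    define \<xi> where "\<xi> = (\<Sum>c<n. x $ c *\<^sub>R es ! c)"
    have "ip (A \<xi> + \<xi>) (es ! r) = 0" if "r < n" for r
    proof -
      have "(?M *\<^sub>v x) $ r = 0" using x that by simp
      then have "(\<Sum>c<n. ip (es ! r) ((1 / 2) *\<^sub>R (es ! c + A (es ! c))) * x $ c) = 0"
        using that x(1) by (simp add: scalar_prod_def atLeast0LessThan)
      also have "(\<Sum>c<n. ip (es ! r) ((1 / 2) *\<^sub>R (es ! c + A (es ! c))) * x $ c) = ip (es ! r) (A \<xi> + \<xi>) / 2"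
        unfolding \<xi>_def linear_sum[OF A] linear_scale[OF A] sum.distrib[symmetric] linear_sum[OF ip_linear(1)] sum_divide_distrib
        by (rule sum.cong) (simp_all add: linear_scale[OF ip_linear(1)] linear_add[OF ip_linear(1)] algebra_simps)
      finally show ?thesis by (simp add: ip_commute)
    qed
    then have 0: "A \<xi> + \<xi> = 0" using expand[of "A \<xi> + \<xi>"] by (simp add: n_def)
    then have "gen \<xi> \<in> form_kernel \<omega>" unfolding kernel by blast
    then have "gen \<xi> = 0" using nd by (simp add: nondegenerate_def)
    then have "A \<xi> - \<xi> = 0" using \<phi>_gen[of \<xi>] 0 linear_0[OF \<phi>] by simp
    then have "2 *\<^sub>R \<xi> = 0" using 0 by (simp add: scaleR_2)
    then have "\<xi> = 0" by simp
    then have "ip \<xi> (es ! r) = 0" for r using linear_0[OF ip_linear(2)] by simp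
    moreover have "ip \<xi> (es ! r) = x $ r" if "r < n" for r
    proof -
      have "ip \<xi> (es ! r) = (\<Sum>c<n. if c = r then x $ r else 0)"
        unfolding \<xi>_def ip_sum_left by (rule sum.cong) (use that in \<open>auto simp: ip_es n_def\<close>)
      then show ?thesis using that by simp
    qed
    ultimately have "x = 0\<^sub>v n" using x(1) by (intro eq_vecI) auto
    then show False using x(2) by simp
  qed
  then have ne: "\<tau> {} \<noteq> 0" using scalar_part_square by (auto simp: endo_det_def n_def)
  have "E vs = wedge E (P (cl_monomial {})) vs" by (simp add: subst_ext_one)
  also have "\<dots> = wedge E (P \<tau>) vs * \<tau> {}"
    using top_eq_scalar_part[OF vs, of "cl_monomial {}"] closed by (simp add: cl_monomial_closed \<tau>'_scalar)
  finally have "E vs = wedge E (P \<tau>) vs * \<tau> {}" .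
  moreover have "sqrt \<bar>endo_det ip es (\<lambda>\<xi>. (1 / 2) *\<^sub>R (\<xi> + A \<xi>))\<bar> = \<bar>\<tau> {}\<bar>"
    by (simp flip: scalar_part_square)
  ultimately show ?thesis using ne by (auto simp: abs_if)
qed

end

subsection \<open>Finite-dimensional normed spaces\<close>

definition finite_dim :: "'a::real_vector itself \<Rightarrow> bool" where
  "finite_dim _ \<longleftrightarrow> (\<exists>B :: 'a set. finite B \<and> span B = UNIV)"

lemma finite_dim_basis:
  assumes "finite_dim TYPE('a::real_vector)"
  obtains B :: "'a::real_vector set" where "finite B" "independent B" "span B = UNIV"
proof -
  obtain C :: "'a set" where C: "finite C" "span C = UNIV" using assms by (auto simp: finite_dim_def)
  obtain B :: "'a set" where B: "independent B" "span B = UNIV"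
    using basis_exists[of "UNIV :: 'a set"] by (metis top.extremum_uniqueI)
  have "finite B" using independent_span_bound[OF C(1) B(1)] C(2) by auto
  then show ?thesis using B that by blast
qed

lemma finite_dim_real: "finite_dim TYPE(real)"
proof -
  have "span {1 :: real} = UNIV"
    by (auto simp: span_singleton)
  then show ?thesis unfolding finite_dim_def by (intro exI[of _ "{1}"]) simp
qed

lemma finite_dim_prod:
  assumes "finite_dim TYPE('a::real_vector)" "finite_dim TYPE('b::real_vector)"
  shows "finite_dim TYPE('a::real_vector \<times> 'b::real_vector)"
proof -
  obtain A :: "'a set" where A: "finite A" "span A = UNIV" using assms by (auto simp: finite_dim_def)
  obtain B :: "'b set" where B: "finite B" "span B = UNIV" using assms by (auto simp: finite_dim_def)
  let ?C = "(\<lambda>a. (a, 0)) ` A \<union> (\<lambda>b. (0, b)) ` B"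
  have lin: "linear (\<lambda>a :: 'a. (a, 0 :: 'b))" "linear (\<lambda>b :: 'b. (0 :: 'a, b))"
    by (simp_all add: linear_iff)
  have "(x, y) \<in> span ?C" for x y
  proof -
    have "(x, 0) \<in> span ((\<lambda>a. (a, 0 :: 'b)) ` A)" "(0, y) \<in> span ((\<lambda>b. (0 :: 'a, b)) ` B)"
      unfolding linear_span_image[OF lin(1)] linear_span_image[OF lin(2)] A B by auto
    then have "(x, 0) + (0, y) \<in> span ?C"
      by (intro span_add) (meson Un_upper1 Un_upper2 span_mono subsetD)+
    then show ?thesis by simp
  qed
  then have "span ?C = UNIV" by auto
  then show ?thesis using A B unfolding finite_dim_def by (intro exI[of _ ?C]) simp
qed

text \<open>All norms on a finite-dimensional space are equivalent; compactness of the unit sphere for the sum norm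
  in coordinates is taken in the product topology.\<close>

lemma finite_dim_norm_lower_bound:
  fixes B :: "'a::real_normed_vector set"
  assumes B: "finite B" "independent B"
  obtains c where "c > 0" "\<And>f. c * (\<Sum>b\<in>B. \<bar>f b\<bar>) \<le> norm (\<Sum>b\<in>B. f b *\<^sub>R b)"
proof -
  let ?X = "product_topology (\<lambda>_. euclideanreal) B"
  let ?K = "PiE B (\<lambda>_. {-1..1}) \<inter> {f \<in> topspace ?X. (\<Sum>b\<in>B. \<bar>f b\<bar>) \<in> {1}}"
  let ?h = "\<lambda>f. norm (\<Sum>b\<in>B. f b *\<^sub>R b)"
  have "compactin ?X (PiE B (\<lambda>_. {-1..1 :: real}))"
    by (simp add: compactin_PiE)
  moreover have "closedin ?X {f \<in> topspace ?X. (\<Sum>b\<in>B. \<bar>f b\<bar>) \<in> {1}}"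
    by (rule closedin_continuous_map_preimage[of _ euclideanreal])
      (auto intro!: continuous_intros continuous_map_sum continuous_map_real_abs continuous_map_product_projection B)
  ultimately have "compactin ?X ?K" by (rule compact_Int_closedin)
  moreover have "continuous_map ?X euclideanreal ?h"
  proof (intro continuous_map_norm continuous_map_sum B)
    fix b assume "b \<in> B"
    then have "continuous_map ?X euclideanreal (\<lambda>f. f b)" by (rule continuous_map_product_projection)
    moreover have "continuous_map euclideanreal euclidean (\<lambda>r. r *\<^sub>R b)"
      by (simp add: continuous_map_iff_continuous2 continuous_intros)
    ultimately show "continuous_map ?X euclidean (\<lambda>f. f b *\<^sub>R b)"
      using continuous_map_compose[of ?X euclideanreal "\<lambda>f. f b" euclidean "\<lambda>r. r *\<^sub>R b"] by (simp add: o_def)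
  qed
  ultimately have "compact (?h ` ?K)" using image_compactin compactin_euclidean_iff by blast
  then have "closed (?h ` ?K)" by (rule compact_imp_closed)
  moreover have "0 \<notin> ?h ` ?K"
  proof
    assume "0 \<in> ?h ` ?K"
    then obtain f where f: "f \<in> ?K" "?h f = 0" by auto
    then have "f b = 0" if "b \<in> B" for b using independentD[OF B(2,1) order_refl _ that] by simp
    then show False using f(1) by simp
  qed
  ultimately have "open (- (?h ` ?K))" "0 \<in> - (?h ` ?K)" by (simp_all only: open_Compl Compl_iff not_False_eq_True)
  then obtain c where c: "c > 0" "ball 0 c \<subseteq> - (?h ` ?K)" unfolding open_contains_ball by blast
  have "c * (\<Sum>b\<in>B. \<bar>f b\<bar>) \<le> ?h f" for f
  proof (cases "(\<Sum>b\<in>B. \<bar>f b\<bar>) = 0")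
    case False
    define N where "N = (\<Sum>b\<in>B. \<bar>f b\<bar>)"
    have "N \<ge> 0" unfolding N_def by (rule sum_nonneg) simp
    then have N: "N > 0" using False unfolding N_def[symmetric] by linarith
    \<comment> \<open>Points of the product space are extensional, so the rescaled coefficients are
      restricted to B.\<close>
    let ?g = "restrict (\<lambda>b. f b / N) B"
    have "\<bar>f b\<bar> \<le> N" if "b \<in> B" for b unfolding N_def using B that by (intro member_le_sum) auto
    then have "\<bar>f b / N\<bar> \<le> 1" if "b \<in> B" for b using N that by simp
    then have "- 1 \<le> f b / N \<and> f b / N \<le> 1" if "b \<in> B" for b
      using that unfolding abs_le_iff by (metis minus_le_iff)
    moreover have "(\<Sum>b\<in>B. \<bar>?g b\<bar>) = 1"
      using N by (simp flip: sum_divide_distrib) (simp add: N_def)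
    ultimately have "?g \<in> ?K" by auto
    then have "?h ?g \<notin> ball 0 c" using c by blast
    then have "c \<le> ?h ?g" by simp
    also have "?h ?g = norm ((1 / N) *\<^sub>R (\<Sum>b\<in>B. f b *\<^sub>R b))"
      by (simp add: scaleR_sum_right)
    also have "\<dots> = ?h f / N" using N by simp
    finally show ?thesis using N by (simp add: N_def[symmetric] field_simps)
  qed simp
  then show ?thesis using c that by blast
qed

text \<open>The value is bounded by the sum of the coordinates, which the norm controls by
  \<open>finite_dim_norm_lower_bound\<close>.\<close>

lemma finite_dim_bounded_linear:
  fixes f :: "'a::real_normed_vector \<Rightarrow> 'b::real_normed_vector"
  assumes "finite_dim TYPE('a)" "linear f"
  shows "bounded_linear f"
proof -
  obtain B :: "'a set" where B: "finite B" "independent B" "span B = UNIV" using finite_dim_basis[OF assms(1)] .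
  obtain c where c: "c > 0" "\<And>f. c * (\<Sum>b\<in>B. \<bar>f b\<bar>) \<le> norm (\<Sum>b\<in>B. f b *\<^sub>R b)"
    using finite_dim_norm_lower_bound[OF B(1,2)] by blast
  define M where "M = (\<Sum>b\<in>B. norm (f b))"
  have "norm (f x) \<le> norm x * (M / c)" for x
  proof -
    have x: "(\<Sum>b\<in>B. representation B x b *\<^sub>R b) = x"
      using B by (intro sum_representation_eq) auto
    have "f x = (\<Sum>b\<in>B. representation B x b *\<^sub>R f b)"
      by (subst x[symmetric]) (simp add: linear_sum[OF assms(2)] linear_scale[OF assms(2)])
    then have "norm (f x) \<le> (\<Sum>b\<in>B. \<bar>representation B x b\<bar> * norm (f b))"
      by (metis (no_types, lifting) norm_scaleR norm_sum sum.cong)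
    also have "\<dots> \<le> (\<Sum>b\<in>B. \<bar>representation B x b\<bar> * M)"
      unfolding M_def using B by (intro sum_mono mult_left_mono member_le_sum) auto
    also have "\<dots> = (\<Sum>b\<in>B. \<bar>representation B x b\<bar>) * M" by (simp add: sum_distrib_right)
    also have "\<dots> \<le> norm x / c * M"
      using c(2)[of "representation B x"] c(1) unfolding x
      by (intro mult_right_mono) (simp_all add: M_def sum_nonneg field_simps)
    finally show ?thesis by simp
  qed
  then show ?thesis
    using assms(2) by (intro bounded_linear_intro[of f "M / c"]) (simp_all add: linear_add linear_scale)
qed

subsection \<open>Continuously differentiable maps\<close>

lemma Ck_on_subset: "Ck_on k S f \<Longrightarrow> T \<subseteq> S \<Longrightarrow> Ck_on k T f"
  by (induction k arbitrary: f) (auto intro: continuous_on_subset)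

lemma frechet_derivative_eqI: "(f has_derivative f') (at x) \<Longrightarrow> frechet_derivative f (at x) = f'"
  using frechet_derivative_at by metis

lemma frechet_derivative_cong_open:
  assumes "open S" "x \<in> S" "\<And>y. y \<in> S \<Longrightarrow> f y = g y" "f differentiable (at x)"
  shows "g differentiable (at x)" "frechet_derivative g (at x) = frechet_derivative f (at x)"
proof -
  have "(g has_derivative frechet_derivative f (at x)) (at x)"
    using has_derivative_transform_within_open[OF _ assms(1,2,3)] assms(4) by (simp add: frechet_derivative_works)
  then show "g differentiable (at x)" "frechet_derivative g (at x) = frechet_derivative f (at x)"
    by (auto simp: differentiable_def frechet_derivative_eqI)
qed

lemma Ck_on_cong:
  assumes "open S" "\<And>x. x \<in> S \<Longrightarrow> f x = g x" "Ck_on k S f"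
  shows "Ck_on k S g"
  using assms(2,3)
proof (induction k arbitrary: f g)
  case 0
  then show ?case using continuous_on_cong[of S S f g] by simp
next
  case (Suc k)
  have d: "f differentiable (at x)" if "x \<in> S" for x using Suc.prems(2) that by simp
  note * = frechet_derivative_cong_open[OF assms(1) _ Suc.prems(1) d]
  have "Ck_on k S (\<lambda>x. frechet_derivative g (at x) v)" for v
    by (rule Suc.IH[of "\<lambda>x. frechet_derivative f (at x) v"]) (use Suc.prems * in auto)
  then show ?case using * by simp
qed

lemma Ck_on_local:
  assumes "\<And>x. x \<in> S \<Longrightarrow> \<exists>T. open T \<and> x \<in> T \<and> Ck_on k T f"
  shows "Ck_on k S f"
  using assms
proof (induction k arbitrary: f)
  case 0
  have "isCont f x" if "x \<in> S" for x
    using 0[OF that] continuous_on_eq_continuous_at by auto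
  then show ?case by (simp add: continuous_at_imp_continuous_on)
next
  case (Suc k)
  have "Ck_on k S (\<lambda>x. frechet_derivative f (at x) v)" for v
    by (rule Suc.IH) (use Suc.prems in fastforce)
  moreover have "f differentiable (at x)" if "x \<in> S" for x using Suc.prems[OF that] by auto
  ultimately show ?case by simp
qed

lemma Ck_on_Suc_imp: "Ck_on (Suc k) S f \<Longrightarrow> Ck_on k S f"
proof (induction k arbitrary: f)
  case 0
  then show ?case by (auto intro!: continuous_at_imp_continuous_on differentiable_imp_continuous_within)
next
  case (Suc k)
  then show ?case by (metis Ck_on.simps(2))
qed

lemma Ck_on_const: "Ck_on k S (\<lambda>x. c)"
  by (induction k arbitrary: c) (simp_all add: frechet_derivative_eqI[OF has_derivative_const])

lemma Ck_on_bounded_linear: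
  assumes "open S" "bounded_linear L" "Ck_on k S f"
  shows "Ck_on k S (\<lambda>x. L (f x))"
  using assms(3)
proof (induction k arbitrary: f)
  case 0
  then show ?case using linear_continuous_on[OF assms(2)] by (simp add: bounded_linear.continuous_on[OF assms(2)])
next
  case (Suc k)
  have *: "((\<lambda>x. L (f x)) has_derivative (\<lambda>v. L (frechet_derivative f (at x) v))) (at x)" if "x \<in> S" for x
    using Suc.prems that by (intro bounded_linear.has_derivative[OF assms(2)]) (simp add: frechet_derivative_works[symmetric])
  have "Ck_on k S (\<lambda>x. frechet_derivative (\<lambda>x. L (f x)) (at x) v)" for v
    by (rule Ck_on_cong[OF assms(1) _ Suc.IH[of "\<lambda>x. frechet_derivative f (at x) v"]])
      (use Suc.prems frechet_derivative_eqI[OF *] in auto)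
  then show ?case using * by (auto simp: differentiable_def)
qed

lemma Ck_on_id: "Ck_on k S (\<lambda>x. x)"
proof (cases k)
  case (Suc j)
  then show ?thesis by (simp add: frechet_derivative_eqI[OF has_derivative_ident] Ck_on_const)
qed (simp add: continuous_on_id)

lemma Ck_on_add:
  assumes "open S" "Ck_on k S f" "Ck_on k S g"
  shows "Ck_on k S (\<lambda>x. f x + g x)"
  using assms(2,3)
proof (induction k arbitrary: f g)
  case 0
  then show ?case by (simp add: continuous_on_add)
next
  case (Suc k)
  have *: "((\<lambda>x. f x + g x) has_derivative (\<lambda>v. frechet_derivative f (at x) v + frechet_derivative g (at x) v)) (at x)" if "x \<in> S" for x
    using Suc.prems that by (intro has_derivative_add) (simp_all add: frechet_derivative_works[symmetric])
  have "Ck_on k S (\<lambda>x. frechet_derivative (\<lambda>x. f x + g x) (at x) v)" for v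
    by (rule Ck_on_cong[OF assms(1) _ Suc.IH[of "\<lambda>x. frechet_derivative f (at x) v" "\<lambda>x. frechet_derivative g (at x) v"]])
      (use Suc.prems frechet_derivative_eqI[OF *] in auto)
  then show ?case using * by (auto simp: differentiable_def)
qed

lemma Ck_on_sum:
  assumes "open S" "\<And>i. i \<in> I \<Longrightarrow> Ck_on k S (f i)"
  shows "Ck_on k S (\<lambda>x. \<Sum>i\<in>I. f i x)"
  using assms(2) by (induction I rule: infinite_finite_induct) (simp_all add: Ck_on_const Ck_on_add[OF assms(1)])

lemma Ck_on_bilinear:
  assumes "open S" "bounded_bilinear p" "Ck_on k S f" "Ck_on k S g"
  shows "Ck_on k S (\<lambda>x. p (f x) (g x))"
  using assms(3,4)
proof (induction k arbitrary: f g)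
  case 0
  then show ?case using bounded_bilinear.continuous_on[OF assms(2)] by simp
next
  case (Suc k)
  have *: "((\<lambda>x. p (f x) (g x)) has_derivative (\<lambda>v. p (f x) (frechet_derivative g (at x) v) + p (frechet_derivative f (at x) v) (g x))) (at x)" if "x \<in> S" for x
    using Suc.prems that by (intro bounded_bilinear.FDERIV[OF assms(2)]) (simp_all add: frechet_derivative_works[symmetric])
  have "Ck_on k S (\<lambda>x. p (f x) (frechet_derivative g (at x) v) + p (frechet_derivative f (at x) v) (g x))" for v
  proof (rule Ck_on_add[OF assms(1)])
    have "Ck_on k S f" "Ck_on k S g" using Suc.prems Ck_on_Suc_imp by blast+
    moreover have "Ck_on k S (\<lambda>x. frechet_derivative f (at x) v)" "Ck_on k S (\<lambda>x. frechet_derivative g (at x) v)"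
      using Suc.prems by simp_all
    ultimately show "Ck_on k S (\<lambda>x. p (f x) (frechet_derivative g (at x) v))"
      "Ck_on k S (\<lambda>x. p (frechet_derivative f (at x) v) (g x))" using Suc.IH by blast+
  qed
  then have "Ck_on k S (\<lambda>x. frechet_derivative (\<lambda>x. p (f x) (g x)) (at x) v)" for v
    by (rule Ck_on_cong[OF assms(1), rotated]) (use frechet_derivative_eqI[OF *] in auto)
  then show ?case using * by (auto simp: differentiable_def)
qed

text \<open>\<open>Ck_on\<close> speaks of derivatives in fixed directions, whereas the chain rule
  applies the derivative of g to the moving vector f'(x) v. Expanding this vector in a basis gives a
  finite sum of products to which the induction applies.\<close>

lemma Ck_on_compose:
  fixes f :: "'a::real_normed_vector \<Rightarrow> 'b::real_normed_vector" and g :: "'b \<Rightarrow> 'c::real_normed_vector"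
  assumes fd: "finite_dim TYPE('b)" and "open S" "open T" "f ` S \<subseteq> T" "Ck_on k S f" "Ck_on k T g"
  shows "Ck_on k S (\<lambda>x. g (f x))"
  using assms(5,6)
proof (induction k arbitrary: g)
  case 0
  then show ?case using assms(4) by (auto intro: continuous_on_compose2)
next
  case (Suc k)
  obtain B :: "'b set" where B: "finite B" "independent B" "span B = UNIV" using finite_dim_basis[OF fd] .
  let ?D = "\<lambda>x. frechet_derivative f (at x)" and ?E = "\<lambda>y. frechet_derivative g (at y)"
  have lin: "linear (?E (f x))" if "x \<in> S" for x
    using Suc.prems(2) assms(4) that by (intro linear_frechet_derivative) auto
  have *: "((\<lambda>x. g (f x)) has_derivative (\<lambda>v. ?E (f x) (?D x v))) (at x)" if "x \<in> S" for x
    using Suc.prems assms(4) that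
    by (intro has_derivative_compose[of f _ _ UNIV g]) (auto simp: frechet_derivative_works[symmetric] image_subset_iff)
  have rep: "bounded_linear (\<lambda>y. representation B y b)" for b
    by (rule finite_dim_bounded_linear[OF fd]) (use B in \<open>simp add: linear_iff representation_add representation_scale\<close>)
  have c: "Ck_on k S (\<lambda>x. \<Sum>b\<in>B. representation B (?D x v) b *\<^sub>R ?E (f x) b)" for v
  proof (intro Ck_on_sum[OF assms(2)] Ck_on_bilinear[OF assms(2) bounded_bilinear_scaleR] Ck_on_bounded_linear[OF assms(2) rep])
    show "Ck_on k S (\<lambda>x. ?D x v)" using Suc.prems by simp
    have "Ck_on k S f" using Suc.prems Ck_on_Suc_imp by blast
    then show "Ck_on k S (\<lambda>x. ?E (f x) b)" for b
      using Suc.IH[of "\<lambda>y. ?E y b"] Suc.prems by simp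
  qed
  have eq: "(\<Sum>b\<in>B. representation B (?D x v) b *\<^sub>R ?E (f x) b) = frechet_derivative (\<lambda>x. g (f x)) (at x) v" if "x \<in> S" for x v
  proof -
    have "?E (f x) (?D x v) = ?E (f x) (\<Sum>b\<in>B. representation B (?D x v) b *\<^sub>R b)"
      using B by (subst sum_representation_eq) auto
    then show ?thesis
      by (simp add: frechet_derivative_eqI[OF *[OF that]] linear_sum[OF lin[OF that]] linear_scale[OF lin[OF that]])
  qed
  have "Ck_on k S (\<lambda>x. frechet_derivative (\<lambda>x. g (f x)) (at x) v)" for v
    by (rule Ck_on_cong[OF assms(2) eq c])
  then show ?case using * by (auto simp: differentiable_def)
qed

subsection \<open>Smoothness near a point\<close>

text \<open>Smoothness of the germ at x, so that domains shrinking under composition need not be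
  tracked.\<close>

definition smooth_at :: "'a::real_normed_vector \<Rightarrow> ('a \<Rightarrow> 'b::real_normed_vector) \<Rightarrow> bool" where
  "smooth_at x f \<longleftrightarrow> (\<exists>S. open S \<and> x \<in> S \<and> smooth_on S f)"

lemma smooth_on_imp_smooth_at: "smooth_on S f \<Longrightarrow> open T \<Longrightarrow> T \<subseteq> S \<Longrightarrow> x \<in> T \<Longrightarrow> smooth_at x f"
  unfolding smooth_at_def smooth_on_def by (intro exI[of _ T]) (auto intro: Ck_on_subset)

lemma smooth_onI: "(\<And>x. x \<in> S \<Longrightarrow> smooth_at x f) \<Longrightarrow> smooth_on S f"
  unfolding smooth_on_def smooth_at_def by (intro allI Ck_on_local) blast

lemma smooth_at_cong:
  assumes "smooth_at x f" "eventually (\<lambda>y. f y = g y) (nhds x)"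
  shows "smooth_at x g"
proof -
  obtain S where S: "open S" "x \<in> S" "smooth_on S f" using assms(1) unfolding smooth_at_def by blast
  obtain T where T: "open T" "x \<in> T" "\<And>y. y \<in> T \<Longrightarrow> f y = g y" using assms(2) by (auto simp: eventually_nhds)
  have "open (S \<inter> T)" using S T by auto
  have "Ck_on k (S \<inter> T) g" for k
  proof (rule Ck_on_cong[OF \<open>open (S \<inter> T)\<close>])
    show "f y = g y" if "y \<in> S \<inter> T" for y using T that by blast
    show "Ck_on k (S \<inter> T) f" using S(3) unfolding smooth_on_def by (auto intro: Ck_on_subset)
  qed
  then show ?thesis unfolding smooth_at_def smooth_on_def using S T by (intro exI[of _ "S \<inter> T"]) auto
qed

lemma smooth_at_imp_differentiable: "smooth_at x f \<Longrightarrow> f differentiable (at x)"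
proof -
  assume "smooth_at x f"
  then obtain S where "x \<in> S" "Ck_on (Suc 0) S f" unfolding smooth_at_def smooth_on_def by blast
  then show ?thesis by simp
qed

lemma smooth_at_has_derivative: "smooth_at x f \<Longrightarrow> (f has_derivative frechet_derivative f (at x)) (at x)"
  using smooth_at_imp_differentiable frechet_derivative_works by blast

lemma smooth_at_imp_isCont: "smooth_at x f \<Longrightarrow> isCont f x"
  using smooth_at_imp_differentiable differentiable_imp_continuous_within by blast

lemma smooth_at_eventually: "smooth_at x f \<Longrightarrow> eventually (\<lambda>y. smooth_at y f) (nhds x)"
  unfolding smooth_at_def eventually_nhds by blast

lemma smooth_at_derivative: "smooth_at x f \<Longrightarrow> smooth_at x (\<lambda>y. frechet_derivative f (at y) v)"
proof -
  assume "smooth_at x f"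
  then obtain S where S: "open S" "x \<in> S" "\<And>k. Ck_on (Suc k) S f" unfolding smooth_at_def smooth_on_def by blast
  then have "Ck_on k S (\<lambda>y. frechet_derivative f (at y) v)" for k by simp
  then show ?thesis unfolding smooth_at_def smooth_on_def using S by (intro exI[of _ S]) simp
qed

lemma smooth_at_const: "smooth_at x (\<lambda>y. c)"
  unfolding smooth_at_def smooth_on_def by (intro exI[of _ UNIV]) (simp add: Ck_on_const)

lemma smooth_at_id: "smooth_at x (\<lambda>y. y)"
  unfolding smooth_at_def smooth_on_def by (intro exI[of _ UNIV]) (simp add: Ck_on_id)

lemma smooth_at_bounded_linear:
  assumes "bounded_linear L" "smooth_at x f" shows "smooth_at x (\<lambda>y. L (f y))"
proof -
  obtain S where S: "open S" "x \<in> S" "smooth_on S f" using assms(2) unfolding smooth_at_def by blast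
  then have "smooth_on S (\<lambda>y. L (f y))"
    unfolding smooth_on_def using Ck_on_bounded_linear[OF S(1) assms(1), where f=f] by blast
  then show ?thesis using S unfolding smooth_at_def by (intro exI[of _ S]) simp
qed

lemma smooth_at_linear: "bounded_linear L \<Longrightarrow> smooth_at x L"
  by (rule smooth_at_bounded_linear[OF _ smooth_at_id])

lemma smooth_at_bilinear:
  assumes "bounded_bilinear p" "smooth_at x f" "smooth_at x g"
  shows "smooth_at x (\<lambda>y. p (f y) (g y))"
proof -
  obtain S where S: "open S" "x \<in> S" "smooth_on S f" using assms(2) unfolding smooth_at_def by blast
  obtain T where T: "open T" "x \<in> T" "smooth_on T g" using assms(3) unfolding smooth_at_def by blast
  have "Ck_on k (S \<inter> T) f" "Ck_on k (S \<inter> T) g" for k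
    using S T unfolding smooth_on_def by (auto intro: Ck_on_subset)
  then have "smooth_on (S \<inter> T) (\<lambda>y. p (f y) (g y))"
    unfolding smooth_on_def using S T by (intro allI Ck_on_bilinear[OF _ assms(1)]) auto
  then show ?thesis unfolding smooth_at_def using S T by (intro exI[of _ "S \<inter> T"]) auto
qed

lemma smooth_at_add:
  assumes "smooth_at x f" "smooth_at x g"
  shows "smooth_at x (\<lambda>y. f y + g y)"
proof -
  obtain S where S: "open S" "x \<in> S" "smooth_on S f" using assms(1) unfolding smooth_at_def by blast
  obtain T where T: "open T" "x \<in> T" "smooth_on T g" using assms(2) unfolding smooth_at_def by blast
  have "Ck_on k (S \<inter> T) f" "Ck_on k (S \<inter> T) g" for k
    using S T unfolding smooth_on_def by (auto intro: Ck_on_subset)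
  then have "smooth_on (S \<inter> T) (\<lambda>y. f y + g y)"
    unfolding smooth_on_def using S T by (intro allI Ck_on_add) auto
  then show ?thesis unfolding smooth_at_def using S T by (intro exI[of _ "S \<inter> T"]) auto
qed

lemma smooth_at_sum:
  "(\<And>i. i \<in> I \<Longrightarrow> smooth_at x (f i)) \<Longrightarrow> smooth_at x (\<lambda>y. \<Sum>i\<in>I. f i y)"
  by (induction I rule: infinite_finite_induct) (simp_all add: smooth_at_const smooth_at_add)

lemma smooth_at_mult:
  fixes f g :: "'a::real_normed_vector \<Rightarrow> real"
  shows "smooth_at x f \<Longrightarrow> smooth_at x g \<Longrightarrow> smooth_at x (\<lambda>y. f y * g y)"
  by (rule smooth_at_bilinear[OF bounded_bilinear_mult])

lemma smooth_at_Pair: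
  fixes f :: "'a::real_normed_vector \<Rightarrow> 'b::real_normed_vector" and g :: "'a \<Rightarrow> 'c::real_normed_vector"
  assumes "smooth_at x f" "smooth_at x g" shows "smooth_at x (\<lambda>y. (f y, g y))"
proof -
  have "bounded_linear (\<lambda>a :: 'b. (a, 0 :: 'c))" "bounded_linear (\<lambda>b :: 'c. (0 :: 'b, b))"
    by (intro bounded_linear_Pair bounded_linear_ident bounded_linear_zero)+
  then have "smooth_at x (\<lambda>y. (f y, 0) + (0, g y))"
    by (intro smooth_at_add smooth_at_bounded_linear[OF _ assms(1)] smooth_at_bounded_linear[OF _ assms(2)])
  then show ?thesis by simp
qed

lemma smooth_at_compose:
  fixes f :: "'a::real_normed_vector \<Rightarrow> 'b::real_normed_vector" and g :: "'b \<Rightarrow> 'c::real_normed_vector"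
  assumes "finite_dim TYPE('b)" "smooth_at x f" "smooth_at (f x) g"
  shows "smooth_at x (\<lambda>y. g (f y))"
proof -
  obtain S where S: "open S" "x \<in> S" "smooth_on S f" using assms(2) unfolding smooth_at_def by blast
  obtain T where T: "open T" "f x \<in> T" "smooth_on T g" using assms(3) unfolding smooth_at_def by blast
  have "continuous_on S f" using S(3) unfolding smooth_on_def by (metis Ck_on.simps(1))
  then have op: "open (S \<inter> f -` T)" using S T by (simp add: continuous_open_preimage)
  have "Ck_on k (S \<inter> f -` T) (\<lambda>y. g (f y))" for k
    by (rule Ck_on_compose[OF assms(1) op T(1)])
      (use S(3) T(3) Ck_on_subset[of k S f "S \<inter> f -` T"] in \<open>auto simp: smooth_on_def\<close>)
  then show ?thesis unfolding smooth_at_def smooth_on_def using op S T by (intro exI[of _ "S \<inter> f -` T"]) auto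
qed

lemma frechet_derivative_chain:
  assumes "smooth_at x f" "smooth_at (f x) g"
  shows "frechet_derivative (\<lambda>y. g (f y)) (at x) v = frechet_derivative g (at (f x)) (frechet_derivative f (at x) v)"
  using frechet_derivative_eqI[OF has_derivative_compose[OF smooth_at_has_derivative[OF assms(1)] smooth_at_has_derivative[OF assms(2)]]]
  by simp

lemma frechet_derivative_cong_nhds:
  assumes "smooth_at x f" "eventually (\<lambda>y. f y = g y) (nhds x)"
  shows "frechet_derivative g (at x) = frechet_derivative f (at x)"
proof -
  obtain T where T: "open T" "x \<in> T" "\<And>y. y \<in> T \<Longrightarrow> f y = g y" using assms(2) by (auto simp: eventually_nhds)
  show ?thesis
    by (rule frechet_derivative_cong_open(2)[OF T(1,2)]) (use T smooth_at_imp_differentiable[OF assms(1)] in auto)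
qed

lemma linear_frechet_derivative_smooth: "smooth_at x f \<Longrightarrow> linear (frechet_derivative f (at x))"
  by (intro linear_frechet_derivative smooth_at_imp_differentiable)

subsection \<open>Charts\<close>

lemma smooth_manifold_finite_dim:
  "smooth_manifold (M :: ('m, 'v::real_normed_vector) manifold) \<Longrightarrow> finite_dim TYPE('v)"
  by (simp add: smooth_manifold_def finite_dim_def)

locale mfd =
  fixes M :: "('m, 'v::real_normed_vector) manifold"
  assumes mfd: "smooth_manifold M"
begin

lemma finite_dim: "finite_dim TYPE('v)"
  by (rule smooth_manifold_finite_dim[OF mfd])

lemma chart_open: "c \<in> atlas M \<Longrightarrow> openin (mtop M) (fst c)"
  using mfd unfolding smooth_manifold_def by blast

lemma chart_subset: "c \<in> atlas M \<Longrightarrow> fst c \<subseteq> points M"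
  using chart_open openin_subset by blast

lemma chart_homeo:
  "c \<in> atlas M \<Longrightarrow> homeomorphic_map (subtopology (mtop M) (fst c)) (top_of_set (snd c ` fst c)) (snd c)"
  "c \<in> atlas M \<Longrightarrow> open (snd c ` fst c)"
  using mfd unfolding smooth_manifold_def by blast+

lemma chart_transition:
  "c \<in> atlas M \<Longrightarrow> d \<in> atlas M \<Longrightarrow> smooth_on (snd c ` (fst c \<inter> fst d)) (snd d \<circ> chart_inv c)"
  using mfd unfolding smooth_manifold_def by blast

lemma chart_inj: assumes "c \<in> atlas M" shows "inj_on (snd c) (fst c)"
  using homeomorphic_imp_injective_map[OF chart_homeo(1)[OF assms]] chart_subset[OF assms]
  by (simp add: Int_absorb1)

lemma chart_inv_coord: "c \<in> atlas M \<Longrightarrow> p \<in> fst c \<Longrightarrow> chart_inv c (snd c p) = p"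
  by (simp add: chart_inv_def chart_inj)

lemma chart_inv_in: "c \<in> atlas M \<Longrightarrow> x \<in> snd c ` fst c \<Longrightarrow> chart_inv c x \<in> fst c"
  by (simp add: chart_inv_def inv_into_into)

lemma coord_chart_inv: "x \<in> snd c ` fst c \<Longrightarrow> snd c (chart_inv c x) = x"
  by (simp add: chart_inv_def f_inv_into_f)

lemma chart_image_open:
  assumes c: "c \<in> atlas M" and U: "openin (mtop M) U"
  shows "open (snd c ` (fst c \<inter> U))"
proof -
  have "openin (subtopology (mtop M) (fst c)) (fst c \<inter> U)"
    using U by (metis Int_commute openin_subtopology_Int)
  then have "openin (top_of_set (snd c ` fst c)) (snd c ` (fst c \<inter> U))"
    using homeomorphic_map_openness[OF chart_homeo(1)[OF c], of "fst c \<inter> U"] openin_subset by blast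
  then show ?thesis using chart_homeo(2)[OF c] openin_open_trans by blast
qed

lemma chart_at: assumes "p \<in> points M" shows "chart_at M p \<in> atlas M" "p \<in> fst (chart_at M p)"
proof -
  have "\<exists>c. c \<in> atlas M \<and> p \<in> fst c" using mfd assms unfolding smooth_manifold_def by blast
  from someI_ex[OF this] show "chart_at M p \<in> atlas M" "p \<in> fst (chart_at M p)"
    by (simp_all add: chart_at_def)
qed

lemma coord_at: "p \<in> points M \<Longrightarrow> chart_inv (chart_at M p) (coord_at M p) = p"
  by (simp add: coord_at_def chart_inv_coord chart_at)

lemma coord_at_in: "p \<in> points M \<Longrightarrow> coord_at M p \<in> snd (chart_at M p) ` fst (chart_at M p)"
  by (simp add: coord_at_def chart_at)

end

subsection \<open>Smooth maps from a normed space into a manifold\<close>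

text \<open>Maps out of a normed space need charts on the target only. Points, curves, chart
  inverses and their images under group operations are all treated as such maps.\<close>

definition smooth_into ::
  "('n, 'w::real_normed_vector) manifold \<Rightarrow> ('a::real_normed_vector \<Rightarrow> 'n) \<Rightarrow> 'a \<Rightarrow> bool" where
  "smooth_into N F x \<longleftrightarrow> F x \<in> points N \<and> (\<forall>d\<in>atlas N. F x \<in> fst d \<longrightarrow>
     (\<forall>\<^sub>F y in nhds x. F y \<in> fst d) \<and> smooth_at x (\<lambda>y. snd d (F y)))"

text \<open>The velocity, in the identification of tangent spaces with the model space.\<close>

definition vel ::
  "('n, 'w::real_normed_vector) manifold \<Rightarrow> ('a::real_normed_vector \<Rightarrow> 'n) \<Rightarrow> 'a \<Rightarrow> 'a \<Rightarrow> 'w" where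
  "vel N F x = frechet_derivative (\<lambda>y. snd (chart_at N (F x)) (F y)) (at x)"

lemma smooth_into_points: "smooth_into N F x \<Longrightarrow> F x \<in> points N"
  by (simp add: smooth_into_def)

lemma smooth_intoD:
  assumes "smooth_into N F x" "d \<in> atlas N" "F x \<in> fst d"
  shows "\<forall>\<^sub>F y in nhds x. F y \<in> fst d" "smooth_at x (\<lambda>y. snd d (F y))"
  using assms by (auto simp: smooth_into_def)

lemma eventually_compose_isCont:
  assumes "isCont h x" "\<forall>\<^sub>F y in nhds (h x). Q y"
  shows "\<forall>\<^sub>F y in nhds x. Q (h y)"
proof -
  have "(h \<longlongrightarrow> h x) (nhds x)" using assms(1) unfolding isCont_def tendsto_at_iff_tendsto_nhds .
  then show ?thesis using assms(2) unfolding filterlim_iff by blast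
qed

lemma smooth_into_cong:
  assumes "smooth_into N F x" "\<forall>\<^sub>F y in nhds x. F y = G y"
  shows "smooth_into N G x"
proof -
  have x: "F x = G x" using eventually_nhds_x_imp_x[OF assms(2)] .
  have "(\<forall>\<^sub>F y in nhds x. G y \<in> fst d) \<and> smooth_at x (\<lambda>y. snd d (G y))" if "d \<in> atlas N" "G x \<in> fst d" for d
  proof
    have d: "F x \<in> fst d" using that x by simp
    show "\<forall>\<^sub>F y in nhds x. G y \<in> fst d"
      using smooth_intoD(1)[OF assms(1) that(1) d] assms(2) by eventually_elim simp
    show "smooth_at x (\<lambda>y. snd d (G y))"
      by (rule smooth_at_cong[OF smooth_intoD(2)[OF assms(1) that(1) d]])
        (use assms(2) in eventually_elim, simp)
  qed
  then show "smooth_into N G x" using assms(1) x by (simp add: smooth_into_def)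
qed

lemma smooth_into_const: "p \<in> points N \<Longrightarrow> smooth_into N (\<lambda>y. p) x"
  by (simp add: smooth_into_def smooth_at_const)

lemma smooth_into_compose:
  fixes h :: "'a::real_normed_vector \<Rightarrow> 'b::real_normed_vector"
  assumes "finite_dim TYPE('b)" "smooth_at x h" "smooth_into N F (h x)"
  shows "smooth_into N (\<lambda>y. F (h y)) x"
  unfolding smooth_into_def
proof (intro conjI ballI impI)
  fix d assume d: "d \<in> atlas N" "F (h x) \<in> fst d"
  show "\<forall>\<^sub>F y in nhds x. F (h y) \<in> fst d"
    by (rule eventually_compose_isCont[OF smooth_at_imp_isCont[OF assms(2)] smooth_intoD(1)[OF assms(3) d]])
  show "smooth_at x (\<lambda>y. snd d (F (h y)))"
    by (rule smooth_at_compose[OF assms(1,2) smooth_intoD(2)[OF assms(3) d]])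
qed (rule smooth_into_points[OF assms(3)])

context mfd
begin

lemma vel_cong:
  assumes "smooth_into M F x" "\<forall>\<^sub>F y in nhds x. F y = G y"
  shows "vel M G x = vel M F x"
proof -
  have x: "F x = G x" using eventually_nhds_x_imp_x[OF assms(2)] .
  have "smooth_at x (\<lambda>y. snd (chart_at M (F x)) (F y))"
    by (rule smooth_intoD(2)[OF assms(1)]) (use smooth_into_points[OF assms(1)] chart_at in auto)
  then show ?thesis unfolding vel_def x[symmetric]
    by (rule frechet_derivative_cong_nhds) (use assms(2) in eventually_elim, simp)
qed

lemma smooth_at_coord:
  assumes "smooth_into M F x"
  shows "smooth_at x (\<lambda>y. snd (chart_at M (F x)) (F y))" "\<forall>\<^sub>F y in nhds x. F y \<in> fst (chart_at M (F x))"
  using smooth_intoD[OF assms] chart_at smooth_into_points[OF assms] by blast+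

lemma smooth_into_eventually:
  assumes F: "smooth_into M F x" and U: "openin (mtop M) U" "F x \<in> U"
  shows "\<forall>\<^sub>F y in nhds x. F y \<in> U"
proof -
  let ?c = "chart_at M (F x)"
  have c: "?c \<in> atlas M" "F x \<in> fst ?c" using chart_at smooth_into_points[OF F] by auto
  have "\<forall>\<^sub>F z in nhds (snd ?c (F x)). z \<in> snd ?c ` (fst ?c \<inter> U)"
    using chart_image_open[OF c(1) U(1)] c U by (intro eventually_nhds_in_open) auto
  then have "\<forall>\<^sub>F y in nhds x. snd ?c (F y) \<in> snd ?c ` (fst ?c \<inter> U)"
    by (rule eventually_compose_isCont[OF smooth_at_imp_isCont[OF smooth_at_coord(1)[OF F]], rotated])
  with smooth_at_coord(2)[OF F] show ?thesis
  proof eventually_elim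
    case (elim y)
    then obtain p where "p \<in> fst ?c" "p \<in> U" "snd ?c (F y) = snd ?c p" by auto
    then show ?case using chart_inj[OF c(1)] elim(1) by (metis inj_onD)
  qed
qed

text \<open>One chart is enough: near x the map stays in the overlap with any other chart, and there
  the transition map is smooth.\<close>

lemma smooth_intoI:
  assumes d: "d \<in> atlas M" "F x \<in> fst d" and ev: "\<forall>\<^sub>F y in nhds x. F y \<in> fst d"
    and sm: "smooth_at x (\<lambda>y. snd d (F y))"
  shows "smooth_into M F x"
  unfolding smooth_into_def
proof (intro conjI ballI impI)
  show "F x \<in> points M" using chart_subset[OF d(1)] d(2) by blast
  fix e assume e: "e \<in> atlas M" "F x \<in> fst e"
  let ?S = "snd d ` (fst d \<inter> fst e)"
  have S: "open ?S" by (rule chart_image_open[OF d(1) chart_open[OF e(1)]])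
  have xS: "snd d (F x) \<in> ?S" using d e by auto
  have "\<forall>\<^sub>F y in nhds x. snd d (F y) \<in> ?S"
    by (rule eventually_compose_isCont[OF smooth_at_imp_isCont[OF sm]]) (rule eventually_nhds_in_open[OF S xS])
  then show in_e: "\<forall>\<^sub>F y in nhds x. F y \<in> fst e"
    using ev
  proof eventually_elim
    case (elim y)
    then obtain p where "p \<in> fst d" "p \<in> fst e" "snd d (F y) = snd d p" by auto
    then show ?case using chart_inj[OF d(1)] elim(2) by (metis inj_onD)
  qed
  have "smooth_at (snd d (F x)) (snd e \<circ> chart_inv d)"
    by (rule smooth_on_imp_smooth_at[OF chart_transition[OF d(1) e(1)] S order_refl xS])
  then have "smooth_at x (\<lambda>y. (snd e \<circ> chart_inv d) (snd d (F y)))"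
    by (rule smooth_at_compose[OF finite_dim sm])
  then show "smooth_at x (\<lambda>y. snd e (F y))"
    by (rule smooth_at_cong) (use ev in eventually_elim, simp add: chart_inv_coord[OF d(1)])
qed

lemma smooth_into_chart_inv:
  assumes c: "c \<in> atlas M" and x: "x \<in> snd c ` fst c"
  shows "smooth_into M (chart_inv c) x"
proof (rule smooth_intoI[where d=c])
  show "c \<in> atlas M" "chart_inv c x \<in> fst c" using c x chart_inv_in by auto
  have ev: "\<forall>\<^sub>F y in nhds x. y \<in> snd c ` fst c"
    by (rule eventually_nhds_in_open[OF chart_homeo(2)[OF c] x])
  then show "\<forall>\<^sub>F y in nhds x. chart_inv c y \<in> fst c" by eventually_elim (rule chart_inv_in[OF c])
  show "smooth_at x (\<lambda>y. snd c (chart_inv c y))"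
    by (rule smooth_at_cong[OF smooth_at_id]) (use ev in eventually_elim, simp add: coord_chart_inv)
qed

lemma vel_linear: "smooth_into M F x \<Longrightarrow> linear (vel M F x)"
  unfolding vel_def by (intro linear_frechet_derivative_smooth smooth_at_coord)

lemma vel_compose:
  fixes h :: "'a::real_normed_vector \<Rightarrow> 'b::real_normed_vector"
  assumes "smooth_at x h" "smooth_into M F (h x)"
  shows "vel M (\<lambda>y. F (h y)) x v = vel M F (h x) (frechet_derivative h (at x) v)"
  unfolding vel_def by (rule frechet_derivative_chain[OF assms(1) smooth_at_coord(1)[OF assms(2)]])

text \<open>Linearity applied to (v, v) = (v, 0) + (0, v). For the group multiplication this is the
  product rule.\<close>

lemma vel_diagonal:
  fixes F :: "'a::real_normed_vector \<times> 'a \<Rightarrow> 'm"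
  assumes F: "smooth_into M F (x, x)"
  shows "vel M (\<lambda>y. F (y, y)) x v = vel M (\<lambda>y. F (y, x)) x v + vel M (\<lambda>y. F (x, y)) x v"
proof -
  have d: "((\<lambda>y :: 'a. (y, y)) has_derivative (\<lambda>v. (v, v))) (at x)" "((\<lambda>y :: 'a. (y, x)) has_derivative (\<lambda>v. (v, 0))) (at x)"
    "((\<lambda>y :: 'a. (x, y)) has_derivative (\<lambda>v. (0, v))) (at x)"
    by (auto intro!: derivative_eq_intros)
  have s: "smooth_at x (\<lambda>y :: 'a. (y, y))" "smooth_at x (\<lambda>y :: 'a. (y, x))" "smooth_at x (\<lambda>y :: 'a. (x, y))"
    by (intro smooth_at_Pair smooth_at_id smooth_at_const)+
  have "vel M (\<lambda>y. F (y, y)) x v = vel M F (x, x) (v, v)"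
    using vel_compose[OF s(1) F] by (simp add: frechet_derivative_eqI[OF d(1)])
  also have "\<dots> = vel M F (x, x) (v, 0) + vel M F (x, x) (0, v)"
    by (simp add: linear_add[OF vel_linear[OF F], symmetric])
  also have "vel M F (x, x) (v, 0) = vel M (\<lambda>y. F (y, x)) x v"
    using vel_compose[OF s(2) F] by (simp add: frechet_derivative_eqI[OF d(2)])
  also have "vel M F (x, x) (0, v) = vel M (\<lambda>y. F (x, y)) x v"
    using vel_compose[OF s(3) F] by (simp add: frechet_derivative_eqI[OF d(3)])
  finally show ?thesis .
qed

text \<open>Every tangent vector is thereby a velocity, so that identities between tangent maps may
  be checked on velocities.\<close>

lemma vel_chart_inv_coord_at:
  assumes "p \<in> points M"
  shows "vel M (chart_inv (chart_at M p)) (coord_at M p) v = v"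
proof -
  let ?c = "chart_at M p"
  have "\<forall>\<^sub>F y in nhds (coord_at M p). y \<in> snd ?c ` fst ?c"
    by (intro eventually_nhds_in_open chart_homeo(2) chart_at coord_at_in assms)
  then have "\<forall>\<^sub>F y in nhds (coord_at M p). y = snd ?c (chart_inv ?c y)"
    by eventually_elim (simp add: coord_chart_inv)
  from frechet_derivative_cong_nhds[OF smooth_at_id this]
  show ?thesis by (simp add: vel_def coord_at[OF assms] frechet_derivative_eqI[OF has_derivative_ident])
qed

end

subsection \<open>Smooth maps between manifolds\<close>

text \<open>A pointwise form of smoothness that suffices for the chain rule and is easy to verify
  for composites such as translations and conjugations.\<close>

definition msmooth :: "('m, 'v::real_normed_vector) manifold \<Rightarrow> ('n, 'w::real_normed_vector) manifold \<Rightarrow> ('m \<Rightarrow> 'n) \<Rightarrow> bool" where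
  "msmooth M N f \<longleftrightarrow> (\<forall>p\<in>points M. smooth_into N (\<lambda>x. f (chart_inv (chart_at M p) x)) (coord_at M p))"

lemma tangent_map_vel:
  assumes "smooth_manifold M" "p \<in> points M"
  shows "tangent_map M N f p v = vel N (\<lambda>x. f (chart_inv (chart_at M p) x)) (coord_at M p) v"
proof -
  interpret mfd M by unfold_locales (rule assms(1))
  show ?thesis by (simp add: tangent_map_def vel_def coord_rep_def o_def coord_at[OF assms(2)])
qed

context mfd
begin

lemma coord_repr:
  assumes F: "smooth_into M F x"
  shows "\<forall>\<^sub>F y in nhds x. chart_inv (chart_at M (F x)) (snd (chart_at M (F x)) (F y)) = F y"
  using smooth_at_coord(2)[OF F]
  by eventually_elim (rule chart_inv_coord[OF chart_at(1)[OF smooth_into_points[OF F]]])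

lemma msmooth_into:
  assumes f: "msmooth M N f" and F: "smooth_into M F x"
  shows "smooth_into N (\<lambda>y. f (F y)) x"
proof -
  let ?c = "chart_at M (F x)"
  have "smooth_into N (\<lambda>z. f (chart_inv ?c z)) (snd ?c (F x))"
    using f smooth_into_points[OF F] by (simp add: msmooth_def coord_at_def)
  then have "smooth_into N (\<lambda>y. f (chart_inv ?c (snd ?c (F y)))) x"
    by (rule smooth_into_compose[OF finite_dim smooth_at_coord(1)[OF F]])
  then show ?thesis by (rule smooth_into_cong) (use coord_repr[OF F] in eventually_elim, simp)
qed

lemma vel_msmooth:
  assumes N: "smooth_manifold N" and f: "msmooth M N f" and F: "smooth_into M F x"
  shows "vel N (\<lambda>y. f (F y)) x v = tangent_map M N f (F x) (vel M F x v)"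
proof -
  interpret N: mfd N by unfold_locales (rule N)
  let ?c = "chart_at M (F x)"
  have s: "smooth_into N (\<lambda>z. f (chart_inv ?c z)) (snd ?c (F x))"
    using f smooth_into_points[OF F] by (simp add: msmooth_def coord_at_def)
  have s': "smooth_into N (\<lambda>y. f (chart_inv ?c (snd ?c (F y)))) x"
    by (rule smooth_into_compose[OF finite_dim smooth_at_coord(1)[OF F] s])
  have "vel N (\<lambda>y. f (F y)) x v = vel N (\<lambda>y. f (chart_inv ?c (snd ?c (F y)))) x v"
    by (subst N.vel_cong[OF s', of "\<lambda>y. f (F y)"]) (use coord_repr[OF F] in \<open>auto elim!: eventually_mono\<close>)
  also have "\<dots> = vel N (\<lambda>z. f (chart_inv ?c z)) (snd ?c (F x)) (vel M F x v)"
    using N.vel_compose[OF smooth_at_coord(1)[OF F] s] by (simp add: vel_def)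
  also have "\<dots> = tangent_map M N f (F x) (vel M F x v)"
    by (simp add: tangent_map_vel[OF mfd smooth_into_points[OF F]] coord_at_def)
  finally show ?thesis .
qed

lemma tangent_map_linear:
  assumes "smooth_manifold N" "msmooth M N f" "p \<in> points M"
  shows "linear (tangent_map M N f p)"
proof -
  interpret N: mfd N by unfold_locales (rule assms)
  have "linear (vel N (\<lambda>x. f (chart_inv (chart_at M p) x)) (coord_at M p))"
    using assms by (intro N.vel_linear) (simp add: msmooth_def)
  moreover have "tangent_map M N f p = vel N (\<lambda>x. f (chart_inv (chart_at M p) x)) (coord_at M p)"
    by (rule ext) (rule tangent_map_vel[OF mfd assms(3)])
  ultimately show ?thesis by simp
qed

lemma smooth_map_into:
  assumes N: "\<And>d. d \<in> atlas N \<Longrightarrow> openin (mtop N) (fst d)"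
    and f: "smooth_map M N f" and F: "smooth_into M F x"
  shows "smooth_into N (\<lambda>y. f (F y)) x"
  unfolding smooth_into_def
proof (intro conjI ballI impI)
  have cont: "continuous_map (mtop M) (mtop N) f" using f by (simp add: smooth_map_def)
  then show "f (F x) \<in> points N" using smooth_into_points[OF F] continuous_map_image_subset_topspace by blast
  fix d assume d: "d \<in> atlas N" "f (F x) \<in> fst d"
  let ?c = "chart_at M (F x)" and ?W = "{p \<in> points M. f p \<in> fst d}"
  have c: "?c \<in> atlas M" "F x \<in> fst ?c" using chart_at smooth_into_points[OF F] by auto
  have W: "openin (mtop M) ?W" by (rule openin_continuous_map_preimage[OF cont N[OF d(1)]])
  have xW: "F x \<in> ?W" using d smooth_into_points[OF F] by simp
  show "\<forall>\<^sub>F y in nhds x. f (F y) \<in> fst d"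
    using smooth_into_eventually[OF F W xW] by eventually_elim simp
  have "fst ?c \<inter> f -` fst d = fst ?c \<inter> ?W" using chart_subset[OF c(1)] by auto
  then have "smooth_on (snd ?c ` (fst ?c \<inter> ?W)) (coord_rep ?c d f)"
    using f c d unfolding smooth_map_def by metis
  then have "smooth_at (snd ?c (F x)) (coord_rep ?c d f)"
    by (rule smooth_on_imp_smooth_at[OF _ chart_image_open[OF c(1) W] order_refl]) (use c xW in auto)
  then have "smooth_at x (\<lambda>y. coord_rep ?c d f (snd ?c (F y)))"
    by (rule smooth_at_compose[OF finite_dim smooth_at_coord(1)[OF F]])
  then show "smooth_at x (\<lambda>y. snd d (f (F y)))"
    by (rule smooth_at_cong) (use coord_repr[OF F] in eventually_elim, simp add: coord_rep_def)
qed

lemma smooth_map_msmooth: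
  assumes "smooth_manifold N" "smooth_map M N f"
  shows "msmooth M N f"
proof -
  interpret N: mfd N by unfold_locales (rule assms)
  show ?thesis unfolding msmooth_def
    by (intro ballI smooth_map_into[OF N.chart_open assms(2)] smooth_into_chart_inv chart_at coord_at_in)
qed

end

text \<open>The argument uses a product of two charts around the two values directly, without
  treating the product as a manifold in its own right.\<close>

lemma smooth_map2_into:
  fixes F :: "'a::real_normed_vector \<Rightarrow> 'm" and M :: "('m, 'v::real_normed_vector) manifold"
    and N :: "('n, 'w::real_normed_vector) manifold" and P :: "('p, 'u::real_normed_vector) manifold"
  assumes M: "smooth_manifold M" and N: "smooth_manifold N" and P: "smooth_manifold P"
    and f: "smooth_map (prod_manifold M N) P f" and F: "smooth_into M F x" and H: "smooth_into N H x"
  shows "smooth_into P (\<lambda>y. f (F y, H y)) x"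
  unfolding smooth_into_def
proof (intro conjI ballI impI)
  interpret M: mfd M by unfold_locales (rule M)
  interpret N: mfd N by unfold_locales (rule N)
  interpret P: mfd P by unfold_locales (rule P)
  have cont: "continuous_map (prod_topology (mtop M) (mtop N)) (mtop P) f"
    using f by (simp add: smooth_map_def prod_manifold_def)
  have pts: "F x \<in> points M" "H x \<in> points N" using F H smooth_into_points by auto
  then show "f (F x, H x) \<in> points P" using cont continuous_map_image_subset_topspace by fastforce
  fix e assume e: "e \<in> atlas P" "f (F x, H x) \<in> fst e"
  let ?c = "chart_at M (F x)" and ?d = "chart_at N (H x)"
  let ?cd = "(fst ?c \<times> fst ?d, map_prod (snd ?c) (snd ?d))"
  have c: "?c \<in> atlas M" "F x \<in> fst ?c" and d: "?d \<in> atlas N" "H x \<in> fst ?d"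
    using M.chart_at N.chart_at pts by auto
  have "openin (prod_topology (mtop M) (mtop N)) {z \<in> topspace (prod_topology (mtop M) (mtop N)). f z \<in> fst e}"
    by (rule openin_continuous_map_preimage[OF cont P.chart_open[OF e(1)]])
  moreover have "(F x, H x) \<in> {z \<in> topspace (prod_topology (mtop M) (mtop N)). f z \<in> fst e}" using pts e by simp
  ultimately obtain U V where UV: "openin (mtop M) U" "openin (mtop N) V" "F x \<in> U" "H x \<in> V"
    "U \<times> V \<subseteq> {z \<in> topspace (prod_topology (mtop M) (mtop N)). f z \<in> fst e}"
    unfolding openin_prod_topology_alt by meson
  show "\<forall>\<^sub>F y in nhds x. f (F y, H y) \<in> fst e"
    using M.smooth_into_eventually[OF F UV(1,3)] N.smooth_into_eventually[OF H UV(2,4)]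
    by eventually_elim (use UV(5) in auto)
  let ?S = "snd ?c ` (fst ?c \<inter> U) \<times> snd ?d ` (fst ?d \<inter> V)"
  have S: "open ?S" by (intro open_Times M.chart_image_open N.chart_image_open c d UV)
  have "?cd \<in> {(fst c \<times> fst d, map_prod (snd c) (snd d)) |c d. c \<in> atlas M \<and> d \<in> atlas N}" using c d by blast
  then have "?cd \<in> atlas (prod_manifold M N)" by (simp only: prod_manifold_def manifold.simps)
  then have "smooth_on (snd ?cd ` (fst ?cd \<inter> f -` fst e)) (coord_rep ?cd e f)"
    using f e unfolding smooth_map_def by blast
  moreover have "?S \<subseteq> snd ?cd ` (fst ?cd \<inter> f -` fst e)"
  proof
    fix z assume "z \<in> ?S"
    then obtain p q where "p \<in> fst ?c" "p \<in> U" "q \<in> fst ?d" "q \<in> V" "z = (snd ?c p, snd ?d q)" by auto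
    moreover from this have "f (p, q) \<in> fst e" using UV(5) by auto
    ultimately show "z \<in> snd ?cd ` (fst ?cd \<inter> f -` fst e)" by (intro image_eqI[of _ _ "(p, q)"]) auto
  qed
  ultimately have "smooth_at (snd ?c (F x), snd ?d (H x)) (coord_rep ?cd e f)"
    by (rule smooth_on_imp_smooth_at[OF _ S]) (use c d UV in auto)
  then have "smooth_at x (\<lambda>y. coord_rep ?cd e f (snd ?c (F y), snd ?d (H y)))"
    by (rule smooth_at_compose[OF finite_dim_prod[OF M.finite_dim N.finite_dim]
          smooth_at_Pair[OF M.smooth_at_coord(1)[OF F] N.smooth_at_coord(1)[OF H]]])
  then show "smooth_at x (\<lambda>y. snd e (f (F y, H y)))"
  proof (rule smooth_at_cong)
    have inj: "inj_on (map_prod (snd ?c) (snd ?d)) (fst ?c \<times> fst ?d)"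
      using M.chart_inj[OF c(1)] N.chart_inj[OF d(1)] by (rule map_prod_inj_on)
    show "\<forall>\<^sub>F y in nhds x. coord_rep ?cd e f (snd ?c (F y), snd ?d (H y)) = snd e (f (F y, H y))"
      using M.smooth_at_coord(2)[OF F] N.smooth_at_coord(2)[OF H]
    proof eventually_elim
      case (elim y)
      then have "chart_inv ?cd (map_prod (snd ?c) (snd ?d) (F y, H y)) = (F y, H y)"
        unfolding chart_inv_def fst_conv snd_conv by (intro inv_into_f_f[OF inj]) simp
      then show ?case by (simp add: coord_rep_def)
    qed
  qed
qed

subsection \<open>Curves and real-valued functions\<close>

lemma chart_at_real_line [simp]: "chart_at real_line t = (UNIV, id)"
  unfolding chart_at_def by (rule some_equality) (auto simp: real_line_def)

lemma chart_inv_id [simp]: "chart_inv (UNIV, id) = id"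
  unfolding chart_inv_def by (auto simp: fun_eq_iff)

lemma coord_at_real_line [simp]: "coord_at real_line t = t"
  by (simp add: coord_at_def)

lemma tangent_map_real_line: "tangent_map real_line M \<gamma> t = vel M \<gamma> t"
  by (simp add: tangent_map_def vel_def coord_rep_def o_def)

lemma smooth_manifold_real_line: "smooth_manifold real_line"
  unfolding smooth_manifold_def
proof (intro conjI)
  show "\<exists>B :: real set. finite B \<and> span B = UNIV" using finite_dim_real by (simp add: finite_dim_def)
  show "Hausdorff_space (mtop real_line)" by (simp add: real_line_def)
  obtain B :: "real set set" where B: "countable B" "topological_basis B" using ex_countable_basis by blast
  have "\<exists>V\<in>B. x \<in> V \<and> V \<subseteq> U" if "open U" "x \<in> U" for U x
    by (rule topological_basisE[OF B(2) that]) blast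
  then show "second_countable (mtop real_line)"
    using B(1) topological_basis_open[OF B(2)] unfolding real_line_def second_countable_def by (intro exI[of _ B]) simp
qed (auto simp: real_line_def smooth_on_def Ck_on_id[folded id_def])

lemma smooth_into_real_line: "smooth_into real_line f x \<longleftrightarrow> smooth_at x f"
  by (simp add: smooth_into_def real_line_def)

context mfd
begin

lemma smooth_map_real_line_iff: "smooth_map real_line M \<gamma> \<longleftrightarrow> (\<forall>t. smooth_into M \<gamma> t)"
proof
  interpret R: mfd real_line by unfold_locales (rule smooth_manifold_real_line)
  assume "smooth_map real_line M \<gamma>"
  then have "smooth_into M (\<lambda>y. \<gamma> y) t" for t
    using R.smooth_map_into[OF chart_open, of \<gamma> "\<lambda>y. y" t] by (simp add: smooth_into_real_line smooth_at_id)
  then show "\<forall>t. smooth_into M \<gamma> t" by simp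
next
  assume \<gamma>: "\<forall>t. smooth_into M \<gamma> t"
  show "smooth_map real_line M \<gamma>"
    unfolding smooth_map_def
  proof (intro conjI ballI)
    have "open {t. \<gamma> t \<in> U}" if U: "openin (mtop M) U" for U
    proof (subst open_subopen, safe)
      fix t assume "\<gamma> t \<in> U"
      then have "\<forall>\<^sub>F s in nhds t. \<gamma> s \<in> U" using \<gamma> smooth_into_eventually U by blast
      then show "\<exists>T. open T \<and> t \<in> T \<and> T \<subseteq> {t. \<gamma> t \<in> U}" unfolding eventually_nhds by blast
    qed
    then show "continuous_map (mtop real_line) (mtop M) \<gamma>"
      using \<gamma> smooth_into_points[of M \<gamma>] by (auto simp: continuous_map_def real_line_def)
    fix c d assume c: "c \<in> atlas real_line" and d: "d \<in> atlas M"
    then have c: "c = (UNIV, id)" by (simp add: real_line_def)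
    show "smooth_on (snd c ` (fst c \<inter> \<gamma> -` fst d)) (coord_rep c d \<gamma>)"
      by (rule smooth_onI) (use \<gamma> smooth_intoD(2)[OF _ d] in \<open>auto simp: c coord_rep_def o_def\<close>)
  qed
qed

end

subsection \<open>Ordinary differential equations\<close>

lemma vector_derivative_bound:
  fixes f :: "real \<Rightarrow> 'b::real_normed_vector"
  assumes "\<And>t. t \<in> {a..b} \<Longrightarrow> (f has_vector_derivative f' t) (at t within {a..b})"
    and "\<And>t. t \<in> {a..b} \<Longrightarrow> norm (f' t) \<le> B" and "s \<in> {a..b}" "t \<in> {a..b}"
  shows "norm (f t - f s) \<le> B * \<bar>t - s\<bar>"
proof -
  have "norm (f t - f s) \<le> B * norm (t - s)"
  proof (rule differentiable_bound[of "{a..b}" f "\<lambda>x h. h *\<^sub>R f' x"])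
    show "(f has_derivative (\<lambda>h. h *\<^sub>R f' x)) (at x within {a..b})" if "x \<in> {a..b}" for x
      using assms(1)[OF that] by (simp add: has_vector_derivative_def)
    show "onorm (\<lambda>h. h *\<^sub>R f' x) \<le> B" if "x \<in> {a..b}" for x
      by (rule onorm_le) (use mult_left_mono[OF assms(2)[OF that] abs_ge_zero] in \<open>simp add: mult.commute\<close>)
  qed (use assms in auto)
  then show ?thesis by simp
qed

text \<open>The difference of two integrals from -d stands for the integral from 0 to t, for either
  sign of t.\<close>

lemma integral_operator_bound:
  fixes g :: "real \<Rightarrow> 'b::banach"
  assumes "d \<ge> 0" "continuous_on {-d..d} g" "\<And>t. t \<in> {-d..d} \<Longrightarrow> norm (g t) \<le> B" "t \<in> {-d..d}"
  shows "norm (integral {-d..t} g - integral {-d..0} g) \<le> B * d"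
proof -
  have "B \<ge> 0" using assms(3)[of 0] assms(1) by (meson atLeastAtMost_iff neg_le_0_iff_le norm_ge_zero order_trans)
  have "norm (integral {-d..t} g - integral {-d..0} g) \<le> B * \<bar>t - 0\<bar>"
    by (rule vector_derivative_bound[OF integral_has_vector_derivative[OF assms(2)] assms(3)]) (use assms in auto)
  also have "\<dots> \<le> B * d" using assms(4) \<open>B \<ge> 0\<close> by (intro mult_left_mono) auto
  finally show ?thesis .
qed

lemma picard:
  fixes F :: "'b::banach \<Rightarrow> 'b"
  assumes r: "r > 0" and K: "K \<ge> 0"
    and lip: "\<And>x y. x \<in> cball y0 r \<Longrightarrow> y \<in> cball y0 r \<Longrightarrow> norm (F x - F y) \<le> K * norm (x - y)"
  obtains d c where "d > 0" "c 0 = y0"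
    "\<And>t. \<bar>t\<bar> < d \<Longrightarrow> c t \<in> cball y0 r \<and> (c has_vector_derivative F (c t)) (at t)"
proof -
  define B where "B = norm (F y0) + K * r"
  \<comment> \<open>The first bound keeps the iterates in the ball, B d <= r; the second makes the
    integral operator a contraction with factor 1/2. Adding 1 keeps the denominators
    positive.\<close>
  define d where "d = min (r / (B + 1)) (1 / (2 * (K + 1)))"
  have B: "B \<ge> 0" using r K by (simp add: B_def)
  have d: "d > 0" using r K B by (simp add: d_def)
  have Bd: "B * d \<le> r"
  proof -
    have "B * d \<le> B * (r / (B + 1))" using B by (intro mult_left_mono) (simp_all add: d_def)
    also have "\<dots> \<le> r" using B r by (simp add: field_simps)
    finally show ?thesis .
  qed
  have Kd: "K * d \<le> 1 / 2"
  proof -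
    have "K * d \<le> K * (1 / (2 * (K + 1)))" using K by (intro mult_left_mono) (simp_all add: d_def)
    also have "\<dots> \<le> 1 / 2" using K by (simp add: field_simps)
    finally show ?thesis .
  qed
  have FB: "norm (F x) \<le> B" if "x \<in> cball y0 r" for x
  proof -
    have "norm (F x) \<le> norm (F y0) + norm (F x - F y0)" by (metis norm_triangle_sub)
    also have "norm (F x - F y0) \<le> K * norm (x - y0)" using that r by (intro lip) auto
    also have "K * norm (x - y0) \<le> K * r" using that K by (intro mult_left_mono) (auto simp: dist_norm norm_minus_commute)
    finally show ?thesis by (simp add: B_def)
  qed
  have Fcont: "continuous_on (cball y0 r) F"
    by (rule lipschitz_on_continuous_on[of K]) (use lip K in \<open>auto simp: lipschitz_on_def dist_norm\<close>)
  \<comment> \<open>Time is clamped to the interval, so that the operator acts on bounded continuous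
    functions on the whole line.\<close>
  define cl where "cl t = max (- d) (min d t)" for t :: real
  have cl: "cl t \<in> {-d..d}" for t using d by (auto simp: cl_def)
  have clc: "continuous_on UNIV cl" unfolding cl_def by (intro continuous_intros)
  define S :: "(real \<Rightarrow>\<^sub>C 'b) set" where "S = PiC UNIV (\<lambda>_. cball y0 r)"
  have S: "apply_bcontfun f t \<in> cball y0 r" if "f \<in> S" for f t using that by (auto simp: S_def mem_PiC_iff)
  define G where "G f t = y0 + (integral {-d..cl t} (\<lambda>s. F (apply_bcontfun f s)) - integral {-d..0} (\<lambda>s. F (apply_bcontfun f s)))" for f t
  have gc: "continuous_on A (\<lambda>s. F (apply_bcontfun f s))" if "f \<in> S" for f A
    by (rule continuous_on_compose2[OF Fcont]) (use S[OF that] in auto)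
  have Gb: "norm (G f t - y0) \<le> r" if "f \<in> S" for f t
    using integral_operator_bound[OF _ gc[OF that] FB[OF S[OF that]] cl[of t]] Bd d by (simp add: G_def)
  have Gc: "continuous_on UNIV (G f)" if f: "f \<in> S" for f
  proof -
    have "continuous_on {-d..d} (\<lambda>t. integral {-d..t} (\<lambda>s. F (apply_bcontfun f s)))"
      unfolding continuous_on_eq_continuous_within
      using integral_has_vector_derivative[OF gc[OF f]] has_vector_derivative_continuous by blast
    then have "continuous_on UNIV (\<lambda>t. integral {-d..cl t} (\<lambda>s. F (apply_bcontfun f s)))"
      by (rule continuous_on_compose2[OF _ clc]) (use cl in auto)
    then show ?thesis unfolding G_def by (intro continuous_intros)
  qed
  have Gin: "G f \<in> bcontfun" if "f \<in> S" for f
  proof (rule bcontfun_normI[OF Gc[OF that]])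
    show "norm (G f t) \<le> norm y0 + r" for t
      using Gb[OF that, of t] norm_triangle_sub[of "G f t" y0] by linarith
  qed
  define T where "T f = Bcontfun (G f)" for f
  have T: "apply_bcontfun (T f) = G f" if "f \<in> S" for f
    unfolding T_def by (rule Bcontfun_inverse[OF Gin[OF that]])
  have "\<exists>!f. f \<in> S \<and> T f = f"
  proof (rule Banach_fix)
    show "complete S" unfolding S_def complete_eq_closed by (rule closed_PiC) simp
    have "apply_bcontfun (const_bcontfun y0) t \<in> cball y0 r" for t using r by simp
    then have "const_bcontfun y0 \<in> S" unfolding S_def mem_PiC_iff by blast
    then show "S \<noteq> {}" by blast
    have "T f \<in> S" if f: "f \<in> S" for f
    proof -
      have "G f t \<in> cball y0 r" for t using Gb[OF f, of t] by (simp add: dist_norm norm_minus_commute)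
      then show ?thesis unfolding S_def mem_PiC_iff T[OF f] by blast
    qed
    then show "T ` S \<subseteq> S" by blast
    show "dist (T f) (T g) \<le> (1 / 2) * dist f g" if f: "f \<in> S" and g: "g \<in> S" for f g
    proof (rule dist_bound)
      fix t
      let ?h = "\<lambda>s. F (apply_bcontfun f s) - F (apply_bcontfun g s)"
      have hc: "continuous_on {-d..x} ?h" for x by (intro continuous_on_diff gc f g)
      have "integral {-d..x} ?h = integral {-d..x} (\<lambda>s. F (apply_bcontfun f s)) - integral {-d..x} (\<lambda>s. F (apply_bcontfun g s))" for x
        by (intro Henstock_Kurzweil_Integration.integral_diff integrable_continuous_real gc f g)
      then have "G f t - G g t = integral {-d..cl t} ?h - integral {-d..0} ?h" by (simp add: G_def)
      also have "norm \<dots> \<le> (K * dist f g) * d"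
      proof (rule integral_operator_bound[OF _ hc _ cl])
        show "norm (?h s) \<le> K * dist f g" for s
        proof -
          have "norm (?h s) \<le> K * norm (apply_bcontfun f s - apply_bcontfun g s)" by (intro lip S f g)
          also have "\<dots> \<le> K * dist f g"
            using dist_bounded[of f s g] K by (intro mult_left_mono) (simp_all add: dist_norm)
          finally show ?thesis .
        qed
      qed (use d in auto)
      also have "\<dots> = (K * d) * dist f g" by simp
      also have "\<dots> \<le> (1 / 2) * dist f g" using Kd by (intro mult_right_mono) auto
      finally show "dist (apply_bcontfun (T f) t) (apply_bcontfun (T g) t) \<le> (1 / 2) * dist f g"
        by (simp add: T f g dist_norm)
    qed
  qed simp_all
  then obtain f where f: "f \<in> S" "T f = f" by blast
  let ?c = "apply_bcontfun f"
  have c: "?c t = G f t" for t using T[OF f(1)] f(2) by simp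
  have "(?c has_vector_derivative F (?c t)) (at t)" if "\<bar>t\<bar> < d" for t
  proof -
    have t: "t \<in> {-d<..<d}" using that by auto
    have "((\<lambda>u. integral {-d..u} (\<lambda>s. F (?c s))) has_vector_derivative F (?c t)) (at t within {-d..d})"
      by (rule integral_has_vector_derivative[OF gc[OF f(1)]]) (use t in auto)
    then have "((\<lambda>u. integral {-d..u} (\<lambda>s. F (?c s))) has_vector_derivative F (?c t)) (at t)"
      using t by (subst (asm) at_within_interior) auto
    then have "((\<lambda>u. y0 + (integral {-d..u} (\<lambda>s. F (?c s)) - integral {-d..0} (\<lambda>s. F (?c s)))) has_vector_derivative F (?c t)) (at t)"
      by (auto intro!: derivative_eq_intros)
    then show ?thesis
    proof (rule has_vector_derivative_transform_within_open[where S="{-d<..<d}"])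
      show "y0 + (integral {-d..u} (\<lambda>s. F (?c s)) - integral {-d..0} (\<lambda>s. F (?c s))) = ?c u" if "u \<in> {-d<..<d}" for u
      proof -
        have "cl u = u" using that by (auto simp: cl_def)
        then show ?thesis by (simp add: c[of u] G_def)
      qed
    qed (use t in auto)
  qed
  moreover have "cl 0 = 0" using d by (simp add: cl_def)
  then have "?c 0 = y0" by (simp add: c[of 0] G_def)
  ultimately show ?thesis using that[OF d, of ?c] S[OF f(1)] by blast
qed

text \<open>On such a short interval the maximum of the distance between two solutions is at most
  half of itself.\<close>

lemma ode_unique:
  fixes X :: "'v::real_normed_vector \<Rightarrow> 'v"
  assumes lip: "\<And>x y. x \<in> S \<Longrightarrow> y \<in> S \<Longrightarrow> norm (X x - X y) \<le> K * norm (x - y)"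
    and e: "K \<ge> 0" "0 \<le> e" "K * e \<le> 1 / 2"
    and c: "\<And>t. t \<in> {-e..e} \<Longrightarrow> c t \<in> S \<and> (c has_vector_derivative X (c t)) (at t)"
    and b: "\<And>t. t \<in> {-e..e} \<Longrightarrow> b t \<in> S \<and> (b has_vector_derivative X (b t)) (at t)"
    and "c 0 = b 0" and t: "t \<in> {-e..e}"
  shows "c t = b t"
proof -
  let ?h = "\<lambda>t. c t - b t"
  have der: "(?h has_vector_derivative X (c t) - X (b t)) (at t within {-e..e})" if "t \<in> {-e..e}" for t
    using c[OF that] b[OF that] by (intro has_vector_derivative_at_within[OF has_vector_derivative_diff]) auto
  have "continuous_on {-e..e} (\<lambda>t. norm (?h t))"
    unfolding continuous_on_eq_continuous_within
    by (intro ballI continuous_norm has_vector_derivative_continuous[OF der])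
  then obtain u where u: "u \<in> {-e..e}" "\<And>s. s \<in> {-e..e} \<Longrightarrow> norm (?h s) \<le> norm (?h u)"
    using continuous_attains_sup[of "{-e..e}" "\<lambda>t. norm (?h t)"] t by auto
  have "norm (?h u - ?h 0) \<le> (K * norm (?h u)) * \<bar>u - 0\<bar>"
  proof (rule vector_derivative_bound[OF der])
    fix s assume s: "s \<in> {-e..e}"
    have "norm (X (c s) - X (b s)) \<le> K * norm (?h s)" using c[OF s] b[OF s] by (intro lip) auto
    also have "\<dots> \<le> K * norm (?h u)" using u(2)[OF s] e by (intro mult_left_mono)
    finally show "norm (X (c s) - X (b s)) \<le> K * norm (?h u)" .
  qed (use u e in auto)
  also have "\<dots> \<le> (K * norm (?h u)) * e" using u e by (intro mult_left_mono) auto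
  also have "\<dots> = (K * e) * norm (?h u)" by simp
  also have "\<dots> \<le> (1 / 2) * norm (?h u)" using e by (intro mult_right_mono) auto
  finally have "norm (?h u) = 0" using \<open>c 0 = b 0\<close> by simp
  then show ?thesis using u(2)[OF t] by simp
qed

section \<open>Differential equations in finite-dimensional normed spaces\<close>

lemma smooth_at_locally_lipschitz:
  fixes f :: "'a::real_normed_vector \<Rightarrow> 'b::real_normed_vector"
  assumes fd: "finite_dim TYPE('a)" and f: "smooth_at x0 f"
  obtains r K where "r > 0" "K \<ge> 0"
    "\<And>x y. x \<in> ball x0 r \<Longrightarrow> y \<in> ball x0 r \<Longrightarrow> norm (f x - f y) \<le> K * norm (x - y)"
proof -
  obtain B :: "'a set" where B: "finite B" "independent B" "span B = UNIV" by (rule finite_dim_basis[OF fd])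
  obtain c where c: "c > 0" "\<And>f. c * (\<Sum>b\<in>B. \<bar>f b\<bar>) \<le> norm (\<Sum>b\<in>B. f b *\<^sub>R b)"
    using finite_dim_norm_lower_bound[OF B(1,2)] by blast
  let ?D = "\<lambda>x. frechet_derivative f (at x)"
  \<comment> \<open>The derivatives along the basis vectors are continuous, so near x0 their norms
    exceed those at x0 by less than 1; M adds up these bounds.\<close>
  define M where "M = (\<Sum>b\<in>B. norm (?D x0 b) + 1)"
  have "M \<ge> 0" unfolding M_def by (intro sum_nonneg) auto
  have "\<forall>\<^sub>F x in nhds x0. norm (?D x b) < norm (?D x0 b) + 1" for b
  proof -
    have "isCont (\<lambda>x. norm (?D x b)) x0"
      by (intro continuous_norm smooth_at_imp_isCont smooth_at_derivative f)
    moreover have "\<forall>\<^sub>F y in nhds (norm (?D x0 b)). y < norm (?D x0 b) + 1"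
      by (rule order_tendstoD(2)[OF filterlim_ident]) simp
    ultimately show ?thesis by (rule eventually_compose_isCont)
  qed
  then have "\<forall>\<^sub>F x in nhds x0. (\<forall>b\<in>B. norm (?D x b) < norm (?D x0 b) + 1) \<and> smooth_at x f"
    using B(1) smooth_at_eventually[OF f] by (intro eventually_conj eventually_ball_finite) auto
  then obtain r where r: "r > 0" "\<And>x. x \<in> ball x0 r \<Longrightarrow> (\<forall>b\<in>B. norm (?D x b) < norm (?D x0 b) + 1) \<and> smooth_at x f"
    unfolding eventually_nhds_metric by (auto simp: dist_commute)
  have "norm (f x - f y) \<le> (M / c) * norm (x - y)" if "x \<in> ball x0 r" "y \<in> ball x0 r" for x y
  proof (rule differentiable_bound[of "ball x0 r" f ?D])
    fix x assume x: "x \<in> ball x0 r"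
    show "(f has_derivative ?D x) (at x within ball x0 r)"
      using r(2)[OF x] smooth_at_has_derivative has_derivative_at_withinI by blast
    have lin: "linear (?D x)" using r(2)[OF x] linear_frechet_derivative_smooth by blast
    show "onorm (?D x) \<le> M / c"
    proof (rule onorm_bound)
      show "0 \<le> M / c" using \<open>M \<ge> 0\<close> c(1) by simp
      fix v
      have v: "(\<Sum>b\<in>B. representation B v b *\<^sub>R b) = v" using B by (intro sum_representation_eq) auto
      have "?D x v = (\<Sum>b\<in>B. representation B v b *\<^sub>R ?D x b)"
        by (subst v[symmetric]) (simp add: linear_sum[OF lin] linear_scale[OF lin])
      then have "norm (?D x v) \<le> (\<Sum>b\<in>B. \<bar>representation B v b\<bar> * norm (?D x b))"
        by (metis (no_types, lifting) norm_scaleR norm_sum sum.cong)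
      also have "\<dots> \<le> (\<Sum>b\<in>B. \<bar>representation B v b\<bar> * M)"
      proof (intro sum_mono mult_left_mono)
        fix b assume b: "b \<in> B"
        have "norm (?D x b) \<le> norm (?D x0 b) + 1" using r(2)[OF x] b by (simp add: less_imp_le)
        also have "\<dots> \<le> M" unfolding M_def using B b by (intro member_le_sum) auto
        finally show "norm (?D x b) \<le> M" .
      qed simp
      also have "\<dots> = (\<Sum>b\<in>B. \<bar>representation B v b\<bar>) * M" by (simp add: sum_distrib_right)
      also have "\<dots> \<le> norm v / c * M"
        using c(2)[of "representation B v"] c(1) \<open>M \<ge> 0\<close> unfolding v
        by (intro mult_right_mono) (simp_all add: field_simps)
      finally show "norm (?D x v) \<le> M / c * norm v" by (simp add: mult.commute)
    qed
  qed (use that in auto)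
  moreover have "M / c \<ge> 0" using \<open>M \<ge> 0\<close> c(1) by simp
  ultimately show ?thesis using that r(1) by blast
qed

text \<open>This admits bounded continuous functions as the state space in
  \<open>picard\<close>.\<close>

instance bcontfun :: (metric_space, banach) banach ..

lemma apply_bcontfun_sum: "apply_bcontfun (\<Sum>i\<in>S. f i) t = (\<Sum>i\<in>S. apply_bcontfun (f i) t)"
  by (induction S rule: infinite_finite_induct) simp_all

text \<open>The model space need not be of class \<open>banach\<close>, so the equation is solved in coordinates. A Banach space
  containing all finite-dimensional coordinate spaces is that of bounded continuous functions on the line: the
  coordinate vector \<open>x\<close> is encoded as a combination of hat functions, and decoded by evaluation at integers.\<close>

lemma ode_local_solution:
  fixes X :: "'v::real_normed_vector \<Rightarrow> 'v"
  assumes fd: "finite_dim TYPE('v)" and X: "smooth_at x0 X"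
  obtains d c where "d > 0" "c 0 = x0" "\<And>t. \<bar>t\<bar> < d \<Longrightarrow> (c has_vector_derivative X (c t)) (at t)"
proof -
  obtain B :: "'v set" where B: "finite B" "independent B" "span B = UNIV" by (rule finite_dim_basis[OF fd])
  obtain us where us: "set us = B" "distinct us" using B(1) finite_distinct_list by blast
  define m where "m = length us"
  define hat :: "nat \<Rightarrow> real \<Rightarrow>\<^sub>C real" where "hat j = Bcontfun (\<lambda>t. max 0 (1 - \<bar>t - real j\<bar>))" for j
  have hat: "apply_bcontfun (hat j) (real i) = (if i = j then 1 else 0)" for i j
  proof -
    have "(\<lambda>t. max 0 (1 - \<bar>t - real j\<bar>)) \<in> bcontfun"
      by (rule bcontfun_normI[where b=1]) (auto intro!: continuous_intros)
    then have "apply_bcontfun (hat j) (real i) = max 0 (1 - \<bar>real i - real j\<bar>)"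
      unfolding hat_def by (simp add: Bcontfun_inverse)
    moreover have "1 \<le> \<bar>real i - real j\<bar>" if "i \<noteq> j" using that by linarith
    ultimately show ?thesis by auto
  qed
  define E :: "'v \<Rightarrow> real \<Rightarrow>\<^sub>C real" where "E x = (\<Sum>j<m. representation B x (us ! j) *\<^sub>R hat j)" for x
  define p where "p f = (\<Sum>i<m. apply_bcontfun f (real i) *\<^sub>R us ! i)" for f :: "real \<Rightarrow>\<^sub>C real"
  have "linear E"
    using B by (intro linearI)
      (simp_all add: E_def representation_add representation_scale scaleR_add_left sum.distrib scaleR_sum_right)
  then have E_lin: "bounded_linear E" by (rule finite_dim_bounded_linear[OF fd])
  have p_lin: "bounded_linear p"
  proof (rule bounded_linear_intro[where K="\<Sum>i<m. norm (us ! i)"])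
    fix f
    have "norm (p f) \<le> (\<Sum>i<m. norm (apply_bcontfun f (real i) *\<^sub>R us ! i))" unfolding p_def by (rule norm_sum)
    also have "\<dots> \<le> (\<Sum>i<m. norm f * norm (us ! i))"
      unfolding norm_scaleR using norm_bounded[of f] by (intro sum_mono mult_right_mono) auto
    finally show "norm (p f) \<le> norm f * (\<Sum>i<m. norm (us ! i))" by (simp add: sum_distrib_left)
  qed (simp_all add: p_def scaleR_add_left sum.distrib scaleR_sum_right)
  have pE: "p (E x) = x" for x
  proof -
    have "apply_bcontfun (E x) (real i) = representation B x (us ! i)" if "i < m" for i
      using that by (simp add: E_def apply_bcontfun_sum hat if_distrib[of "(*) _"] cong: if_cong)
    then have "p (E x) = (\<Sum>i<m. representation B x (us ! i) *\<^sub>R us ! i)" by (simp add: p_def)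
    also have "\<dots> = (\<Sum>b\<in>B. representation B x b *\<^sub>R b)"
    proof (rule sum.reindex_bij_betw)
      show "bij_betw ((!) us) {..<m} B" using us by (simp add: m_def bij_betw_nth)
    qed
    also have "\<dots> = x" using B by (intro sum_representation_eq) auto
    finally show ?thesis .
  qed
  obtain r K where r: "r > 0" "K \<ge> 0"
    "\<And>x y. x \<in> ball x0 r \<Longrightarrow> y \<in> ball x0 r \<Longrightarrow> norm (X x - X y) \<le> K * norm (x - y)"
    by (rule smooth_at_locally_lipschitz[OF fd X]) blast
  obtain KE where KE: "KE > 0" "\<And>x. norm (E x) \<le> norm x * KE" using bounded_linear.pos_bounded[OF E_lin] by blast
  obtain Kp where Kp: "Kp > 0" "\<And>x. norm (p x) \<le> norm x * Kp" using bounded_linear.pos_bounded[OF p_lin] by blast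
  have diff: "p f - p g = p (f - g)" "E x - E y = E (x - y)" for f g x y
    using linear_diff[OF bounded_linear.linear[OF p_lin]] linear_diff[OF bounded_linear.linear[OF E_lin]] by simp_all
  \<comment> \<open>Decoding stretches distances by at most \<open>Kp\<close>, so a closed ball of
    this radius lands in the open ball of radius r; the 2 makes the inequality strict.\<close>
  let ?r = "r / (2 * Kp)" and ?K = "K * KE * Kp"
  have in_ball: "p f \<in> ball x0 r" if "f \<in> cball (E x0) ?r" for f
  proof -
    have "norm (p f - x0) = norm (p (f - E x0))" by (simp add: diff[symmetric] pE)
    also have "\<dots> \<le> norm (f - E x0) * Kp" by (rule Kp)
    also have "\<dots> \<le> ?r * Kp" using that Kp(1) by (intro mult_right_mono) (auto simp: dist_norm norm_minus_commute)
    also have "\<dots> < r" using r Kp by simp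
    finally show ?thesis by (simp add: dist_norm norm_minus_commute)
  qed
  have lip: "norm (E (X (p f)) - E (X (p g))) \<le> ?K * norm (f - g)" if "f \<in> cball (E x0) ?r" "g \<in> cball (E x0) ?r" for f g
  proof -
    have "norm (E (X (p f)) - E (X (p g))) \<le> norm (X (p f) - X (p g)) * KE" unfolding diff by (rule KE)
    also have "\<dots> \<le> (K * norm (p f - p g)) * KE" using KE by (intro mult_right_mono r in_ball that) auto
    also have "\<dots> \<le> (K * (norm (f - g) * Kp)) * KE"
      unfolding diff using Kp KE r by (intro mult_right_mono mult_left_mono) auto
    finally show ?thesis by (simp add: mult_ac)
  qed
  have r0: "0 < ?r" and K0: "0 \<le> ?K" using r KE(1) Kp(1) by simp_all
  obtain d c where c: "d > 0" "c 0 = E x0"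
    "\<And>t. \<bar>t\<bar> < d \<Longrightarrow> c t \<in> cball (E x0) ?r \<and> (c has_vector_derivative E (X (p (c t)))) (at t)"
    by (rule picard[where F="\<lambda>f. E (X (p f))", OF r0 K0 lip]) blast+
  have "((\<lambda>t. p (c t)) has_vector_derivative X (p (c t))) (at t)" if "\<bar>t\<bar> < d" for t
    using bounded_linear.has_vector_derivative[OF p_lin, of c "E (X (p (c t)))" "at t"] c(3)[OF that] by (simp add: pE)
  moreover have "p (c 0) = x0" by (simp add: c pE)
  ultimately show ?thesis using that[of d "\<lambda>t. p (c t)"] c(1) by blast
qed

text \<open>Bootstrapping: a solution is as smooth as its own derivative \<open>X \<circ> c\<close> allows.\<close>

lemma ode_solution_smooth:
  fixes X :: "'v::real_normed_vector \<Rightarrow> 'v"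
  assumes fd: "finite_dim TYPE('v)" and S: "open S" and T: "open T" "smooth_on T X"
    and c: "\<And>t. t \<in> S \<Longrightarrow> c t \<in> T \<and> (c has_vector_derivative X (c t)) (at t)"
  shows "smooth_on S c"
  unfolding smooth_on_def
proof
  have der: "(c has_derivative (\<lambda>h. h *\<^sub>R X (c t))) (at t)" if "t \<in> S" for t
    using c[OF that] by (simp add: has_vector_derivative_def)
  fix k show "Ck_on k S c"
  proof (induction k)
    case 0
    have "isCont c t" if "t \<in> S" for t using der[OF that] has_derivative_continuous by blast
    then show ?case by (simp add: continuous_at_imp_continuous_on)
  next
    case (Suc k)
    have "Ck_on k S (\<lambda>t. X (c t))"
      by (rule Ck_on_compose[OF fd S T(1) _ Suc.IH]) (use c T(2) in \<open>auto simp: smooth_on_def\<close>)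
    then have sc: "Ck_on k S (\<lambda>t. h *\<^sub>R X (c t))" for h
      using Ck_on_bounded_linear[OF S bounded_linear_scaleR_right] by blast
    have "Ck_on k S (\<lambda>t. frechet_derivative c (at t) h)" for h
      by (rule Ck_on_cong[OF S _ sc[of h]]) (simp add: frechet_derivative_eqI[OF der])
    then show ?case using der by (auto simp: differentiable_def)
  qed
qed

subsection \<open>Lie groups\<close>

text \<open>The extension is the N-th power of the value at t / N, for N so large that t / N is in
  the domain.\<close>

lemma (in Group.group) extend_local_hom:
  fixes \<gamma>0 :: "real \<Rightarrow> 'a"
  assumes d: "\<delta> > 0" and closed: "\<And>t. \<bar>t\<bar> \<le> \<delta> \<Longrightarrow> \<gamma>0 t \<in> carrier G"
    and hom: "\<And>s t. \<bar>s\<bar> \<le> \<delta> \<Longrightarrow> \<bar>t\<bar> \<le> \<delta> \<Longrightarrow> \<gamma>0 (s + t) = \<gamma>0 s \<otimes> \<gamma>0 t"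
  obtains \<gamma> where "\<And>t. \<gamma> t \<in> carrier G" "\<And>s t. \<gamma> (s + t) = \<gamma> s \<otimes> \<gamma> t" "\<And>t. \<bar>t\<bar> \<le> \<delta> \<Longrightarrow> \<gamma> t = \<gamma>0 t"
proof -
  have one: "\<gamma>0 0 = \<one>" using hom[of 0 0] closed[of 0] d by (simp add: l_cancel_one)
  have pow: "\<gamma>0 (real n * t) = \<gamma>0 t [^] n" if "\<bar>real n * t\<bar> \<le> \<delta>" for n t
    using that
  proof (induction n)
    case (Suc n)
    have "\<bar>real n * t\<bar> \<le> \<bar>real (Suc n) * t\<bar>" "\<bar>t\<bar> \<le> \<bar>real (Suc n) * t\<bar>"
      by (simp_all add: abs_mult mult_right_mono mult_le_cancel_right1)
    then have le: "\<bar>real n * t\<bar> \<le> \<delta>" "\<bar>t\<bar> \<le> \<delta>" using Suc.prems by linarith+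
    have "\<gamma>0 (real (Suc n) * t) = \<gamma>0 (real n * t + t)" by (simp add: algebra_simps)
    then show ?case using hom[OF le] Suc.IH[OF le(1)] by simp
  qed (simp add: one)
  \<comment> \<open>Both powers are compared with the common refinement t / (M N).\<close>
  have indep: "\<gamma>0 (t / real N) [^] N = \<gamma>0 (t / real M) [^] M"
    if "M > 0" "N > 0" "\<bar>t\<bar> / real M \<le> \<delta>" "\<bar>t\<bar> / real N \<le> \<delta>" for t and M N :: nat
  proof -
    let ?u = "t / (real M * real N)"
    have "\<bar>?u\<bar> \<le> \<bar>t\<bar> / real M"
      using that by (simp add: abs_mult divide_left_mono mult_le_cancel_left1 divide_simps)
    then have u: "\<gamma>0 ?u \<in> carrier G" using that by (intro closed) linarith
    have e: "real M * ?u = t / real N" "real N * ?u = t / real M" using that by simp_all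
    have "\<bar>t / real N\<bar> \<le> \<delta>" "\<bar>t / real M\<bar> \<le> \<delta>" using that(3,4) by (simp_all only: abs_divide abs_of_nat)
    then have "\<gamma>0 (t / real N) = \<gamma>0 ?u [^] M" "\<gamma>0 (t / real M) = \<gamma>0 ?u [^] N"
      using pow[of M ?u] pow[of N ?u] unfolding e by blast+
    then show ?thesis using u by (simp add: nat_pow_pow mult.commute)
  qed
  define N where "N t = Suc (nat \<lceil>\<bar>t\<bar> / \<delta>\<rceil>)" for t
  define \<gamma> where "\<gamma> t = \<gamma>0 (t / real (N t)) [^] N t" for t
  have N: "\<bar>t\<bar> / real (N s) \<le> \<delta>" if "\<bar>t\<bar> \<le> \<bar>s\<bar>" for s t
  proof -
    have "\<bar>s\<bar> / \<delta> \<le> real (N s)" unfolding N_def by linarith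
    then have "\<bar>t\<bar> \<le> \<delta> * real (N s)" using d that by (simp add: field_simps)
    then show ?thesis by (simp add: N_def divide_simps)
  qed
  have Npos: "N t > 0" for t by (simp add: N_def)
  have \<gamma>: "\<gamma> t = \<gamma>0 (t / real (N s)) [^] N s" if "\<bar>t\<bar> \<le> \<bar>s\<bar>" for s t
    unfolding \<gamma>_def by (rule indep[OF Npos Npos N[OF that] N[OF order_refl]])
  have cl: "\<gamma>0 (t / real (N s)) \<in> carrier G" if "\<bar>t\<bar> \<le> \<bar>s\<bar>" for s t
    using N[OF that] by (intro closed) simp
  show ?thesis
  proof
    show "\<gamma> t \<in> carrier G" for t unfolding \<gamma>_def using cl[OF order_refl] by simp
    show "\<gamma> t = \<gamma>0 t" if "\<bar>t\<bar> \<le> \<delta>" for t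
      using indep[of 1 "N t" t] that N[OF order_refl] Npos closed[OF that] by (simp add: \<gamma>_def)
    fix s t
    \<comment> \<open>The exponent belonging to |s| + |t| serves s, t and s + t at once. The two
      factors commute because addition of real numbers does.\<close>
    let ?S = "\<bar>s\<bar> + \<bar>t\<bar>" and ?n = "N (\<bar>s\<bar> + \<bar>t\<bar>)"
    have le: "\<bar>s\<bar> \<le> \<bar>?S\<bar>" "\<bar>t\<bar> \<le> \<bar>?S\<bar>" "\<bar>s + t\<bar> \<le> \<bar>?S\<bar>" by linarith+
    let ?a = "\<gamma>0 (s / real ?n)" and ?b = "\<gamma>0 (t / real ?n)"
    have ab: "\<gamma>0 ((s + t) / real ?n) = ?a \<otimes> ?b" "?a \<otimes> ?b = ?b \<otimes> ?a"
      using hom[of "s / real ?n" "t / real ?n"] hom[of "t / real ?n" "s / real ?n"] N[OF le(1)] N[OF le(2)]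
      by (simp_all add: add_divide_distrib add.commute)
    show "\<gamma> (s + t) = \<gamma> s \<otimes> \<gamma> t"
      unfolding \<gamma>[OF le(1)] \<gamma>[OF le(2)] \<gamma>[OF le(3)] ab(1)
      by (rule pow_mult_distrib[OF ab(2) cl[OF le(1)] cl[OF le(2)]])
  qed
qed

lemma (in Group.group) hom_real_pow:
  assumes "\<And>t :: real. \<gamma> t \<in> carrier G" "\<And>s t. \<gamma> (s + t) = \<gamma> s \<otimes> \<gamma> t"
  shows "\<gamma> 0 = \<one>" "\<gamma> (real n * t) = \<gamma> t [^] n" "\<gamma> (- t) = inv (\<gamma> t)"
proof -
  show one: "\<gamma> 0 = \<one>" using assms(2)[of 0 0] assms(1)[of 0] by (simp add: l_cancel_one)
  show "\<gamma> (real n * t) = \<gamma> t [^] n"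
  proof (induction n)
    case (Suc n)
    have "\<gamma> (real (Suc n) * t) = \<gamma> (real n * t + t)" by (simp add: algebra_simps)
    then show ?case using Suc by (simp add: assms(2))
  qed (simp add: one)
  show "\<gamma> (- t) = inv (\<gamma> t)"
    using assms(2)[of "- t" t] by (intro inv_equality[symmetric]) (simp_all add: one assms(1))
qed

locale lie_group =
  fixes G :: "('a, 'x) monoid_scheme" (structure) and L :: "('a, 'v::real_normed_vector) manifold"
  assumes lie: "compact_lie_group G L"
begin

sublocale Group.group G using lie by (simp add: compact_lie_group_def)
sublocale mfd L by unfold_locales (use lie in \<open>simp add: compact_lie_group_def\<close>)

lemma points_carrier [simp]: "points L = carrier G"
  using lie by (simp add: compact_lie_group_def)

lemma smooth_into_carrier: "smooth_into L F x \<Longrightarrow> F x \<in> carrier G"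
  using smooth_into_points by fastforce

lemma smooth_into_eventually_carrier: "smooth_into L F x \<Longrightarrow> \<forall>\<^sub>F y in nhds x. F y \<in> carrier G"
  using smooth_into_eventually[of F x "points L"] smooth_into_points by fastforce

lemma smooth_into_mult:
  assumes "smooth_into L F x" "smooth_into L H x"
  shows "smooth_into L (\<lambda>y. F y \<otimes> H y) x"
  using smooth_map2_into[OF mfd mfd mfd _ assms, of "\<lambda>(g, h). g \<otimes> h"] lie
  by (simp add: compact_lie_group_def)

lemma smooth_into_inv:
  assumes "smooth_into L F x" shows "smooth_into L (\<lambda>y. inv (F y)) x"
  using smooth_map_into[OF chart_open _ assms, of "\<lambda>g. inv g"] lie by (simp add: compact_lie_group_def)

lemma smooth_into_constant: "g \<in> carrier G \<Longrightarrow> smooth_into L (\<lambda>y. g) x"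
  by (simp add: smooth_into_const)

lemma smooth_into_coord: "p \<in> carrier G \<Longrightarrow> smooth_into L (chart_inv (chart_at L p)) (coord_at L p)"
  by (intro smooth_into_chart_inv chart_at coord_at_in) simp_all

lemma msmooth_translations:
  assumes "g \<in> carrier G"
  shows "msmooth L L (\<lambda>h. g \<otimes> h)" "msmooth L L (\<lambda>h. h \<otimes> g)" "msmooth L L (\<lambda>h. g \<otimes> h \<otimes> inv g)"
  unfolding msmooth_def
  by (auto intro!: smooth_into_mult smooth_into_constant smooth_into_coord assms)

lemma theta_R_vel:
  assumes "smooth_into L F x"
  shows "theta_R G L (F x) (vel L F x v) = vel L (\<lambda>y. F y \<otimes> inv (F x)) x v"
  unfolding theta_R_def
  by (rule vel_msmooth[OF mfd msmooth_translations(2) assms, symmetric]) (simp add: smooth_into_carrier[OF assms])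

lemma theta_L_vel:
  assumes "smooth_into L F x"
  shows "theta_L G L (F x) (vel L F x v) = vel L (\<lambda>y. inv (F x) \<otimes> F y) x v"
  unfolding theta_L_def
  by (rule vel_msmooth[OF mfd msmooth_translations(1) assms, symmetric]) (simp add: smooth_into_carrier[OF assms])

lemma Ad_vel:
  assumes "smooth_into L F x" "F x = \<one>" "g \<in> carrier G"
  shows "Ad G L g (vel L F x v) = vel L (\<lambda>y. g \<otimes> F y \<otimes> inv g) x v"
  using vel_msmooth[OF mfd msmooth_translations(3)[OF assms(3)] assms(1)] by (simp add: Ad_def assms(2))

lemma theta_R_linear: "g \<in> carrier G \<Longrightarrow> linear (theta_R G L g)"
  unfolding theta_R_def by (intro tangent_map_linear mfd msmooth_translations) simp_all

lemma Ad_linear: "g \<in> carrier G \<Longrightarrow> linear (Ad G L g)"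
  unfolding Ad_def by (intro tangent_map_linear mfd msmooth_translations) simp_all

text \<open>Conjugating g^-1 h by g gives h g^-1. This is what expresses \<theta>^L through
  \<theta>^R in the moment condition.\<close>

lemma Ad_theta_L:
  assumes g: "g \<in> carrier G"
  shows "Ad G L g (theta_L G L g w) = theta_R G L g w"
proof -
  let ?F = "chart_inv (chart_at L g)" and ?x = "coord_at L g"
  have F: "smooth_into L ?F ?x" "?F ?x = g" "vel L ?F ?x w = w"
    using smooth_into_coord[OF g] coord_at[of g] vel_chart_inv_coord_at[of g] g by simp_all
  have "theta_L G L g w = vel L (\<lambda>y. inv g \<otimes> ?F y) ?x w" using theta_L_vel[OF F(1), of w] F by simp
  then have "Ad G L g (theta_L G L g w) = vel L (\<lambda>y. g \<otimes> (inv g \<otimes> ?F y) \<otimes> inv g) ?x w"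
    using Ad_vel[of "\<lambda>y. inv g \<otimes> ?F y" ?x g w] g F by (simp add: smooth_into_mult smooth_into_constant)
  also have "\<dots> = vel L (\<lambda>y. ?F y \<otimes> inv g) ?x w"
  proof (subst vel_cong)
    show "smooth_into L (\<lambda>y. ?F y \<otimes> inv g) ?x" using g F by (intro smooth_into_mult smooth_into_constant) auto
    show "\<forall>\<^sub>F y in nhds ?x. ?F y \<otimes> inv g = g \<otimes> (inv g \<otimes> ?F y) \<otimes> inv g"
      using smooth_into_eventually_carrier[OF F(1)] by eventually_elim (use g in \<open>simp add: m_assoc[symmetric]\<close>)
  qed simp
  also have "\<dots> = theta_R G L g w" using theta_R_vel[OF F(1), of w] F by simp
  finally show ?thesis .
qed

lemma vel_mult_at_one:
  fixes F H :: "real \<Rightarrow> 'a"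
  assumes F: "smooth_into L F x" "F x = \<one>" and H: "smooth_into L H x" "H x = \<one>"
  shows "vel L (\<lambda>t. F t \<otimes> H t) x v = vel L F x v + vel L H x v"
proof -
  let ?K = "\<lambda>p. F (fst p) \<otimes> H (snd p)"
  have K: "smooth_into L ?K (x, x)"
    using smooth_into_compose[OF finite_dim_real smooth_at_linear[OF bounded_linear_fst], of L F "(x, x)"]
      smooth_into_compose[OF finite_dim_real smooth_at_linear[OF bounded_linear_snd], of L H "(x, x)"] F H
    by (intro smooth_into_mult) simp_all
  have "vel L (\<lambda>t. F t \<otimes> H x) x v = vel L F x v"
    by (subst vel_cong[OF F(1)])
      (use smooth_into_eventually_carrier[OF F(1)] H in \<open>auto elim!: eventually_mono\<close>)
  moreover have "vel L (\<lambda>t. F x \<otimes> H t) x v = vel L H x v"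
    by (subst vel_cong[OF H(1)])
      (use smooth_into_eventually_carrier[OF H(1)] F in \<open>auto elim!: eventually_mono\<close>)
  ultimately show ?thesis using vel_diagonal[OF K] by simp
qed

subsection \<open>One-parameter subgroups\<close>

text \<open>In the chart around \<open>\<one>\<close> with domain \<open>U\<close>, coordinate map \<open>\<kappa>\<close> and inverse \<open>\<kappa>i\<close>, the left-invariant vector
  field of \<open>\<xi>\<close> is \<open>inv_field \<xi>\<close>.\<close>

definition "\<kappa> = snd (chart_at L \<one>)"
definition "\<kappa>i = chart_inv (chart_at L \<one>)"
definition "U = fst (chart_at L \<one>)"
definition "x0 = coord_at L \<one>"
definition "inv_field \<xi> x = frechet_derivative (\<lambda>z. \<kappa> (\<kappa>i x \<otimes> \<kappa>i z)) (at x0) \<xi>"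

lemma chart_one: "chart_at L \<one> \<in> atlas L" "\<one> \<in> U"
  using chart_at[of \<one>] by (simp_all add: U_def)

lemma \<kappa>i_x0: "\<kappa>i x0 = \<one>" and \<kappa>_one: "\<kappa> \<one> = x0"
  using coord_at[of \<one>] by (simp_all add: \<kappa>i_def x0_def \<kappa>_def coord_at_def)

lemma \<kappa>i_\<kappa>: "p \<in> U \<Longrightarrow> \<kappa>i (\<kappa> p) = p"
  unfolding \<kappa>i_def \<kappa>_def U_def by (rule chart_inv_coord[OF chart_one(1)])

lemma \<kappa>_\<kappa>i: "x \<in> \<kappa> ` U \<Longrightarrow> \<kappa> (\<kappa>i x) = x"
  unfolding \<kappa>i_def \<kappa>_def U_def by (rule coord_chart_inv)

lemma \<kappa>i_in: "x \<in> \<kappa> ` U \<Longrightarrow> \<kappa>i x \<in> U"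
  unfolding \<kappa>i_def \<kappa>_def U_def by (rule chart_inv_in[OF chart_one(1)])

lemma U_carrier: "p \<in> U \<Longrightarrow> p \<in> carrier G"
  using chart_subset[OF chart_one(1)] by (auto simp: U_def)

lemma U_open: "openin (mtop L) U" "open (\<kappa> ` U)" "x0 \<in> \<kappa> ` U"
  using chart_open[OF chart_one(1)] chart_homeo(2)[OF chart_one(1)] chart_one(2) \<kappa>_one
  by (auto simp: U_def \<kappa>_def intro: image_eqI[OF sym])

lemma smooth_into_\<kappa>i: "x \<in> \<kappa> ` U \<Longrightarrow> smooth_into L \<kappa>i x"
  unfolding \<kappa>i_def \<kappa>_def U_def by (rule smooth_into_chart_inv[OF chart_one(1)])

lemma smooth_at_\<kappa>: "smooth_into L F x \<Longrightarrow> F x \<in> U \<Longrightarrow> smooth_at x (\<lambda>y. \<kappa> (F y))"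
  unfolding \<kappa>_def U_def by (rule smooth_intoD(2)[OF _ chart_one(1)])

lemma eventually_U: "smooth_into L F x \<Longrightarrow> F x \<in> U \<Longrightarrow> \<forall>\<^sub>F y in nhds x. F y \<in> U"
  by (rule smooth_into_eventually[OF _ U_open(1)])

lemma smooth_into_product:
  assumes "x \<in> \<kappa> ` U" "y \<in> \<kappa> ` U"
  shows "smooth_into L (\<lambda>p. \<kappa>i (fst p) \<otimes> \<kappa>i (snd p)) (x, y)"
  using smooth_into_compose[OF finite_dim smooth_at_linear[OF bounded_linear_fst], of L \<kappa>i "(x, y)"]
    smooth_into_compose[OF finite_dim smooth_at_linear[OF bounded_linear_snd], of L \<kappa>i "(x, y)"]
    smooth_into_\<kappa>i assms
  by (intro smooth_into_mult) simp_all

lemma inv_field_smooth: "smooth_at x0 (inv_field \<xi>)"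
proof -
  let ?\<mu> = "\<lambda>p. \<kappa> (\<kappa>i (fst p) \<otimes> \<kappa>i (snd p))"
  have \<mu>: "smooth_at (x0, x0) ?\<mu>"
    using smooth_at_\<kappa>[OF smooth_into_product[OF U_open(3,3)]] chart_one(2) by (simp add: \<kappa>i_x0)
  have P: "smooth_at x (\<lambda>x. (x, x0))" for x by (intro smooth_at_Pair smooth_at_id smooth_at_const)
  \<comment> \<open>The derivative in the second variable is the derivative of the joint map along
    (0, \<xi>), hence smooth in the first variable.\<close>
  have "smooth_at x0 (\<lambda>x. frechet_derivative ?\<mu> (at (x, x0)) (0, \<xi>))"
    by (rule smooth_at_compose[OF finite_dim_prod[OF finite_dim finite_dim] P smooth_at_derivative[OF \<mu>]])
  then show ?thesis
  proof (rule smooth_at_cong)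
    have "\<forall>\<^sub>F x in nhds x0. smooth_at (x, x0) ?\<mu>"
      by (rule eventually_compose_isCont[OF smooth_at_imp_isCont[OF P] smooth_at_eventually[OF \<mu>]])
    then show "\<forall>\<^sub>F x in nhds x0. frechet_derivative ?\<mu> (at (x, x0)) (0, \<xi>) = inv_field \<xi> x"
    proof eventually_elim
      case (elim x)
      have "((\<lambda>z. (x, z)) has_derivative (\<lambda>v. (0, v))) (at x0)" by (auto intro!: derivative_eq_intros)
      then have d: "frechet_derivative (\<lambda>z. (x, z)) (at x0) \<xi> = (0, \<xi>)" by (simp add: frechet_derivative_eqI)
      have "smooth_at x0 (\<lambda>z. (x, z))" by (intro smooth_at_Pair smooth_at_id smooth_at_const)
      from frechet_derivative_chain[OF this elim] show ?case by (simp add: inv_field_def d)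
    qed
  qed
qed

lemma inv_field_x0: "inv_field \<xi> x0 = \<xi>"
proof -
  have "\<forall>\<^sub>F z in nhds x0. z = \<kappa> (\<kappa>i x0 \<otimes> \<kappa>i z)"
    using eventually_nhds_in_open[OF U_open(2,3)]
    by eventually_elim (simp add: \<kappa>i_x0 \<kappa>_\<kappa>i U_carrier \<kappa>i_in)
  from frechet_derivative_cong_nhds[OF smooth_at_id this]
  show ?thesis by (simp add: inv_field_def frechet_derivative_eqI[OF has_derivative_ident])
qed

text \<open>The identity a (g h) = (a g) h, differentiated at h = 1 in coordinates.\<close>

lemma inv_field_left_invariant:
  assumes a: "a \<in> carrier G" and z: "z \<in> \<kappa> ` U" and az: "a \<otimes> \<kappa>i z \<in> U"
  shows "frechet_derivative (\<lambda>y. \<kappa> (a \<otimes> \<kappa>i y)) (at z) (inv_field \<xi> z) = inv_field \<xi> (\<kappa> (a \<otimes> \<kappa>i z))"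
proof -
  let ?g = "\<kappa>i z"
  have g: "?g \<in> U" "?g \<in> carrier G" using \<kappa>i_in[OF z] U_carrier by auto
  have s: "smooth_into L (\<lambda>y. ?g \<otimes> \<kappa>i y) x0"
    by (intro smooth_into_mult smooth_into_constant smooth_into_\<kappa>i U_open g)
  have s1: "smooth_at x0 (\<lambda>y. \<kappa> (?g \<otimes> \<kappa>i y))" by (rule smooth_at_\<kappa>[OF s]) (use g in \<open>simp add: \<kappa>i_x0\<close>)
  have e: "\<kappa> (?g \<otimes> \<kappa>i x0) = z" using g z by (simp add: \<kappa>i_x0 \<kappa>_\<kappa>i)
  have s2: "smooth_at z (\<lambda>y. \<kappa> (a \<otimes> \<kappa>i y))"
    by (intro smooth_at_\<kappa> smooth_into_mult smooth_into_constant smooth_into_\<kappa>i a z az)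
  have "frechet_derivative (\<lambda>y. \<kappa> (a \<otimes> \<kappa>i y)) (at z) (inv_field \<xi> z)
     = frechet_derivative (\<lambda>y. \<kappa> (a \<otimes> \<kappa>i (\<kappa> (?g \<otimes> \<kappa>i y)))) (at x0) \<xi>"
    using frechet_derivative_chain[OF s1, of "\<lambda>y. \<kappa> (a \<otimes> \<kappa>i y)" \<xi>] s2 by (simp add: e inv_field_def)
  also have "\<dots> = frechet_derivative (\<lambda>y. \<kappa> (\<kappa>i (\<kappa> (a \<otimes> ?g)) \<otimes> \<kappa>i y)) (at x0) \<xi>"
  proof -
    have sm: "smooth_at x0 (\<lambda>y. \<kappa> (a \<otimes> \<kappa>i (\<kappa> (?g \<otimes> \<kappa>i y))))"
      by (rule smooth_at_compose[OF finite_dim s1]) (use s2 e in simp)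
    have "\<forall>\<^sub>F y in nhds x0. ?g \<otimes> \<kappa>i y \<in> U" by (rule eventually_U[OF s]) (use g in \<open>simp add: \<kappa>i_x0\<close>)
    then have "\<forall>\<^sub>F y in nhds x0. \<kappa> (a \<otimes> \<kappa>i (\<kappa> (?g \<otimes> \<kappa>i y))) = \<kappa> (\<kappa>i (\<kappa> (a \<otimes> ?g)) \<otimes> \<kappa>i y)"
      using eventually_nhds_in_open[OF U_open(2,3)]
      by eventually_elim (simp add: \<kappa>i_\<kappa> az a g m_assoc U_carrier \<kappa>i_in)
    from frechet_derivative_cong_nhds[OF sm this] show ?thesis by simp
  qed
  finally show ?thesis by (simp add: inv_field_def)
qed

lemma inv_field_nice_ball:
  obtains R K where "R > 0" "K \<ge> 0" "ball x0 R \<subseteq> \<kappa> ` U" "smooth_on (ball x0 R) (inv_field \<xi>)"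
    "\<And>x y. x \<in> ball x0 R \<Longrightarrow> y \<in> ball x0 R \<Longrightarrow> norm (inv_field \<xi> x - inv_field \<xi> y) \<le> K * norm (x - y)"
proof -
  obtain r K where r: "r > 0" "K \<ge> 0"
    "\<And>x y. x \<in> ball x0 r \<Longrightarrow> y \<in> ball x0 r \<Longrightarrow> norm (inv_field \<xi> x - inv_field \<xi> y) \<le> K * norm (x - y)"
    by (rule smooth_at_locally_lipschitz[OF finite_dim inv_field_smooth]) blast
  have "\<forall>\<^sub>F x in nhds x0. smooth_at x (inv_field \<xi>) \<and> x \<in> \<kappa> ` U"
    by (intro eventually_conj smooth_at_eventually inv_field_smooth eventually_nhds_in_open U_open)
  then obtain e where e: "e > 0" "\<And>x. dist x x0 < e \<Longrightarrow> smooth_at x (inv_field \<xi>) \<and> x \<in> \<kappa> ` U"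
    unfolding eventually_nhds_metric by blast
  show ?thesis
  proof (rule that[of "min r e" K])
    show "smooth_on (ball x0 (min r e)) (inv_field \<xi>)" by (rule smooth_onI) (use e in \<open>simp add: dist_commute\<close>)
    show "ball x0 (min r e) \<subseteq> \<kappa> ` U" using e by (auto simp: dist_commute)
  qed (use r e in auto)
qed

text \<open>Let c be the integral curve through the identity. For fixed s the curves u \<mapsto>
  c(s) c(u) and u \<mapsto> c(s + u) both solve the equation of the left-invariant field and start
  at c(s), so they agree.\<close>

lemma exists_local_hom:
  obtains \<delta> c where "\<delta> > 0" "c 0 = x0" "smooth_at 0 c" "\<And>t :: real. \<bar>t\<bar> \<le> \<delta> \<Longrightarrow> c t \<in> \<kappa> ` U"
    "(c has_vector_derivative \<xi>) (at 0)"
    "\<And>s t. \<bar>s\<bar> \<le> \<delta> \<Longrightarrow> \<bar>t\<bar> \<le> \<delta> \<Longrightarrow> \<kappa>i (c (s + t)) = \<kappa>i (c s) \<otimes> \<kappa>i (c t)"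
proof -
  obtain R K where R: "R > 0" "K \<ge> 0" "ball x0 R \<subseteq> \<kappa> ` U" "smooth_on (ball x0 R) (inv_field \<xi>)"
    and lip: "\<And>x y. x \<in> ball x0 R \<Longrightarrow> y \<in> ball x0 R \<Longrightarrow> norm (inv_field \<xi> x - inv_field \<xi> y) \<le> K * norm (x - y)"
    by (rule inv_field_nice_ball[where \<xi>=\<xi>]) blast
  obtain d c where c: "d > 0" "c 0 = x0" "\<And>t. \<bar>t\<bar> < d \<Longrightarrow> (c has_vector_derivative inv_field \<xi> (c t)) (at t)"
    by (rule ode_local_solution[OF finite_dim inv_field_smooth]) blast
  let ?m = "\<lambda>p. \<kappa>i (fst p) \<otimes> \<kappa>i (snd p)"
  have m: "smooth_into L ?m (x0, x0)" by (rule smooth_into_product[OF U_open(3,3)])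
  have m1: "?m (x0, x0) \<in> U" using chart_one(2) by (simp add: \<kappa>i_x0)
  have "\<forall>\<^sub>F p in nhds (x0, x0). \<kappa> (?m p) \<in> ball x0 R"
    by (rule eventually_compose_isCont[OF smooth_at_imp_isCont[OF smooth_at_\<kappa>[OF m m1]]])
      (rule eventually_nhds_in_open, use R in \<open>simp_all add: \<kappa>i_x0 \<kappa>_one\<close>)
  then have "\<forall>\<^sub>F p in nhds (x0, x0). \<kappa> (?m p) \<in> ball x0 R \<and> ?m p \<in> U"
    using eventually_U[OF m m1] by eventually_elim simp
  then obtain A where A: "open A" "(x0, x0) \<in> A" "\<And>p. p \<in> A \<Longrightarrow> \<kappa> (?m p) \<in> ball x0 R \<and> ?m p \<in> U"
    unfolding eventually_nhds by blast
  obtain A1 A2 where A12: "open A1" "open A2" "x0 \<in> A1" "x0 \<in> A2" "A1 \<times> A2 \<subseteq> A"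
    using open_prod_elim[OF A(1,2)] by (metis mem_Times_iff fst_conv snd_conv)
  let ?A = "A1 \<inter> A2 \<inter> ball x0 R"
  have "isCont c 0" using c(3)[of 0] c(1) has_vector_derivative_continuous by auto
  then have "\<forall>\<^sub>F t in nhds 0. c t \<in> ?A"
    by (rule eventually_compose_isCont) (rule eventually_nhds_in_open, use A12 R c in auto)
  then obtain e where e: "e > 0" "\<And>t. dist t 0 < e \<Longrightarrow> c t \<in> ?A" unfolding eventually_nhds_metric by blast
  \<comment> \<open>The thirds keep sums of two parameters within the domain of the solution and
    within the region where products stay in the ball; the last bound is the one that
    \<open>ode_unique\<close> requires.\<close>
  define \<delta> where "\<delta> = min (min (d / 3) (e / 3)) (1 / (2 * (K + 1)))"
  have \<delta>: "\<delta> > 0" using c(1) e(1) R by (simp add: \<delta>_def)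
  have K\<delta>: "K * \<delta> \<le> 1 / 2"
  proof -
    have "K * \<delta> \<le> K * (1 / (2 * (K + 1)))" using R by (intro mult_left_mono) (simp_all add: \<delta>_def)
    also have "\<dots> \<le> 1 / 2" using R by (simp add: field_simps)
    finally show ?thesis .
  qed
  have small: "\<bar>t\<bar> < d" "c t \<in> ?A" if "\<bar>t\<bar> \<le> 2 * \<delta>" for t
  proof -
    have "2 * \<delta> < d" "2 * \<delta> < e" using c(1) e(1) unfolding \<delta>_def by linarith+
    then show "\<bar>t\<bar> < d" using that by simp
    have "dist t 0 < e" using that \<open>2 * \<delta> < e\<close> by simp
    then show "c t \<in> ?A" by (rule e(2))
  qed
  show ?thesis
  proof (rule that[of \<delta> c])
    show "0 < \<delta>" "c 0 = x0" by (rule \<delta>, rule c(2))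
    show "(c has_vector_derivative \<xi>) (at 0)" using c(3)[of 0] c(1,2) by (simp add: inv_field_x0)
    have "smooth_on {-\<delta><..<\<delta>} c"
      by (rule ode_solution_smooth[OF finite_dim _ _ R(4)]) (use c(3) small in auto)
    then show "smooth_at 0 c" by (rule smooth_on_imp_smooth_at[OF _ _ order_refl]) (use \<delta> in auto)
    show "c t \<in> \<kappa> ` U" if "\<bar>t\<bar> \<le> \<delta>" for t using small(2)[of t] that \<delta> R(3) by auto
    fix s t assume s: "\<bar>s\<bar> \<le> \<delta>" and t: "\<bar>t\<bar> \<le> \<delta>"
    let ?a = "\<kappa>i (c s)"
    have cs: "c s \<in> ?A" and cs': "c s \<in> \<kappa> ` U" using small(2)[of s] s \<delta> R(3) by auto
    have a: "?a \<in> U" "?a \<in> carrier G" using \<kappa>i_in[OF cs'] U_carrier by auto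
    have prod: "?a \<otimes> \<kappa>i (c u) \<in> U" "\<kappa> (?a \<otimes> \<kappa>i (c u)) \<in> ball x0 R" "c u \<in> \<kappa> ` U" if "\<bar>u\<bar> \<le> \<delta>" for u
      using A(3)[of "(c s, c u)"] A12(5) cs small(2)[of u] that \<delta> R(3) by auto
    have "\<kappa> (?a \<otimes> \<kappa>i (c t)) = c (s + t)"
    proof (rule ode_unique[where c="\<lambda>u. \<kappa> (?a \<otimes> \<kappa>i (c u))" and b="\<lambda>u. c (s + u)", OF lip R(2) _ K\<delta>])
      show "\<kappa> (?a \<otimes> \<kappa>i (c 0)) = c (s + 0)" using a cs' by (simp add: c \<kappa>i_x0 \<kappa>_\<kappa>i)
      fix u assume "u \<in> {-\<delta>..\<delta>}"
      then have u: "\<bar>u\<bar> \<le> \<delta>" by auto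
      have su: "\<bar>s + u\<bar> \<le> 2 * \<delta>" using s u by linarith
      have "((\<lambda>u. c (s + u)) has_vector_derivative 1 *\<^sub>R inv_field \<xi> (c (s + u))) (at u)"
        by (rule vector_diff_chain_at[of "\<lambda>u. s + u" 1 u c, unfolded o_def])
          (use c(3)[OF small(1)[OF su]] in \<open>auto intro!: derivative_eq_intros\<close>)
      then show "c (s + u) \<in> ball x0 R \<and> ((\<lambda>u. c (s + u)) has_vector_derivative inv_field \<xi> (c (s + u))) (at u)"
        using small(2)[OF su] by simp
      let ?f = "\<lambda>y. \<kappa> (?a \<otimes> \<kappa>i y)"
      have "smooth_at (c u) ?f"
        by (intro smooth_at_\<kappa> smooth_into_mult smooth_into_constant smooth_into_\<kappa>i a prod u)
      then have "(?f has_derivative frechet_derivative ?f (at (c u))) (at (c u))" by (rule smooth_at_has_derivative)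
      moreover have "(c has_vector_derivative inv_field \<xi> (c u)) (at u)" using c(3)[OF small(1)[of u]] u \<delta> by simp
      ultimately have "((\<lambda>u. ?f (c u)) has_vector_derivative frechet_derivative ?f (at (c u)) (inv_field \<xi> (c u))) (at u)"
        using vector_derivative_diff_chain_within[of c "inv_field \<xi> (c u)" u UNIV ?f] has_derivative_at_withinI
        by (fastforce simp: o_def)
      then show "?f (c u) \<in> ball x0 R \<and> ((\<lambda>u. ?f (c u)) has_vector_derivative inv_field \<xi> (?f (c u))) (at u)"
        using prod[OF u] by (simp add: inv_field_left_invariant[OF a(2)])
    qed (use t \<delta> in auto)
    then show "\<kappa>i (c (s + t)) = ?a \<otimes> \<kappa>i (c t)" using \<kappa>i_\<kappa>[OF prod(1)[OF t]] by simp
  qed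
qed

lemma one_param_subgroup_iff:
  "one_param_subgroup G L \<gamma> \<longleftrightarrow> (\<forall>t. smooth_into L \<gamma> t) \<and> (\<forall>s t. \<gamma> (s + t) = \<gamma> s \<otimes> \<gamma> t)"
  by (simp add: one_param_subgroup_def smooth_map_real_line_iff)

lemma one_param_subgroup_exists: "\<exists>\<gamma>. one_param_subgroup G L \<gamma> \<and> vel L \<gamma> 0 1 = \<xi>"
proof -
  obtain \<delta> c where c: "\<delta> > 0" "c 0 = x0" "smooth_at 0 c" "\<And>t :: real. \<bar>t\<bar> \<le> \<delta> \<Longrightarrow> c t \<in> \<kappa> ` U"
    "(c has_vector_derivative \<xi>) (at 0)"
    "\<And>s t. \<bar>s\<bar> \<le> \<delta> \<Longrightarrow> \<bar>t\<bar> \<le> \<delta> \<Longrightarrow> \<kappa>i (c (s + t)) = \<kappa>i (c s) \<otimes> \<kappa>i (c t)"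
    by (rule exists_local_hom) blast
  have "\<kappa>i (c t) \<in> carrier G" if "\<bar>t\<bar> \<le> \<delta>" for t using c(4)[OF that] \<kappa>i_in U_carrier by blast
  then obtain \<gamma> where \<gamma>: "\<And>t. \<gamma> t \<in> carrier G" "\<And>s t. \<gamma> (s + t) = \<gamma> s \<otimes> \<gamma> t" "\<And>t. \<bar>t\<bar> \<le> \<delta> \<Longrightarrow> \<gamma> t = \<kappa>i (c t)"
    using extend_local_hom[of \<delta> "\<lambda>t. \<kappa>i (c t)"] c(1,6) by blast
  have "\<forall>\<^sub>F t in nhds 0. t \<in> {-\<delta><..<\<delta>}" using c(1) by (intro eventually_nhds_in_open) auto
  then have ev: "\<forall>\<^sub>F t in nhds 0. \<kappa>i (c t) = \<gamma> t" by eventually_elim (use \<gamma>(3) in auto)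
  have s: "smooth_into L (\<lambda>t. \<kappa>i (c t)) 0"
    by (rule smooth_into_compose[OF finite_dim c(3)]) (simp add: c(2) smooth_into_\<kappa>i U_open)
  have \<gamma>0: "smooth_into L \<gamma> 0" by (rule smooth_into_cong[OF s ev])
  have "smooth_into L \<gamma> t" for t
  proof -
    have "smooth_at t (\<lambda>s. s - t)"
      using smooth_at_add[OF smooth_at_id smooth_at_const[of t "- t"]] by simp
    then have "smooth_into L (\<lambda>s. \<gamma> (s - t)) t"
      using smooth_into_compose[where F=\<gamma> and h="\<lambda>s. s - t" and x=t and N=L, OF finite_dim_real] \<gamma>0 by simp
    then have "smooth_into L (\<lambda>s. \<gamma> t \<otimes> \<gamma> (s - t)) t"
      by (intro smooth_into_mult smooth_into_constant \<gamma>(1))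
    moreover have "(\<lambda>s. \<gamma> t \<otimes> \<gamma> (s - t)) = \<gamma>" by (rule ext) (simp add: \<gamma>(2)[symmetric])
    ultimately show ?thesis by simp
  qed
  then have "one_param_subgroup G L \<gamma>" using \<gamma>(2) by (simp add: one_param_subgroup_iff)
  moreover have "vel L \<gamma> 0 1 = \<xi>"
  proof -
    have "vel L \<gamma> 0 1 = vel L (\<lambda>t. \<kappa>i (c t)) 0 1" using vel_cong[OF s ev] by simp
    also have "\<dots> = vel L \<kappa>i x0 (frechet_derivative c (at 0) 1)"
      using vel_compose[OF c(3), of \<kappa>i 1] smooth_into_\<kappa>i[OF U_open(3)] by (simp add: c(2))
    also have "\<dots> = frechet_derivative c (at 0) 1"
      unfolding \<kappa>i_def x0_def by (rule vel_chart_inv_coord_at) simp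
    also have "\<dots> = \<xi>" using c(5) by (simp add: has_vector_derivative_def frechet_derivative_eqI)
    finally show ?thesis .
  qed
  ultimately show ?thesis by blast
qed

lemma one_param_subgroup_ode:
  assumes \<gamma>: "one_param_subgroup G L \<gamma>" and t: "\<gamma> t \<in> U"
  shows "((\<lambda>t. \<kappa> (\<gamma> t)) has_vector_derivative inv_field (vel L \<gamma> 0 1) (\<kappa> (\<gamma> t))) (at t)"
proof -
  have s: "smooth_into L \<gamma> t" and hom: "\<gamma> (s + t) = \<gamma> s \<otimes> \<gamma> t" for s t
    using \<gamma> by (simp_all add: one_param_subgroup_iff)
  have one: "\<gamma> 0 = \<one>" by (rule hom_real_pow(1)[OF smooth_into_carrier[OF s] hom])
  let ?c = "\<lambda>t. \<kappa> (\<gamma> t)"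
  have c0: "smooth_at 0 ?c" by (rule smooth_at_\<kappa>[OF s]) (simp add: one chart_one)
  have ct: "smooth_at t ?c" by (rule smooth_at_\<kappa>[OF s t])
  have vel: "vel L \<gamma> 0 1 = frechet_derivative ?c (at 0) 1" by (simp add: vel_def one \<kappa>_def)
  have f: "smooth_at x0 (\<lambda>z. \<kappa> (\<gamma> t \<otimes> \<kappa>i z))"
    by (intro smooth_at_\<kappa> smooth_into_mult smooth_into_constant smooth_into_\<kappa>i U_open)
      (use t U_carrier in \<open>simp_all add: \<kappa>i_x0\<close>)
  \<comment> \<open>The homomorphism property is differentiated at s = 0, which identifies the
    velocity at t with the left-invariant field.\<close>
  have "frechet_derivative (\<lambda>s. ?c (t + s)) (at 0) 1 = frechet_derivative (\<lambda>s. \<kappa> (\<gamma> t \<otimes> \<kappa>i (?c s))) (at 0) 1"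
  proof -
    have sm: "smooth_at 0 (\<lambda>s. \<kappa> (\<gamma> t \<otimes> \<kappa>i (?c s)))"
      by (rule smooth_at_compose[OF finite_dim c0]) (simp add: one \<kappa>_one f)
    have "\<forall>\<^sub>F s in nhds 0. \<gamma> s \<in> U" by (rule eventually_U[OF s]) (simp add: one chart_one)
    then have "\<forall>\<^sub>F s in nhds 0. \<kappa> (\<gamma> t \<otimes> \<kappa>i (?c s)) = ?c (t + s)"
      by eventually_elim (simp add: \<kappa>i_\<kappa> hom)
    from frechet_derivative_cong_nhds[OF sm this] show ?thesis by simp
  qed
  also have "\<dots> = inv_field (vel L \<gamma> 0 1) (?c t)"
    using frechet_derivative_chain[OF c0, of "\<lambda>z. \<kappa> (\<gamma> t \<otimes> \<kappa>i z)" 1] f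
    by (simp add: one \<kappa>_one vel inv_field_def \<kappa>i_\<kappa>[OF t])
  also have "frechet_derivative (\<lambda>s. ?c (t + s)) (at 0) 1 = frechet_derivative ?c (at t) 1"
  proof -
    have "((\<lambda>s :: real. t + s) has_derivative (\<lambda>v. v)) (at 0)" by (auto intro!: derivative_eq_intros)
    moreover have "smooth_at 0 (\<lambda>s :: real. t + s)" by (intro smooth_at_add smooth_at_const smooth_at_id)
    ultimately show ?thesis
      using frechet_derivative_chain[of 0 "\<lambda>s. t + s" ?c 1] ct by (simp add: frechet_derivative_eqI)
  qed
  finally have eq: "frechet_derivative ?c (at t) 1 = inv_field (vel L \<gamma> 0 1) (?c t)" .
  have "(?c has_derivative frechet_derivative ?c (at t)) (at t)" by (rule smooth_at_has_derivative[OF ct])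
  moreover have "frechet_derivative ?c (at t) = (\<lambda>h. h *\<^sub>R inv_field (vel L \<gamma> 0 1) (?c t))"
    using linear_scale[OF linear_frechet_derivative_smooth[OF ct], of _ 1] by (simp add: eq fun_eq_iff)
  ultimately show ?thesis by (simp add: has_vector_derivative_def)
qed

text \<open>Near 0 both curves solve the same differential equation; any other value is the n-th
  power of one near 0.\<close>

lemma one_param_subgroup_unique:
  assumes "one_param_subgroup G L \<gamma>1" "one_param_subgroup G L \<gamma>2" "vel L \<gamma>1 0 1 = vel L \<gamma>2 0 1"
  shows "\<gamma>1 = \<gamma>2"
proof -
  define \<xi> where "\<xi> = vel L \<gamma>1 0 1"
  obtain R K where R: "R > 0" "K \<ge> 0" "ball x0 R \<subseteq> \<kappa> ` U" "smooth_on (ball x0 R) (inv_field \<xi>)"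
    and lip: "\<And>x y. x \<in> ball x0 R \<Longrightarrow> y \<in> ball x0 R \<Longrightarrow> norm (inv_field \<xi> x - inv_field \<xi> y) \<le> K * norm (x - y)"
    by (rule inv_field_nice_ball[where \<xi>=\<xi>]) blast
  have near: "\<forall>\<^sub>F t in nhds 0. \<gamma> t \<in> U \<and> \<kappa> (\<gamma> t) \<in> ball x0 R" and one: "\<gamma> 0 = \<one>"
    and cl: "\<gamma> t \<in> carrier G" and pow: "\<gamma> (real n * t) = \<gamma> t [^] n"
    if "one_param_subgroup G L \<gamma>" for \<gamma> t n
  proof -
    have s: "smooth_into L \<gamma> t" and hom: "\<gamma> (s + t) = \<gamma> s \<otimes> \<gamma> t" for s t
      using that by (simp_all add: one_param_subgroup_iff)
    show "\<gamma> t \<in> carrier G" by (rule smooth_into_carrier[OF s])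
    show one: "\<gamma> 0 = \<one>" by (rule hom_real_pow(1)[OF smooth_into_carrier[OF s] hom])
    show "\<gamma> (real n * t) = \<gamma> t [^] n" by (rule hom_real_pow(2)[OF smooth_into_carrier[OF s] hom])
    have U: "\<gamma> 0 \<in> U" by (simp add: one chart_one)
    have "\<forall>\<^sub>F t in nhds 0. \<kappa> (\<gamma> t) \<in> ball x0 R"
      by (rule eventually_compose_isCont[OF smooth_at_imp_isCont[OF smooth_at_\<kappa>[OF s U]]])
        (rule eventually_nhds_in_open, use R in \<open>simp_all add: one \<kappa>_one\<close>)
    then show "\<forall>\<^sub>F t in nhds 0. \<gamma> t \<in> U \<and> \<kappa> (\<gamma> t) \<in> ball x0 R"
      using eventually_U[OF s U] by eventually_elim simp
  qed
  have "\<forall>\<^sub>F t in nhds 0. (\<gamma>1 t \<in> U \<and> \<kappa> (\<gamma>1 t) \<in> ball x0 R) \<and> (\<gamma>2 t \<in> U \<and> \<kappa> (\<gamma>2 t) \<in> ball x0 R)"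
    by (intro eventually_conj near assms)
  then obtain e where e: "e > 0" "\<And>t. dist t 0 < e \<Longrightarrow> (\<gamma>1 t \<in> U \<and> \<kappa> (\<gamma>1 t) \<in> ball x0 R) \<and> (\<gamma>2 t \<in> U \<and> \<kappa> (\<gamma>2 t) \<in> ball x0 R)"
    unfolding eventually_nhds_metric by blast
  define \<delta> where "\<delta> = min (e / 2) (1 / (2 * (K + 1)))"
  have \<delta>: "\<delta> > 0" "\<delta> < e" using e(1) R by (auto simp: \<delta>_def)
  have K\<delta>: "K * \<delta> \<le> 1 / 2"
  proof -
    have "K * \<delta> \<le> K * (1 / (2 * (K + 1)))" using R by (intro mult_left_mono) (simp_all add: \<delta>_def)
    also have "\<dots> \<le> 1 / 2" using R by (simp add: field_simps)
    finally show ?thesis .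
  qed
  have nr: "(\<gamma>1 t \<in> U \<and> \<kappa> (\<gamma>1 t) \<in> ball x0 R) \<and> (\<gamma>2 t \<in> U \<and> \<kappa> (\<gamma>2 t) \<in> ball x0 R)" if "t \<in> {-\<delta>..\<delta>}" for t
    using that \<delta> by (intro e(2)) auto
  have local: "\<gamma>1 t = \<gamma>2 t" if t: "t \<in> {-\<delta>..\<delta>}" for t
  proof -
    have "\<kappa> (\<gamma>1 t) = \<kappa> (\<gamma>2 t)"
    proof (rule ode_unique[where c="\<lambda>t. \<kappa> (\<gamma>1 t)" and b="\<lambda>t. \<kappa> (\<gamma>2 t)", OF lip R(2) _ K\<delta>])
      fix u assume u: "u \<in> {-\<delta>..\<delta>}"
      show "\<kappa> (\<gamma>1 u) \<in> ball x0 R \<and> ((\<lambda>t. \<kappa> (\<gamma>1 t)) has_vector_derivative inv_field \<xi> (\<kappa> (\<gamma>1 u))) (at u)"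
        using nr[OF u] one_param_subgroup_ode[OF assms(1)] by (simp add: \<xi>_def)
      show "\<kappa> (\<gamma>2 u) \<in> ball x0 R \<and> ((\<lambda>t. \<kappa> (\<gamma>2 t)) has_vector_derivative inv_field \<xi> (\<kappa> (\<gamma>2 u))) (at u)"
        using nr[OF u] one_param_subgroup_ode[OF assms(2)] by (simp add: \<xi>_def assms(3))
    qed (use t \<delta> in \<open>auto simp: one[OF assms(1)] one[OF assms(2)]\<close>)
    then show ?thesis using nr[OF t] \<kappa>i_\<kappa> by metis
  qed
  show ?thesis
  proof (rule ext)
    fix t :: real
    obtain n :: nat where n: "\<bar>t\<bar> / \<delta> < real n" using reals_Archimedean2 by blast
    then have "n > 0" using \<delta> by (metis abs_ge_zero divide_nonneg_pos less_le_trans not_gr_zero of_nat_0 linorder_not_less order_less_imp_le)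
    have "\<bar>t / real n\<bar> \<le> \<delta>" using n \<delta> \<open>n > 0\<close> by (simp add: field_simps)
    then have "t / real n \<in> {-\<delta>..\<delta>}" unfolding abs_le_iff atLeastAtMost_iff by linarith
    then have "\<gamma>1 (t / real n) = \<gamma>2 (t / real n)" by (rule local)
    then show "\<gamma>1 t = \<gamma>2 t"
      using pow[OF assms(1), of n "t / real n"] pow[OF assms(2), of n "t / real n"] \<open>n > 0\<close> by simp
  qed
qed

text \<open>Existence and uniqueness resolve the definite description. For a multiple of \<xi> it
  picks the same subgroup run at t times the speed, evaluated at 1.\<close>

lemma lie_exp:
  obtains \<gamma> where "\<And>t. smooth_into L \<gamma> t" "\<And>s t :: real. \<gamma> (s + t) = \<gamma> s \<otimes> \<gamma> t" "vel L \<gamma> 0 1 = \<xi>"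
    "\<And>t. lie_exp G L (t *\<^sub>R \<xi>) = \<gamma> t"
proof -
  obtain \<gamma> where \<gamma>: "one_param_subgroup G L \<gamma>" "vel L \<gamma> 0 1 = \<xi>" using one_param_subgroup_exists by blast
  have s: "smooth_into L \<gamma> t" and hom: "\<gamma> (s + t) = \<gamma> s \<otimes> \<gamma> t" for s t
    using \<gamma>(1) by (simp_all add: one_param_subgroup_iff)
  have "lie_exp G L (t *\<^sub>R \<xi>) = \<gamma> t" for t
  proof -
    let ?\<gamma> = "\<lambda>s. \<gamma> (t * s)"
    have sm: "smooth_at u (\<lambda>s :: real. t * s)" for u by (intro smooth_at_linear bounded_linear_mult_right)
    have "one_param_subgroup G L ?\<gamma>"
      unfolding one_param_subgroup_iff
    proof (intro conjI allI)
      show "smooth_into L ?\<gamma> u" for u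
        by (rule smooth_into_compose[where F=\<gamma>, OF finite_dim_real sm s])
    qed (simp add: distrib_left hom)
    moreover have "vel L ?\<gamma> 0 1 = t *\<^sub>R \<xi>"
    proof -
      have "((\<lambda>s :: real. t * s) has_derivative (\<lambda>s. t * s)) (at 0)" by (auto intro!: derivative_eq_intros)
      then have "vel L ?\<gamma> 0 1 = vel L \<gamma> 0 (t *\<^sub>R 1)"
        using vel_compose[OF sm, of \<gamma> 0 1] s by (simp add: frechet_derivative_eqI)
      then show ?thesis using \<gamma>(2) by (simp only: linear_scale[OF vel_linear[OF s]])
    qed
    ultimately have "(THE \<gamma>. one_param_subgroup G L \<gamma> \<and> tangent_map real_line L \<gamma> 0 1 = t *\<^sub>R \<xi>) = ?\<gamma>"
      unfolding tangent_map_real_line by (intro the_equality) (auto intro: one_param_subgroup_unique)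
    then show ?thesis by (simp add: lie_exp_def)
  qed
  then show ?thesis using that s hom \<gamma>(2) by blast
qed

end

subsection \<open>Smooth families of forms\<close>

text \<open>Smoothness is asked for each fixed list of arguments, exactly as in
  \<open>differential_form\<close>.\<close>

definition smooth_family :: "'a::real_normed_vector \<Rightarrow> ('a \<Rightarrow> 'v mform) \<Rightarrow> bool" where
  "smooth_family x a \<longleftrightarrow> (\<forall>vs. smooth_at x (\<lambda>y. a y vs))"

lemma smooth_family_const: "smooth_family x (\<lambda>y. a)"
  by (simp add: smooth_family_def smooth_at_const)

lemma smooth_family_wedge:
  assumes "smooth_family x a" "smooth_family x b"
  shows "smooth_family x (\<lambda>y. wedge (a y) (b y))"
  unfolding smooth_family_def wedge_def
  using assms by (auto simp: smooth_family_def intro!: smooth_at_sum smooth_at_mult smooth_at_const)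

lemma smooth_family_one_form:
  assumes "\<And>v. smooth_at x (\<lambda>y. f y v)"
  shows "smooth_family x (\<lambda>y. one_form (f y))"
  unfolding smooth_family_def
proof
  fix vs show "smooth_at x (\<lambda>y. one_form (f y) vs)"
    using assms by (cases vs; cases "tl vs") (simp_all add: one_form_def smooth_at_const)
qed

lemma smooth_family_wedge_list:
  assumes "\<And>a. a \<in> set as \<Longrightarrow> smooth_family x a"
  shows "smooth_family x (\<lambda>y. wedge_list (map (\<lambda>a. a y) as))"
  using assms by (induction as) (simp_all add: smooth_family_const smooth_family_wedge)

lemma smooth_family_exp_form:
  assumes "smooth_family x a"
  shows "smooth_family x (\<lambda>y. exp_form (a y))"
proof -
  have "smooth_family x (\<lambda>y. (wedge (a y) ^^ k) unit_form)" for k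
    by (induction k) (simp_all add: smooth_family_const smooth_family_wedge assms)
  then show ?thesis
    unfolding smooth_family_def exp_form_def divide_inverse
    by (intro allI smooth_at_sum smooth_at_mult smooth_at_const) blast
qed

lemma smooth_family_subst_ext:
  assumes "\<And>i v. smooth_at x (\<lambda>y. \<beta> y i v)" "\<And>I. smooth_at x (\<lambda>y. u y I)"
  shows "smooth_family x (\<lambda>y. subst_ext n (\<beta> y) (u y))"
proof -
  have "smooth_family x (\<lambda>y. one_form (\<beta> y i))" for i
    by (rule smooth_family_one_form[OF assms(1)])
  then have "smooth_family x (\<lambda>y. wedge_monomial (\<beta> y) I)" for I
    using smooth_family_wedge_list[of "map (\<lambda>i y. one_form (\<beta> y i)) (sorted_list_of_set I)" x]
    by (auto simp: wedge_monomial_def o_def)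
  then show ?thesis
    unfolding smooth_family_def subst_ext_def
    by (intro allI smooth_at_sum smooth_at_mult assms(2)) blast
qed

lemma exp_form_comp_map: "exp_form a (map f vs) = exp_form (a \<circ> map f) vs"
proof -
  have "(wedge a ^^ k) unit_form (map f vs) = (wedge (a \<circ> map f) ^^ k) unit_form vs" for k vs
  proof (induction k arbitrary: vs)
    case (Suc k)
    have "(wedge a ^^ k) unit_form \<circ> map f = (wedge (a \<circ> map f) ^^ k) unit_form"
      by (rule ext) (simp only: o_apply[of "(wedge a ^^ k) unit_form" "map f"] Suc)
    then show ?case by (simp add: wedge_comp_map o_def)
  qed (simp add: unit_form_def)
  then show ?thesis by (simp add: exp_form_def)
qed

lemma subst_ext_comp_map: "subst_ext n \<beta> u (map f vs) = subst_ext n (\<lambda>i v. \<beta> i (f v)) u vs"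
  by (simp add: subst_ext_def wedge_monomial_def wedge_list_comp_map o_def[of "\<lambda>a. a \<circ> map f"] one_form_comp_map)

subsection \<open>Group valued Hamiltonian manifolds\<close>

locale hamiltonian_manifold = lie_group G L + onb ip es
  for G :: "('a, 'x) monoid_scheme" (structure) and L :: "('a, 'v::real_normed_vector) manifold"
    and ip :: "'v \<Rightarrow> 'v \<Rightarrow> real" and es :: "'v list" +
  fixes \<tau> :: "'a \<Rightarrow> clifford" and M :: "('m, 'w::real_normed_vector) manifold"
    and act :: "'a \<Rightarrow> 'm \<Rightarrow> 'm" and \<omega> :: "'m \<Rightarrow> 'w mform" and \<Phi> :: "'m \<Rightarrow> 'a"
  assumes Ad_inv: "Ad_invariant G L ip" and lift: "pin_lift G L ip es \<tau>"
    and ham: "group_valued_hamiltonian G L ip es M act \<omega> \<Phi>"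
begin

lemma ham_facts:
  shows M_manifold: "smooth_manifold M" and action: "group_action G (points M) act"
    and act_smooth: "smooth_map (prod_manifold L M) M (\<lambda>(g, m). act g m)"
    and \<omega>_form: "differential_form M 2 \<omega>"
    and \<Phi>_smooth: "smooth_map M L \<Phi>"
    and equivariant: "\<And>g m. g \<in> carrier G \<Longrightarrow> m \<in> points M \<Longrightarrow> \<Phi> (act g m) = g \<otimes> \<Phi> m \<otimes> inv g"
    and moment_map: "\<And>m \<xi> v. m \<in> points M \<Longrightarrow> \<omega> m [generating_vf G L M act \<xi> m, v] =
        1 / 2 * ip (theta_L G L (\<Phi> m) (tangent_map M L \<Phi> m v)
                    + theta_R G L (\<Phi> m) (tangent_map M L \<Phi> m v)) \<xi>"
    and kernel_\<omega>: "\<And>m. m \<in> points M \<Longrightarrow> form_kernel (\<omega> m) =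
        {generating_vf G L M act \<xi> m |\<xi>. Ad G L (\<Phi> m) \<xi> + \<xi> = 0}"
  using ham unfolding group_valued_hamiltonian_def G_manifold_def by blast+

sublocale M: mfd M by unfold_locales (rule M_manifold)

lemma \<Phi>_msmooth: "msmooth M L \<Phi>"
  by (rule M.smooth_map_msmooth[OF mfd \<Phi>_smooth])

lemma \<Phi>_carrier: "m \<in> points M \<Longrightarrow> \<Phi> m \<in> carrier G"
  using \<Phi>_smooth continuous_map_image_subset_topspace[of "mtop M" "mtop L" \<Phi>] by (auto simp: smooth_map_def)

text \<open>With g = \<Phi>(m), equivariance gives \<Phi>(exp(-t \<xi>).m) g^-1 = exp(-t \<xi>) (g
  exp(t \<xi>) g^-1). The product rule at t = 0 yields - \<xi> from the first factor and Ad \<xi>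
  from the second.\<close>

lemma theta_R_generating_vf:
  assumes m: "m \<in> points M"
  shows "theta_R G L (\<Phi> m) (tangent_map M L \<Phi> m (generating_vf G L M act \<xi> m)) = Ad G L (\<Phi> m) \<xi> - \<xi>"
proof -
  obtain \<gamma> where s: "\<And>t. smooth_into L \<gamma> t" and hom: "\<And>s t :: real. \<gamma> (s + t) = \<gamma> s \<otimes> \<gamma> t"
    and vel: "vel L \<gamma> 0 1 = \<xi>" and exp: "\<And>t. lie_exp G L (t *\<^sub>R \<xi>) = \<gamma> t"
    by (rule lie_exp) blast
  have cl: "\<gamma> t \<in> carrier G" for t by (rule smooth_into_carrier[OF s])
  have one: "\<gamma> 0 = \<one>" and inv: "\<gamma> (- t) = inv (\<gamma> t)" for t
    by (rule hom_real_pow(1)[OF cl hom], rule hom_real_pow(3)[OF cl hom])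
  let ?g = "\<Phi> m" and ?c = "\<lambda>t. act (\<gamma> (- t)) m"
  have g: "?g \<in> carrier G" by (rule \<Phi>_carrier[OF m])
  have neg: "smooth_at t (uminus :: real \<Rightarrow> real)" for t
    by (rule smooth_at_linear[OF bounded_linear_minus[OF bounded_linear_ident]])
  have sneg: "smooth_into L (\<lambda>t. \<gamma> (- t)) 0"
    by (rule smooth_into_compose[where F=\<gamma>, OF finite_dim_real neg s])
  have c0: "act (\<gamma> 0) m = m"
    using group_action.id_eq_one[OF action] m by (simp add: one) (metis restrict_apply')
  have sc: "smooth_into M ?c 0"
    using smooth_map2_into[OF mfd M_manifold M_manifold act_smooth sneg smooth_into_const[OF m]] by simp
  have "lie_exp G L (- (t *\<^sub>R \<xi>)) = \<gamma> (- t)" for t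
    using exp[of "- t"] by simp
  then have gen: "generating_vf G L M act \<xi> m = vel M ?c 0 1"
    by (simp add: generating_vf_def tangent_map_real_line)
  have "tangent_map M L \<Phi> m (generating_vf G L M act \<xi> m) = vel L (\<lambda>t. \<Phi> (?c t)) 0 1"
    unfolding gen using M.vel_msmooth[OF mfd \<Phi>_msmooth sc, of 1] by (simp add: c0)
  also have "theta_R G L ?g \<dots> = vel L (\<lambda>t. \<Phi> (?c t) \<otimes> inv ?g) 0 1"
    using theta_R_vel[OF M.msmooth_into[OF \<Phi>_msmooth sc], of 1] by (simp add: c0)
  also have "(\<lambda>t. \<Phi> (?c t) \<otimes> inv ?g) = (\<lambda>t. \<gamma> (- t) \<otimes> (?g \<otimes> \<gamma> t \<otimes> inv ?g))"
    by (rule ext) (simp add: equivariant cl m inv m_assoc g)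
  also have "vel L \<dots> 0 1 = vel L (\<lambda>t. \<gamma> (- t)) 0 1 + vel L (\<lambda>t. ?g \<otimes> \<gamma> t \<otimes> inv ?g) 0 1"
    by (rule vel_mult_at_one[OF sneg]) (simp_all add: one g smooth_into_mult smooth_into_constant s)
  also have "vel L (\<lambda>t. ?g \<otimes> \<gamma> t \<otimes> inv ?g) 0 1 = Ad G L ?g \<xi>"
    using Ad_vel[OF s one g, of 1] by (simp add: vel)
  also have "vel L (\<lambda>t. \<gamma> (- t)) 0 1 = - \<xi>"
  proof -
    have "(uminus has_derivative (\<lambda>s :: real. - s)) (at (0 :: real))" by (auto intro!: derivative_eq_intros)
    from frechet_derivative_eqI[OF this] have "frechet_derivative uminus (at (0 :: real)) 1 = - 1" by simp
    then have "vel L (\<lambda>t. \<gamma> (- t)) 0 1 = vel L \<gamma> 0 (- 1)"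
      using vel_compose[OF neg, of \<gamma> 0 1] s by simp
    also have "\<dots> = - \<xi>" using linear_neg[OF vel_linear[OF s]] by (simp add: vel)
    finally show ?thesis .
  qed
  finally show ?thesis by simp
qed

lemma at_point:
  assumes m: "m \<in> points M"
  shows "hamiltonian_point ip es (\<omega> m) (\<lambda>v. theta_R G L (\<Phi> m) (tangent_map M L \<Phi> m v)) (Ad G L (\<Phi> m))
    (\<lambda>\<xi>. generating_vf G L M act \<xi> m) (\<tau> (\<Phi> m))"
proof (intro hamiltonian_point.intro hamiltonian_point_axioms.intro onb_axioms)
  let ?g = "\<Phi> m"
  have g: "?g \<in> carrier G" by (rule \<Phi>_carrier[OF m])
  show "\<exists>B :: 'w set. finite B \<and> span B = UNIV" using M.finite_dim by (simp add: finite_dim_def)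
  show "alternating_form 2 (\<omega> m)" using \<omega>_form m by (simp add: differential_form_def)
  show "linear (\<lambda>v. theta_R G L ?g (tangent_map M L \<Phi> m v))"
    using linear_compose[OF M.tangent_map_linear[OF mfd \<Phi>_msmooth m] theta_R_linear[OF g]] by (simp add: o_def)
  show "linear (Ad G L ?g)" by (rule Ad_linear[OF g])
  show iso: "ip (Ad G L ?g x) (Ad G L ?g y) = ip x y" for x y
    using Ad_inv g by (simp add: Ad_invariant_def)
  show "\<omega> m [generating_vf G L M act \<xi> m, v] = ip (theta_R G L ?g (tangent_map M L \<Phi> m v)) (Ad G L ?g \<xi> + \<xi>) / 2" for \<xi> v
  proof -
    let ?w = "tangent_map M L \<Phi> m v"
    \<comment> \<open>The isometry A is applied to both arguments; it sends \<theta>^L to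
      \<theta>^R.\<close>
    have "ip (theta_L G L ?g ?w) \<xi> = ip (theta_R G L ?g ?w) (Ad G L ?g \<xi>)"
      using iso[of "theta_L G L ?g ?w" \<xi>] by (simp add: Ad_theta_L[OF g])
    then show ?thesis
      using moment_map[OF m] by (simp add: linear_add[OF ip_linear(1)] linear_add[OF ip_linear(2)])
  qed
  show "theta_R G L ?g (tangent_map M L \<Phi> m (generating_vf G L M act \<xi> m)) = Ad G L ?g \<xi> - \<xi>" for \<xi>
    by (rule theta_R_generating_vf[OF m])
  show "form_kernel (\<omega> m) = {generating_vf G L M act \<xi> m |\<xi>. Ad G L ?g \<xi> + \<xi> = 0}" by (rule kernel_\<omega>[OF m])
  show "\<tau> ?g \<in> carrier (pin_group ip es)" using lift g by (auto simp: pin_lift_def hom_def)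
  show "Ad_tilde (length es) (\<tau> ?g) (cl_vec ip es \<xi>) = cl_vec ip es (Ad G L ?g \<xi>)" for \<xi>
    using lift g by (simp add: pin_lift_def)
qed

section \<open>Smoothness of the form in charts, and the theorem\<close>

definition moment_coord :: "'m \<Rightarrow> nat \<Rightarrow> 'w \<Rightarrow> real" where
  "moment_coord m i v = 1 / 2 * ip (theta_R G L (\<Phi> m) (tangent_map M L \<Phi> m v)) (es ! i)"

lemma Gamma_form_eq:
  "Gamma_form G L ip es \<tau> M \<omega> \<Phi> m = wedge (exp_form (\<omega> m)) (subst_ext (length es) (moment_coord m) (\<tau> (\<Phi> m)))"
proof -
  let ?\<beta> = "\<lambda>i v. 1 / 2 * ip (theta_R G L (\<Phi> m) v) (es ! i)"
  have "T_form G L ip es \<tau> (\<Phi> m) = subst_ext (length es) ?\<beta> (\<tau> (\<Phi> m))"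
    by (rule ext) (simp add: T_form_def substitute_forms_def symbol_def subst_ext_def wedge_monomial_def)
  then have "pullback M L \<Phi> (T_form G L ip es \<tau>) m = subst_ext (length es) (moment_coord m) (\<tau> (\<Phi> m))"
    by (intro ext) (simp add: pullback_def subst_ext_comp_map moment_coord_def[abs_def])
  then show ?thesis by (simp add: Gamma_form_def)
qed

text \<open>The charts picked by \<open>chart_at\<close> vary irregularly with the point, so
  smoothness cannot be read off the definition. They drop out: with F for \<Phi> in the chart c, the
  value of \<theta>^R is the derivative at (x, x) along (v, 0) of F(y) F(x)^-1, read in the single
  chart around the identity, and this map is jointly smooth.\<close>

lemma moment_coord_chart_smooth:
  assumes c: "c \<in> atlas M" and z: "z \<in> snd c ` fst c"
  shows "smooth_at z (\<lambda>x. moment_coord (chart_inv c x) i (vel M (chart_inv c) x v))"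
proof -
  let ?U = "snd c ` fst c" and ?F = "\<lambda>x. \<Phi> (chart_inv c x)"
  let ?K = "\<lambda>p. ?F (fst p) \<otimes> inv (?F (snd p))"
  have U: "open ?U" by (rule M.chart_homeo(2)[OF c])
  have ci: "smooth_into M (chart_inv c) x" if "x \<in> ?U" for x by (rule M.smooth_into_chart_inv[OF c that])
  have F: "smooth_into L ?F x" if "x \<in> ?U" for x by (rule M.msmooth_into[OF \<Phi>_msmooth ci[OF that]])
  have K: "smooth_into L ?K (x, x)" if "x \<in> ?U" for x
    using smooth_into_compose[where F="?F" and x="(x, x)" and N=L, OF M.finite_dim smooth_at_linear[OF bounded_linear_fst]]
      smooth_into_compose[where F="?F" and x="(x, x)" and N=L, OF M.finite_dim smooth_at_linear[OF bounded_linear_snd]]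
      F[OF that] by (intro smooth_into_mult smooth_into_inv) simp_all
  have K1: "?K (x, x) = \<one>" if "x \<in> ?U" for x using smooth_into_carrier[OF F[OF that]] by simp
  have \<kappa>K: "smooth_at (x, x) (\<lambda>p. \<kappa> (?K p))" if "x \<in> ?U" for x
    by (rule smooth_at_\<kappa>[OF K[OF that]]) (simp only: K1[OF that] chart_one)
  have D: "theta_R G L (?F x) (tangent_map M L \<Phi> (chart_inv c x) (vel M (chart_inv c) x v))
     = frechet_derivative (\<lambda>p. \<kappa> (?K p)) (at (x, x)) (v, 0)" if x: "x \<in> ?U" for x
  proof -
    have "theta_R G L (?F x) (tangent_map M L \<Phi> (chart_inv c x) (vel M (chart_inv c) x v)) = theta_R G L (?F x) (vel L ?F x v)"
      using M.vel_msmooth[OF mfd \<Phi>_msmooth ci[OF x]] by simp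
    also have "\<dots> = vel L (\<lambda>y. ?F y \<otimes> inv (?F x)) x v" by (rule theta_R_vel[OF F[OF x]])
    also have "\<dots> = frechet_derivative (\<lambda>y. \<kappa> (?K (y, x))) (at x) v"
      using K1[OF x] by (simp add: vel_def \<kappa>_def)
    also have "\<dots> = frechet_derivative (\<lambda>p. \<kappa> (?K p)) (at (x, x)) (v, 0)"
    proof -
      have "((\<lambda>y. (y, x)) has_derivative (\<lambda>v. (v, 0))) (at x)" by (auto intro!: derivative_eq_intros)
      moreover have "smooth_at x (\<lambda>y. (y, x))" by (intro smooth_at_Pair smooth_at_id smooth_at_const)
      ultimately show ?thesis
        using frechet_derivative_chain[of x "\<lambda>y. (y, x)" "\<lambda>p. \<kappa> (?K p)" v] \<kappa>K[OF x] by (simp add: frechet_derivative_eqI)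
    qed
    finally show ?thesis .
  qed
  have "smooth_at z (\<lambda>x. (x, x))" by (intro smooth_at_Pair smooth_at_id)
  from smooth_at_compose[OF finite_dim_prod[OF M.finite_dim M.finite_dim] this smooth_at_derivative[OF \<kappa>K[OF z]]]
  have "smooth_at z (\<lambda>x. frechet_derivative (\<lambda>p. \<kappa> (?K p)) (at (x, x)) (v, 0))" .
  then have "smooth_at z (\<lambda>x. 1 / 2 * ip (frechet_derivative (\<lambda>p. \<kappa> (?K p)) (at (x, x)) (v, 0)) (es ! i))"
    by (intro smooth_at_mult smooth_at_const
        smooth_at_bounded_linear[OF finite_dim_bounded_linear[OF finite_dim ip_linear(2)]])
  then show ?thesis
    by (rule smooth_at_cong)
      (use eventually_nhds_in_open[OF U z] in \<open>eventually_elim, simp add: moment_coord_def D\<close>)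
qed

lemma lift_chart_smooth:
  assumes c: "c \<in> atlas M" and z: "z \<in> snd c ` fst c"
  shows "smooth_at z (\<lambda>x. \<tau> (\<Phi> (chart_inv c x)) I)"
proof -
  interpret R: mfd real_line by unfold_locales (rule smooth_manifold_real_line)
  have "smooth_map L real_line (\<lambda>g. \<tau> g I)" using lift by (simp add: pin_lift_def)
  from smooth_map_into[OF R.chart_open this M.msmooth_into[OF \<Phi>_msmooth M.smooth_into_chart_inv[OF c z]]]
  show ?thesis by (simp add: smooth_into_real_line)
qed

lemma Gamma_form_smooth:
  assumes c: "c \<in> atlas M"
  shows "smooth_on (snd c ` fst c) (\<lambda>x. form_rep M c (\<lambda>m. degree_part k (Gamma_form G L ip es \<tau> M \<omega> \<Phi> m)) x vs)"
proof (rule smooth_onI)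
  fix z assume z: "z \<in> snd c ` fst c"
  let ?p = "chart_inv c" and ?D = "vel M (chart_inv c)"
  have D: "frechet_derivative (coord_rep c (chart_at M (?p x)) id) (at x) = ?D x" for x
    by (simp add: vel_def coord_rep_def o_def)
  have \<omega>: "smooth_family z (form_rep M c \<omega>)"
    unfolding smooth_family_def
  proof
    fix us
    have "smooth_on (snd c ` fst c) (\<lambda>x. form_rep M c \<omega> x us)" using \<omega>_form c by (simp add: differential_form_def)
    then show "smooth_at z (\<lambda>x. form_rep M c \<omega> x us)"
      by (rule smooth_on_imp_smooth_at[OF _ M.chart_homeo(2)[OF c] order_refl z])
  qed
  have "smooth_family z (\<lambda>x. wedge (exp_form (form_rep M c \<omega> x))
     (subst_ext (length es) (\<lambda>i v. moment_coord (?p x) i (?D x v)) (\<tau> (\<Phi> (?p x)))))"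
    by (intro smooth_family_wedge smooth_family_exp_form \<omega> smooth_family_subst_ext
        moment_coord_chart_smooth[OF c z] lift_chart_smooth[OF c z])
  \<comment> \<open>Wedge, exponential and substitution commute with a linear change of arguments,
    so the representative of the form is built from smooth families.\<close>
  moreover have "form_rep M c (\<lambda>m. degree_part k (Gamma_form G L ip es \<tau> M \<omega> \<Phi> m)) x vs
     = (if length vs = k then wedge (exp_form (form_rep M c \<omega> x))
     (subst_ext (length es) (\<lambda>i v. moment_coord (?p x) i (?D x v)) (\<tau> (\<Phi> (?p x)))) vs else 0)" for x
  proof -
    have "form_rep M c \<omega> x = \<omega> (?p x) \<circ> map (?D x)" by (rule ext) (simp add: form_rep_def Let_def D)
    moreover have "exp_form (\<omega> (?p x)) \<circ> map (?D x) = exp_form (\<omega> (?p x) \<circ> map (?D x))"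
      by (rule ext) (simp add: exp_form_comp_map)
    moreover have "subst_ext (length es) (moment_coord (?p x)) u \<circ> map (?D x)
       = subst_ext (length es) (\<lambda>i v. moment_coord (?p x) i (?D x v)) u" for u
      by (rule ext) (simp add: subst_ext_comp_map)
    moreover have "form_rep M c (\<lambda>m. degree_part k (Gamma_form G L ip es \<tau> M \<omega> \<Phi> m)) x vs
      = degree_part k (Gamma_form G L ip es \<tau> M \<omega> \<Phi> (?p x)) (map (?D x) vs)"
      by (simp add: form_rep_def Let_def D)
    ultimately show ?thesis by (simp add: degree_part_def Gamma_form_eq wedge_comp_map)
  qed
  ultimately show "smooth_at z (\<lambda>x. form_rep M c (\<lambda>m. degree_part k (Gamma_form G L ip es \<tau> M \<omega> \<Phi> m)) x vs)"
    by (cases "length vs = k") (simp_all add: smooth_family_def smooth_at_const)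
qed

lemma Gamma_point:
  assumes m: "m \<in> points M"
  shows "alternating (Gamma_form G L ip es \<tau> M \<omega> \<Phi> m)"
    and "\<exists>vs. length vs = mdim M \<and> Gamma_form G L ip es \<tau> M \<omega> \<Phi> m vs \<noteq> 0"
    and "\<And>vs. nondegenerate (\<omega> m) \<Longrightarrow> length vs = mdim M \<Longrightarrow> Gamma_form G L ip es \<tau> M \<omega> \<Phi> m vs
      = (if \<tau> (\<Phi> m) {} < 0 then - 1 else 1) * exp_form (\<omega> m) vs
        / sqrt \<bar>endo_det ip es (\<lambda>\<xi>. (1 / 2) *\<^sub>R (\<xi> + Ad G L (\<Phi> m) \<xi>))\<bar>"
proof -
  interpret P: hamiltonian_point ip es "\<omega> m" "\<lambda>v. theta_R G L (\<Phi> m) (tangent_map M L \<Phi> m v)" "Ad G L (\<Phi> m)"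
    "\<lambda>\<xi>. generating_vf G L M act \<xi> m" "\<tau> (\<Phi> m)"
    by (rule at_point[OF m])
  have \<Gamma>: "Gamma_form G L ip es \<tau> M \<omega> \<Phi> m = wedge P.E (P.P (\<tau> (\<Phi> m)))"
    by (simp add: Gamma_form_eq P.n_def P.\<beta>_def[abs_def] moment_coord_def[abs_def])
  show "alternating (Gamma_form G L ip es \<tau> M \<omega> \<Phi> m)"
    unfolding \<Gamma> by (intro alternating_wedge P.alternating_E P.alternating_P)
  show "\<exists>vs. length vs = mdim M \<and> Gamma_form G L ip es \<tau> M \<omega> \<Phi> m vs \<noteq> 0"
    unfolding \<Gamma> mdim_def by (rule P.top_nonzero)
  show "Gamma_form G L ip es \<tau> M \<omega> \<Phi> m vs
      = (if \<tau> (\<Phi> m) {} < 0 then - 1 else 1) * exp_form (\<omega> m) vs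
        / sqrt \<bar>endo_det ip es (\<lambda>\<xi>. (1 / 2) *\<^sub>R (\<xi> + Ad G L (\<Phi> m) \<xi>))\<bar>"
    if "nondegenerate (\<omega> m)" "length vs = mdim M" for vs
    unfolding \<Gamma> using P.top_nondegenerate that by (simp add: mdim_def)
qed

lemma volume_form_Gamma: "volume_form M (\<lambda>m. degree_part (mdim M) (Gamma_form G L ip es \<tau> M \<omega> \<Phi> m))"
  unfolding volume_form_def differential_form_def
proof (intro conjI ballI allI)
  fix m assume m: "m \<in> points M"
  show "alternating_form (mdim M) (degree_part (mdim M) (Gamma_form G L ip es \<tau> M \<omega> \<Phi> m))"
    by (rule alternating_form_degree_part[OF Gamma_point(1)[OF m]])
  show "\<exists>vs. degree_part (mdim M) (Gamma_form G L ip es \<tau> M \<omega> \<Phi> m) vs \<noteq> 0"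
    using Gamma_point(2)[OF m] by (auto simp: degree_part_def)
qed (rule Gamma_form_smooth)

end

theorem theorem3p1:
  fixes G :: "('a, 'x) monoid_scheme"
    and L :: "('a, 'v::real_normed_vector) manifold"
    and ip :: "'v \<Rightarrow> 'v \<Rightarrow> real"
    and es :: "'v list"
    and \<tau> :: "'a \<Rightarrow> clifford"
  assumes "compact_lie_group G L"
    and "inner_product ip"
    and "Ad_invariant G L ip"
    and "orthonormal_basis ip es"
    and "pin_lift G L ip es \<tau>"
  shows "(\<forall>(M :: ('m, 'w::real_normed_vector) manifold) act \<omega> \<Phi>.
            group_valued_hamiltonian G L ip es M act \<omega> \<Phi> \<longrightarrow>
            volume_form M (\<lambda>m. degree_part (mdim M) (Gamma_form G L ip es \<tau> M \<omega> \<Phi> m)))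
       \<and> (\<exists>\<epsilon> :: 'a \<Rightarrow> real. (\<forall>g\<in>carrier G. \<epsilon> g \<in> {1, - 1}) \<and>
           (\<forall>(M :: ('m, 'w) manifold) act \<omega> \<Phi>.
            group_valued_hamiltonian G L ip es M act \<omega> \<Phi> \<longrightarrow>
            (\<forall>m\<in>points M. nondegenerate (\<omega> m) \<longrightarrow>
               (\<forall>vs. degree_part (mdim M) (Gamma_form G L ip es \<tau> M \<omega> \<Phi> m) vs =
                  \<epsilon> (\<Phi> m) * degree_part (mdim M) (exp_form (\<omega> m)) vs /
                  sqrt \<bar>endo_det ip es (\<lambda>\<xi>. (1 / 2) *\<^sub>R (\<xi> + Ad G L (\<Phi> m) \<xi>))\<bar>))))"
proof -
  \<comment> \<open>A function of the group element alone, hence common to all M. Where \<omega> is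
    nondegenerate the scalar part is nonzero, so the value chosen at scalar part 0 is
    arbitrary.\<close>
  define \<epsilon> :: "'a \<Rightarrow> real" where "\<epsilon> g = (if \<tau> g {} < 0 then - 1 else 1)" for g
  have H: "hamiltonian_manifold G L ip es \<tau> M act \<omega> \<Phi>" if "group_valued_hamiltonian G L ip es M act \<omega> \<Phi>"
    for M :: "('m, 'w) manifold" and act \<omega> \<Phi>
    by unfold_locales (use assms that in auto)
  show ?thesis
  proof (intro conjI allI impI exI[of _ \<epsilon>] ballI)
    show "\<epsilon> g \<in> {1, - 1}" for g by (simp add: \<epsilon>_def)
    fix M :: "('m, 'w) manifold" and act \<omega> \<Phi>
    assume ham: "group_valued_hamiltonian G L ip es M act \<omega> \<Phi>"
    show "volume_form M (\<lambda>m. degree_part (mdim M) (Gamma_form G L ip es \<tau> M \<omega> \<Phi> m))"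
      by (rule hamiltonian_manifold.volume_form_Gamma[OF H[OF ham]])
    fix m vs assume m: "m \<in> points M" and nd: "nondegenerate (\<omega> m)"
    show "degree_part (mdim M) (Gamma_form G L ip es \<tau> M \<omega> \<Phi> m) vs =
                  \<epsilon> (\<Phi> m) * degree_part (mdim M) (exp_form (\<omega> m)) vs /
                  sqrt \<bar>endo_det ip es (\<lambda>\<xi>. (1 / 2) *\<^sub>R (\<xi> + Ad G L (\<Phi> m) \<xi>))\<bar>"
      using hamiltonian_manifold.Gamma_point(3)[OF H[OF ham] m nd, of vs]
      by (simp add: degree_part_def \<epsilon>_def)
  qed
qed

end
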